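(* For every countable ordinal $\xi$, the space $X_\xi$ does not admit any $\ell_p$ ($1\le p<\infty$), nor $c_0$, as a spreading model.
   Context: General notation. $\mathbb N=\{1,2,\dots\}$, $(e_n)$ is the unit vector basis of $c_{00}(\mathbb N)$, $e_n^*$ the coordinate functionals; an element $f\in c_{00}(\mathbb N)$ acts on $c_{00}(\mathbb N)$ by $f(x)=\sum_n f(n)x(n)$. For an interval $E\subset\mathbb N$, $Ef$ is the restriction of $f$ to $E$. $f<g$ means $\max\operatorname{supp}f<\min\operatorname{supp}g$. Schreier families. $\mathcal S_0=\{\{n\}:n\in\mathbb N\}\cup\{\emptyset\}$; $\mathcal S_{\xi+1}=\{F_1\cup\dots\cup F_m: m\in\mathbb N,\ F_i\in\mathcal S_\xi,\ m\le F_1<\dots<F_m\}$; for limit $\xi<\omega_1$ fix $\xi_n\nearrow\xi$ and set $\mathcal S_\xi=\{F: F\in\mathcal S_{\xi_n}\text{ and }n\le F\text{ for some }n\}$. In particular $\mathcal S_1=\{F\text{ finite}:\#F\le\min F\}\cup\{\emptyset\}$. The set $G_\xi$. Fix $\xi<\omega_1$. Let $m_1=2^5$, $m_{j+1}=m_j^5$, $n_1=2^6$, $n_{j+1}=(2n_j)^{s_j}$ where $2^{s_j}=m_{j+1}^3$. Put $G_0=\{\pm e_n^*:n\in\mathbb N\}$ and, for $j\in\mathbb N$, $G_1^j=\{m_{2j-1}^{-2}\sum_{i\in B}\varepsilon_ie_i^*: B\subset\mathbb N,\ 1\le\#B\le n_{2j-1},\ \varepsilon_i\in\{-1,1\}\}$,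 $G_1=\bigcup_jG_1^j$; for $f\in G_1^j$ put $\operatorname{ind}(f)=j$. Let $\mathcal U$ be the set of finite sequences $(f_1,\dots,f_d)$ with $f_1<\dots<f_d$, $f_i\in G_1^{j_i}$, $j_1<\dots<j_d$. Fix a partition $\mathbb N=M_1\cup M_2$ into infinite disjoint sets and an injective map $\sigma_1:\mathcal U\to M_2$ with $\sigma_1(f_1,\dots,f_{i+1})>\sigma_1(f_1,\dots,f_i)$ always. A special sequence is $(f_1,\dots,f_d)\in\mathcal U$ such that $\{\min\operatorname{supp}f_i:i\le d\}\in\mathcal S_\xi$, $f_1\in G_1^{j_1}$ with $j_1\in M_1$, and $f_{i+1}\in G_1^{\sigma_1(f_1,\dots,f_i)}$ for $1\le i<d$. Put $G_{sp}=\{E\sum_{i=1}^d\varepsilon_if_i:(f_1,\dots,f_d)\text{ special},\ \varepsilon_i\in\{-1,1\},\ E\text{ an interval}\}$, and for $\phi=E\sum\varepsilon_if_i\in G_{sp}$ put $\operatorname{ind}(\phi)=\{\operatorname{ind}(f_i):Ef_i\neq0\}$ (for $\phi\in G_1^j$, $\operatorname{ind}(\phi)$ is identified with $\{j\}$). Put $G_{\ell_2}=\{\sum_{i=1}^da_i\phi_i: d\in\mathbb N,\ a_i\in\mathbb Q,\ \sum a_i^2\le1,\ \phi_i\in G_{sp}\cup G_1,\ (\operatorname{ind}\phi_i)_{i=1}^d\text{ pairwise disjoint}\}$ and $G_\xi=G_0\cup G_1\cup G_{sp}\cup G_{\ell_2}$. The set $K_\xi$ and the space $X_\xi$. Let $(\Lambda_i)_{i\in\mathbb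 N}$ be a partition of $\mathbb N$ into pairwise disjoint infinite sets, and $\mathbb N=N_1\cup N_2$ a partition into two infinite sets. Let $\mathbb Q_s$ be the set of finite sequences $(f_1,\dots,f_d)$ of nonzero rational-valued elements of $c_{00}(\mathbb N)$ with $f_1<\dots<f_d$, and fix an injective $\sigma:\mathbb Q_s\to N_2$ with $m_{2\sigma(f_1,\dots,f_d)}^{1/2}>\max\{|f_i(e_l)|^{-1}:l\in\operatorname{supp}f_i,\ i\le d\}\cdot\max\operatorname{supp}f_d$. The $(\mathcal A_n,\theta)$-operation assigns to $f_1<\dots<f_d$, $d\le n$, the vector $\theta(f_1+\dots+f_d)$. $K_\xi$ is the minimal subset of $c_{00}(\mathbb N)$ such that: (1) $K_\xi$ is symmetric, closed under restriction of its elements to intervals, and $G_\xi\subset K_\xi$; (2) $K_\xi$ is closed under the $(\mathcal A_{n_{2j}},m_{2j}^{-1})$-operation for every $j$; (3) $K_\xi$ is closed under the $(\mathcal A_{n_{2j-1}},m_{2j-1}^{-1})$-operation applied to $n_{2j-1}$-attractor sequences, for every $j$; (4) $\sum_{i\in A}\lambda_if_i\in K_\xi$ whenever $A$ is finite, each $f_i\in K_\xi$ is the result of an $(\mathcal A_{n_{j_i}},m_{j_i}^{-1})$-operation on elements of $K_\xi$, $n_{j_i}\ne n_{j_k}$ for $i\neq k$, $\lambda_i\in\mathbb Q$ and $\sum\lambda_i^2\le1$; (5) $K_\xi$ is closed under rational convex combinations. Here $(f_1,\dots,f_d)\in\mathbb Q_s$ is an $n_{2j-1}$-attractor sequence if $d\le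 n_{2j-1}$, all $f_i\in K_\xi$, $f_1$ is the result of an $(\mathcal A_{n_{2j_1}},m_{2j_1}^{-1})$-operation on elements of $K_\xi$ for some $j_1\in N_1$ with $m_{2j_1}>n_{2j-1}^3$, each $f_{2i-1}$ with $i\ge2$ is the result of an $(\mathcal A_{n_{2r}},m_{2r}^{-1})$-operation on elements of $K_\xi$ with $r=\sigma(f_1,\dots,f_{2i-2})$, and each $f_{2i}=e^*_{\lambda_{2i}}$ for some $\lambda_{2i}\in\Lambda_{\sigma(f_1,\dots,f_{2i-1})}$. Put $\|x\|=\sup\{f(x):f\in K_\xi\}$ and let $X_\xi$ be the completion of $(c_{00}(\mathbb N),\|\cdot\|)$. Spreading models. A Banach space admits $\ell_p$ (respectively $c_0$) as a spreading model if it contains a normalized basic sequence $(x_i)_{i\in\mathbb N}$ for which there is $C\ge1$ such that for every $F\in\mathcal S_1$ the sequence $(x_i)_{i\in F}$ is $C$-equivalent to the unit vector basis of $\ell_p^{\#F}$ (respectively $\ell_\infty^{\#F}$). *)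

theory Defs
  imports "HOL-Analysis.Analysis" "HOL-Library.Countable_Set_Type"
begin

section \<open>Countable ordinals\<close>

text \<open>\<^term>\<open>cardSuc natLeq\<close> is a well-order of the least uncountable order type, so the
  elements of the following type are the countable ordinals.\<close>

typedef omega1 = "Field (cardSuc natLeq)"
proof -
  have "Card_order (cardSuc natLeq)"
    by (rule cardSuc_Card_order[OF natLeq_Card_order])
  have "infinite (Field (cardSuc natLeq))"
    using cardSuc_finite[OF natLeq_Card_order] by (simp add: Field_natLeq)
  then show ?thesis
    by (metis ex_in_conv finite.emptyI)
qed

lemma Well_order_cardSuc_natLeq: "Well_order (cardSuc natLeq)"
  using cardSuc_Card_order[OF natLeq_Card_order] card_order_on_well_order_on by blast

instantiation omega1 :: wellorder
begin

definition less_eq_omega1 :: "omega1 \<Rightarrow> omega1 \<Rightarrow> bool" where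
  "(a::omega1) \<le> b \<longleftrightarrow> (Rep_omega1 a, Rep_omega1 b) \<in> cardSuc natLeq"

definition less_omega1 :: "omega1 \<Rightarrow> omega1 \<Rightarrow> bool" where
  "(a::omega1) < b \<longleftrightarrow> a \<le> b \<and> a \<noteq> b"

instance
proof
  note W = Well_order_cardSuc_natLeq
  have lin: "Linear_order (cardSuc natLeq)"
    using W unfolding well_order_on_def by blast
  have tr: "trans (cardSuc natLeq)" and anti: "antisym (cardSuc natLeq)"
    and tot: "total_on (Field (cardSuc natLeq)) (cardSuc natLeq)"
    and re: "refl_on (Field (cardSuc natLeq)) (cardSuc natLeq)"
    using lin unfolding linear_order_on_def partial_order_on_def preorder_on_def by auto
  fix x y z :: omega1
  show refl: "x \<le> x"
    unfolding less_eq_omega1_def using re Rep_omega1 by (auto simp: refl_on_def)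
  show asym: "x \<le> y \<Longrightarrow> y \<le> x \<Longrightarrow> x = y"
    unfolding less_eq_omega1_def using anti by (metis Rep_omega1_inject antisymD)
  show "x \<le> y \<Longrightarrow> y \<le> z \<Longrightarrow> x \<le> z"
    unfolding less_eq_omega1_def using tr by (meson transD)
  show "x < y \<longleftrightarrow> x \<le> y \<and> \<not> y \<le> x"
    unfolding less_omega1_def using refl asym by blast
  show "x \<le> y \<or> y \<le> x"
    using tot re Rep_omega1[of x] Rep_omega1[of y] unfolding less_eq_omega1_def
    by (metis refl_onD total_on_def)
next
  fix P :: "omega1 \<Rightarrow> bool" and a :: omega1
  assume step: "\<And>x. (\<And>y. y < x \<Longrightarrow> P y) \<Longrightarrow> P x"
  have "wf (cardSuc natLeq - Id)"
    using Well_order_cardSuc_natLeq unfolding well_order_on_def by blast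
  then have wf: "wf (inv_image (cardSuc natLeq - Id) Rep_omega1)"
    by (rule wf_inv_image)
  show "P a"
  proof (induction a rule: wf_induct_rule[OF wf])
    case (1 x)
    show ?case
      by (rule step, rule 1)
        (auto simp: in_inv_image less_omega1_def less_eq_omega1_def Rep_omega1_inject)
  qed
qed

end

lemma countable_atMost_omega1: "countable {..\<xi>::omega1}"
proof -
  include cardinal_syntax
  have C: "Card_order (cardSuc natLeq)"
    by (rule cardSuc_Card_order[OF natLeq_Card_order])
  have "|underS (cardSuc natLeq) (Rep_omega1 \<xi>)| <o cardSuc natLeq"
    by (rule card_of_underS[OF C Rep_omega1])
  then have "|underS (cardSuc natLeq) (Rep_omega1 \<xi>)| \<le>o natLeq"
    using cardSuc_ordLeq_ordLess[OF natLeq_Card_order card_of_Card_order] by blast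
  then have "countable (underS (cardSuc natLeq) (Rep_omega1 \<xi>))"
    using countable_card_le_natLeq by blast
  moreover have "Rep_omega1 ` {..<\<xi>} \<subseteq> underS (cardSuc natLeq) (Rep_omega1 \<xi>)"
    by (auto simp: underS_def less_omega1_def less_eq_omega1_def Rep_omega1_inject)
  ultimately have "countable (Rep_omega1 ` {..<\<xi>})"
    using countable_subset by blast
  then have "countable {..<\<xi>}"
    by (rule countable_image_inj_on) (auto simp: inj_on_def Rep_omega1_inject)
  moreover have "{..\<xi>} = insert \<xi> {..<\<xi>}"
    by auto
  ultimately show ?thesis by simp
qed

lemma uncountable_UNIV_omega1: "uncountable (UNIV :: omega1 set)"
proof
  include cardinal_syntax
  assume "countable (UNIV :: omega1 set)"
  then have "countable (range Rep_omega1)" by simp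
  then have "countable (Field (cardSuc natLeq))"
    using type_definition.Rep_range[OF type_definition_omega1] by simp
  then have "|Field (cardSuc natLeq)| \<le>o natLeq"
    using countable_card_le_natLeq by blast
  moreover have "natLeq <o |Field (cardSuc natLeq)|"
    using cardSuc_greater[OF natLeq_Card_order]
      card_of_Field_ordIso[OF cardSuc_Card_order[OF natLeq_Card_order]]
      ordLess_ordIso_trans ordIso_symmetric by blast
  ultimately show False
    using not_ordLess_ordLeq by blast
qed

definition ozero :: omega1 where
  "ozero = (LEAST \<eta>. True)"

definition osuc :: "omega1 \<Rightarrow> omega1" where
  "osuc \<xi> = (LEAST \<eta>. \<xi> < \<eta>)"

definition olimit :: "omega1 \<Rightarrow> bool" where
  "olimit \<xi> \<longleftrightarrow> \<xi> \<noteq> ozero \<and> (\<forall>\<eta>. \<xi> \<noteq> osuc \<eta>)"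

lemma less_osuc: "\<xi> < osuc \<xi>"
proof -
  have "\<exists>\<eta>. \<xi> < \<eta>"
  proof (rule ccontr)
    assume "\<nexists>\<eta>. \<xi> < \<eta>"
    then have "{..\<xi>} = UNIV" by (auto simp: not_less)
    then show False
      using countable_atMost_omega1[of \<xi>] uncountable_UNIV_omega1 by simp
  qed
  then show ?thesis unfolding osuc_def by (rule LeastI_ex)
qed

lemma osuc_inj: "osuc \<xi> = osuc \<eta> \<Longrightarrow> \<xi> = \<eta>"
  by (metis less_osuc linorder_neqE not_less_Least osuc_def)

lemma ozero_neq_osuc: "ozero \<noteq> osuc \<xi>"
  by (metis less_osuc not_less_Least ozero_def)


section \<open>Schreier families\<close>

text \<open>The paper's set of natural numbers is \<open>{1, 2, \<dots>}\<close>. Throughout, objects indexed by it are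
  indexed by \<^typ>\<open>nat\<close>, and only the indices \<open>\<ge> 1\<close> are meaningful.

  \<open>L \<xi> n\<close> is the \<open>n\<close>-th term of the sequence chosen for the limit ordinal \<open>\<xi>\<close>.\<close>

definition ladder_system :: "(omega1 \<Rightarrow> nat \<Rightarrow> omega1) \<Rightarrow> bool" where
  "ladder_system L \<longleftrightarrow> (\<forall>\<xi>. olimit \<xi> \<longrightarrow>
     (\<forall>m\<ge>1. \<forall>n\<ge>m. L \<xi> m \<le> L \<xi> n) \<and> (\<forall>n\<ge>1. L \<xi> n < \<xi>) \<and> (\<forall>\<eta><\<xi>. \<exists>n\<ge>1. \<eta> < L \<xi> n))"

text \<open>In the successor clause some of the \<open>F i\<close> may be empty, so the order conditions
  are stated elementwise; in particular \<open>m \<le> F i\<close> is required of every \<open>i\<close>.\<close>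

inductive schreier :: "(omega1 \<Rightarrow> nat \<Rightarrow> omega1) \<Rightarrow> omega1 \<Rightarrow> nat set \<Rightarrow> bool" for L where
  zero_empty: "schreier L ozero {}"
| zero_single: "n \<ge> 1 \<Longrightarrow> schreier L ozero {n}"
| succ: "\<lbrakk>m \<ge> 1; \<And>i. i < m \<Longrightarrow> schreier L \<xi> (F i);
    \<forall>i<m. \<forall>a\<in>F i. m \<le> a; \<forall>i j. i < j \<and> j < m \<longrightarrow> (\<forall>a\<in>F i. \<forall>b\<in>F j. a < b)\<rbrakk>
    \<Longrightarrow> schreier L (osuc \<xi>) (\<Union>i<m. F i)"
| limit: "\<lbrakk>olimit \<xi>; n \<ge> 1; schreier L (L \<xi> n) F; \<forall>a\<in>F. n \<le> a\<rbrakk> \<Longrightarrow> schreier L \<xi> F"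

definition schreier1 :: "nat set set" where
  "schreier1 = {F. F = {} \<or> (finite F \<and> card F \<le> Min F)}"

lemma schreier_ozero_iff: "schreier L ozero F \<longleftrightarrow> F = {} \<or> (\<exists>n\<ge>1. F = {n})"
proof
  assume "schreier L ozero F"
  then show "F = {} \<or> (\<exists>n\<ge>1. F = {n})"
  proof cases
    case zero_empty
    then show ?thesis by simp
  next
    case (zero_single n)
    then show ?thesis by simp
  next
    case (succ m \<xi> G)
    have False using succ(1) ozero_neq_osuc[of \<xi>] by simp
    then show ?thesis ..
  next
    case (limit n)
    have False using limit(1) unfolding olimit_def by simp
    then show ?thesis ..
  qed
next
  show "F = {} \<or> (\<exists>n\<ge>1. F = {n}) \<Longrightarrow> schreier L ozero F"
    by (elim disjE exE conjE; simp only: zero_empty zero_single)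
qed

lemma schreier_osuc_ozero_iff: "schreier L (osuc ozero) F \<longleftrightarrow> F \<in> schreier1"
proof
  assume "schreier L (osuc ozero) F"
  then show "F \<in> schreier1"
  proof cases
    case (succ m \<xi> G)
    have "\<xi> = ozero" using succ(1) osuc_inj by metis
    then have G: "G i = {} \<or> (\<exists>n. G i = {n})" if "i < m" for i
      using succ(4)[OF that] \<open>\<xi> = ozero\<close> schreier_ozero_iff[of L "G i"] by blast
    have "finite (G i)" if "i < m" for i using G[OF that] by auto
    then have fin: "finite F" unfolding succ(2) by blast
    have "card F \<le> (\<Sum>i<m. card (G i))" unfolding succ(2) by (rule card_UN_le) simp
    also have "\<dots> \<le> (\<Sum>i<m. 1)"
      by (rule sum_mono) (use G in fastforce)
    finally have "card F \<le> m" by simp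
    moreover have "m \<le> Min F" if "F \<noteq> {}"
    proof -
      have "\<forall>a\<in>F. m \<le> a" unfolding succ(2) using succ(5) by blast
      then show ?thesis using fin that by simp
    qed
    ultimately show ?thesis using fin unfolding schreier1_def by force
  next
    case zero_empty
    then have False using ozero_neq_osuc[of ozero] by simp
    then show ?thesis ..
  next
    case (zero_single n)
    then have False using ozero_neq_osuc[of ozero] by simp
    then show ?thesis ..
  next
    case (limit n)
    then have False unfolding olimit_def by blast
    then show ?thesis ..
  qed
next
  assume F: "F \<in> schreier1"
  show "schreier L (osuc ozero) F"
  proof (cases "F = {}")
    case True
    have "schreier L (osuc ozero) (\<Union>i<(1::nat). {})"
      by (rule schreier.succ) (auto intro: zero_empty)
    then show ?thesis using True by simp
  next
    case False
    define xs where "xs = sorted_list_of_set F"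
    have fin: "finite F" and c: "card F \<le> Min F" using F False unfolding schreier1_def by auto
    have xs: "set xs = F" "length xs = card F" "sorted_wrt (<) xs"
      using fin unfolding xs_def by auto
    have ge: "card F \<le> a" if "a \<in> F" for a
      using c Min_le[OF fin that] by linarith
    have pos: "card F \<ge> 1" using fin False by (simp add: Suc_leI card_gt_0_iff)
    have "schreier L (osuc ozero) (\<Union>i<card F. {xs ! i})"
    proof (rule schreier.succ)
      fix i assume "i < card F"
      then have "xs ! i \<in> F" using xs by (metis nth_mem)
      then show "schreier L ozero {xs ! i}" using ge pos by (blast intro: zero_single order_trans)
    next
      show "\<forall>i<card F. \<forall>a\<in>{xs ! i}. card F \<le> a"
        using xs ge by (metis nth_mem singletonD)
      show "\<forall>i j. i < j \<and> j < card F \<longrightarrow> (\<forall>a\<in>{xs ! i}. \<forall>b\<in>{xs ! j}. a < b)"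
        using xs by (simp add: sorted_wrt_nth_less)
    qed (use pos in auto)
    moreover have "(\<Union>i<card F. {xs ! i}) = F"
      using xs by (auto simp: set_conv_nth)
    ultimately show ?thesis by simp
  qed
qed


section \<open>Finitely supported sequences\<close>

definition supp :: "(nat \<Rightarrow> real) \<Rightarrow> nat set" where
  "supp f = {n. f n \<noteq> 0}"

definition c00 :: "(nat \<Rightarrow> real) set" where
  "c00 = {f. finite (supp f) \<and> f 0 = 0}"

definition unit_vec :: "nat \<Rightarrow> nat \<Rightarrow> real" where
  "unit_vec n = (\<lambda>k. if k = n then 1 else 0)"

definition act :: "(nat \<Rightarrow> real) \<Rightarrow> (nat \<Rightarrow> real) \<Rightarrow> real" where
  "act f x = (\<Sum>n\<in>supp f. f n * x n)"

definition nat_interval :: "nat set \<Rightarrow> bool" where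
  "nat_interval E \<longleftrightarrow> (\<forall>a\<in>E. \<forall>c\<in>E. \<forall>b. a \<le> b \<and> b \<le> c \<longrightarrow> b \<in> E)"

definition restr :: "nat set \<Rightarrow> (nat \<Rightarrow> real) \<Rightarrow> nat \<Rightarrow> real" where
  "restr E f = (\<lambda>n. if n \<in> E then f n else 0)"

text \<open>Equivalent to \<open>max supp f < min supp g\<close> for nonzero vectors. The zero vector precedes and
  follows everything.\<close>

definition before :: "(nat \<Rightarrow> real) \<Rightarrow> (nat \<Rightarrow> real) \<Rightarrow> bool" where
  "before f g \<longleftrightarrow> (\<forall>a\<in>supp f. \<forall>b\<in>supp g. a < b)"

definition successive :: "(nat \<Rightarrow> real) list \<Rightarrow> bool" where
  "successive fs \<longleftrightarrow> sorted_wrt before fs"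


section \<open>The norming set of the ground space\<close>

fun mseq :: "nat \<Rightarrow> nat" where
  "mseq 0 = 0"
| "mseq (Suc 0) = 2 ^ 5"
| "mseq (Suc (Suc j)) = mseq (Suc j) ^ 5"

definition sexp :: "nat \<Rightarrow> nat" where
  "sexp j = (THE s. (2::nat) ^ s = mseq (Suc j) ^ 3)"

fun nseq :: "nat \<Rightarrow> nat" where
  "nseq 0 = 0"
| "nseq (Suc 0) = 2 ^ 6"
| "nseq (Suc (Suc j)) = (2 * nseq (Suc j)) ^ sexp (Suc j)"

lemma mseq_Suc: "mseq (Suc j) = 2 ^ (5 ^ Suc j)"
proof (induction j)
  case (Suc j)
  have "mseq (Suc (Suc j)) = (2 ^ (5 ^ Suc j)) ^ 5"
    using Suc by simp
  also have "\<dots> = 2 ^ (5 ^ Suc j * 5)"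
    by (rule power_mult[symmetric])
  finally show ?case by (simp only: power_Suc mult.commute)
qed simp

lemma two_power_sexp: "2 ^ sexp j = mseq (Suc j) ^ 3"
proof -
  have "\<exists>!s. (2::nat) ^ s = mseq (Suc j) ^ 3"
  proof (rule ex1I)
    show "(2::nat) ^ (5 ^ Suc j * 3) = mseq (Suc j) ^ 3"
      unfolding mseq_Suc by (rule power_mult)
    show "(2::nat) ^ s = mseq (Suc j) ^ 3 \<Longrightarrow> s = 5 ^ Suc j * 3" for s
      unfolding mseq_Suc power_mult[symmetric] by (simp only: power_inject_exp one_less_numeral_iff semiring_norm)
  qed
  then show ?thesis unfolding sexp_def by (rule theI')
qed

definition G0 :: "(nat \<Rightarrow> real) set" where
  "G0 = {(\<lambda>k. s * unit_vec n k) | s n. s \<in> {-1, 1} \<and> n \<ge> 1}"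

definition G1j :: "nat \<Rightarrow> (nat \<Rightarrow> real) set" where
  "G1j j = {(\<lambda>k. (\<Sum>i\<in>B. \<epsilon> i * unit_vec i k) / real (mseq (2 * j - 1)) ^ 2) | B \<epsilon>.
     j \<ge> 1 \<and> finite B \<and> B \<subseteq> {1..} \<and> 1 \<le> card B \<and> card B \<le> nseq (2 * j - 1)
     \<and> (\<forall>i\<in>B. \<epsilon> i \<in> {-1, 1})}"

definition G1 :: "(nat \<Rightarrow> real) set" where
  "G1 = (\<Union>j\<in>{1..}. G1j j)"

definition Useq :: "(nat \<Rightarrow> real) list set" where
  "Useq = {fs. fs \<noteq> [] \<and> successive fs \<and>
     (\<exists>js. length js = length fs \<and> sorted_wrt (<) js \<and> (\<forall>i<length fs. fs ! i \<in> G1j (js ! i)))}"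

definition partition_pair :: "nat set \<Rightarrow> nat set \<Rightarrow> bool" where
  "partition_pair A B \<longleftrightarrow> A \<union> B = {1..} \<and> A \<inter> B = {} \<and> infinite A \<and> infinite B"

definition coding1 :: "nat set \<Rightarrow> ((nat \<Rightarrow> real) list \<Rightarrow> nat) \<Rightarrow> bool" where
  "coding1 M2 \<sigma>1 \<longleftrightarrow> inj_on \<sigma>1 Useq \<and> \<sigma>1 ` Useq \<subseteq> M2 \<and>
     (\<forall>fs f. fs \<noteq> [] \<and> fs @ [f] \<in> Useq \<longrightarrow> \<sigma>1 fs < \<sigma>1 (fs @ [f]))"

text \<open>Lists are indexed from 0, so \<open>fs ! k\<close> is the paper's \<open>f\<^bsub>k+1\<^esub>\<close> and
  \<open>take k fs\<close> is the sequence of its predecessors.\<close>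

definition special :: "(omega1 \<Rightarrow> nat \<Rightarrow> omega1) \<Rightarrow> omega1 \<Rightarrow> nat set \<Rightarrow> ((nat \<Rightarrow> real) list \<Rightarrow> nat)
    \<Rightarrow> (nat \<Rightarrow> real) list \<Rightarrow> bool" where
  "special L \<xi> M1 \<sigma>1 fs \<longleftrightarrow> fs \<in> Useq \<and> schreier L \<xi> ((\<lambda>f. Min (supp f)) ` set fs) \<and>
     (\<exists>j\<in>M1. fs ! 0 \<in> G1j j) \<and>
     (\<forall>k. 1 \<le> k \<and> k < length fs \<longrightarrow> fs ! k \<in> G1j (\<sigma>1 (take k fs)))"

text \<open>Pairs \<open>(\<phi>, ind \<phi>)\<close> for the special functionals \<open>\<phi>\<close>.\<close>

definition Gsp_ind :: "(omega1 \<Rightarrow> nat \<Rightarrow> omega1) \<Rightarrow> omega1 \<Rightarrow> nat set \<Rightarrow> ((nat \<Rightarrow> real) list \<Rightarrow> nat)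
    \<Rightarrow> ((nat \<Rightarrow> real) \<times> nat set) set" where
  "Gsp_ind L \<xi> M1 \<sigma>1 =
     {(restr E (\<lambda>n. \<Sum>i<length fs. \<epsilon> i * (fs ! i) n),
       {j. \<exists>i<length fs. fs ! i \<in> G1j j \<and> restr E (fs ! i) \<noteq> (\<lambda>_. 0)}) | E fs \<epsilon>.
      special L \<xi> M1 \<sigma>1 fs \<and> nat_interval E \<and> (\<forall>i<length fs. \<epsilon> i \<in> {-1, 1::real})}"

definition Gsp :: "(omega1 \<Rightarrow> nat \<Rightarrow> omega1) \<Rightarrow> omega1 \<Rightarrow> nat set \<Rightarrow> ((nat \<Rightarrow> real) list \<Rightarrow> nat)
    \<Rightarrow> (nat \<Rightarrow> real) set" where
  "Gsp L \<xi> M1 \<sigma>1 = fst ` Gsp_ind L \<xi> M1 \<sigma>1"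

definition G1_ind :: "((nat \<Rightarrow> real) \<times> nat set) set" where
  "G1_ind = {(f, {j}) | f j. f \<in> G1j j}"

definition Gl2 :: "(omega1 \<Rightarrow> nat \<Rightarrow> omega1) \<Rightarrow> omega1 \<Rightarrow> nat set \<Rightarrow> ((nat \<Rightarrow> real) list \<Rightarrow> nat)
    \<Rightarrow> (nat \<Rightarrow> real) set" where
  "Gl2 L \<xi> M1 \<sigma>1 = {(\<lambda>n. \<Sum>i\<in>{1..d}. a i * \<phi> i n) | d a \<phi> I.
     d \<ge> (1::nat) \<and> (\<forall>i\<in>{1..d}. a i \<in> \<rat>) \<and> (\<Sum>i\<in>{1..d}. (a i)\<^sup>2) \<le> 1 \<and>
     (\<forall>i\<in>{1..d}. (\<phi> i, I i) \<in> Gsp_ind L \<xi> M1 \<sigma>1 \<union> G1_ind) \<and>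
     (\<forall>i\<in>{1..d}. \<forall>k\<in>{1..d}. i \<noteq> k \<longrightarrow> I i \<inter> I k = {})}"

definition Gset :: "(omega1 \<Rightarrow> nat \<Rightarrow> omega1) \<Rightarrow> omega1 \<Rightarrow> nat set \<Rightarrow> ((nat \<Rightarrow> real) list \<Rightarrow> nat)
    \<Rightarrow> (nat \<Rightarrow> real) set" where
  "Gset L \<xi> M1 \<sigma>1 = G0 \<union> G1 \<union> Gsp L \<xi> M1 \<sigma>1 \<union> Gl2 L \<xi> M1 \<sigma>1"


section \<open>The norming set and the norm of the attractor space\<close>

definition partition_family :: "(nat \<Rightarrow> nat set) \<Rightarrow> bool" where
  "partition_family \<Lambda> \<longleftrightarrow> (\<Union>i\<in>{1..}. \<Lambda> i) = {1..} \<and> (\<forall>i\<ge>1. infinite (\<Lambda> i)) \<and>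
     (\<forall>i\<ge>1. \<forall>k\<ge>1. i \<noteq> k \<longrightarrow> \<Lambda> i \<inter> \<Lambda> k = {})"

definition Qs :: "(nat \<Rightarrow> real) list set" where
  "Qs = {fs. fs \<noteq> [] \<and> successive fs \<and>
     (\<forall>f\<in>set fs. f \<in> c00 \<and> f \<noteq> (\<lambda>_. 0) \<and> (\<forall>n. f n \<in> \<rat>))}"

definition coding :: "nat set \<Rightarrow> ((nat \<Rightarrow> real) list \<Rightarrow> nat) \<Rightarrow> bool" where
  "coding N2 \<sigma> \<longleftrightarrow> inj_on \<sigma> Qs \<and> \<sigma> ` Qs \<subseteq> N2 \<and>
     (\<forall>fs\<in>Qs. sqrt (real (mseq (2 * \<sigma> fs))) >
        Max {inverse \<bar>f l\<bar> | f l. f \<in> set fs \<and> l \<in> supp f} * real (Max (supp (last fs))))"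

text \<open>\<open>f\<close> is the result of an \<open>(\<A>\<^bsub>n\<^esub>, \<theta>)\<close>-operation on elements of \<open>A\<close>.\<close>

definition op_result :: "(nat \<Rightarrow> real) set \<Rightarrow> nat \<Rightarrow> real \<Rightarrow> (nat \<Rightarrow> real) \<Rightarrow> bool" where
  "op_result A n \<theta> f \<longleftrightarrow> (\<exists>fs. fs \<noteq> [] \<and> length fs \<le> n \<and> set fs \<subseteq> A \<and> successive fs \<and>
     f = (\<lambda>k. \<theta> * (\<Sum>i<length fs. (fs ! i) k)))"

text \<open>\<open>n\<^bsub>2j-1\<^esub>\<close>-attractor sequences of elements of \<open>A\<close>. With indexing from 0, the paper's odd
  (even) positions are the even (odd) indices.\<close>

definition attractor_seq :: "(nat \<Rightarrow> nat set) \<Rightarrow> nat set \<Rightarrow> ((nat \<Rightarrow> real) list \<Rightarrow> nat)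
    \<Rightarrow> (nat \<Rightarrow> real) set \<Rightarrow> nat \<Rightarrow> (nat \<Rightarrow> real) list \<Rightarrow> bool" where
  "attractor_seq \<Lambda> N1 \<sigma> A j fs \<longleftrightarrow> fs \<in> Qs \<and> length fs \<le> nseq (2 * j - 1) \<and> set fs \<subseteq> A \<and>
     (\<exists>j1\<in>N1. mseq (2 * j1) > nseq (2 * j - 1) ^ 3 \<and>
        op_result A (nseq (2 * j1)) (1 / real (mseq (2 * j1))) (fs ! 0)) \<and>
     (\<forall>k. even k \<and> 2 \<le> k \<and> k < length fs \<longrightarrow>
        op_result A (nseq (2 * \<sigma> (take k fs))) (1 / real (mseq (2 * \<sigma> (take k fs)))) (fs ! k)) \<and>
     (\<forall>k. odd k \<and> k < length fs \<longrightarrow> (\<exists>l\<in>\<Lambda> (\<sigma> (take k fs)). fs ! k = unit_vec l))"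

definition K_closed :: "(nat \<Rightarrow> real) set \<Rightarrow> (nat \<Rightarrow> nat set) \<Rightarrow> nat set
    \<Rightarrow> ((nat \<Rightarrow> real) list \<Rightarrow> nat) \<Rightarrow> (nat \<Rightarrow> real) set \<Rightarrow> bool" where
  "K_closed G \<Lambda> N1 \<sigma> A \<longleftrightarrow>
     (\<forall>f\<in>A. (\<lambda>n. - f n) \<in> A) \<and> (\<forall>f\<in>A. \<forall>E. nat_interval E \<longrightarrow> restr E f \<in> A) \<and> G \<subseteq> A \<and>
     (\<forall>j\<ge>1. \<forall>f. op_result A (nseq (2 * j)) (1 / real (mseq (2 * j))) f \<longrightarrow> f \<in> A) \<and>
     (\<forall>j\<ge>1. \<forall>fs. attractor_seq \<Lambda> N1 \<sigma> A j fs \<longrightarrow>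
        (\<lambda>n. 1 / real (mseq (2 * j - 1)) * (\<Sum>i<length fs. (fs ! i) n)) \<in> A) \<and>
     (\<forall>(I::nat set) c f j. finite I \<and>
        (\<forall>i\<in>I. f i \<in> A \<and> j i \<ge> 1 \<and> op_result A (nseq (j i)) (1 / real (mseq (j i))) (f i)) \<and>
        inj_on (\<lambda>i. nseq (j i)) I \<and> (\<forall>i\<in>I. c i \<in> \<rat>) \<and> (\<Sum>i\<in>I. (c i)\<^sup>2) \<le> 1 \<longrightarrow>
        (\<lambda>n. \<Sum>i\<in>I. c i * f i n) \<in> A) \<and>
     (\<forall>(I::nat set) c f. finite I \<and> (\<forall>i\<in>I. f i \<in> A \<and> c i \<in> \<rat> \<and> c i \<ge> 0) \<and>
        (\<Sum>i\<in>I. c i) = 1 \<longrightarrow> (\<lambda>n. \<Sum>i\<in>I. c i * f i n) \<in> A)"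

definition K_gen :: "(nat \<Rightarrow> real) set \<Rightarrow> (nat \<Rightarrow> nat set) \<Rightarrow> nat set
    \<Rightarrow> ((nat \<Rightarrow> real) list \<Rightarrow> nat) \<Rightarrow> (nat \<Rightarrow> real) set" where
  "K_gen G \<Lambda> N1 \<sigma> = \<Inter>{A. A \<subseteq> c00 \<and> K_closed G \<Lambda> N1 \<sigma> A}"

definition Kset :: "(omega1 \<Rightarrow> nat \<Rightarrow> omega1) \<Rightarrow> omega1 \<Rightarrow> nat set \<Rightarrow> ((nat \<Rightarrow> real) list \<Rightarrow> nat)
    \<Rightarrow> (nat \<Rightarrow> nat set) \<Rightarrow> nat set \<Rightarrow> ((nat \<Rightarrow> real) list \<Rightarrow> nat) \<Rightarrow> (nat \<Rightarrow> real) set" where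
  "Kset L \<xi> M1 \<sigma>1 \<Lambda> N1 \<sigma> = K_gen (Gset L \<xi> M1 \<sigma>1) \<Lambda> N1 \<sigma>"

definition norm_of :: "(nat \<Rightarrow> real) set \<Rightarrow> (nat \<Rightarrow> real) \<Rightarrow> real" where
  "norm_of K x = (SUP f\<in>K. act f x)"

text \<open>The minimal set exists: \<^const>\<open>c00\<close> itself is closed, so the intersection is over a
  nonempty family, and the intersection is closed.\<close>

lemma c00_sum:
  assumes "finite I" "\<And>i. i \<in> I \<Longrightarrow> f i \<in> c00"
  shows "(\<lambda>n. \<Sum>i\<in>I. c i * f i n) \<in> c00"
proof -
  have "supp (\<lambda>n. \<Sum>i\<in>I. c i * f i n) \<subseteq> (\<Union>i\<in>I. supp (f i))"
    unfolding supp_def by (auto intro: ccontr simp: sum.neutral)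
  moreover have "finite (\<Union>i\<in>I. supp (f i))"
    using assms by (auto simp: c00_def)
  ultimately show ?thesis
    using assms by (auto simp: c00_def intro: finite_subset)
qed

lemma c00_scale: "f \<in> c00 \<Longrightarrow> (\<lambda>n. c * f n) \<in> c00"
  using c00_sum[of "{()}" "\<lambda>_. f" "\<lambda>_. c"] by simp

lemma c00_restr: "f \<in> c00 \<Longrightarrow> restr E f \<in> c00"
  unfolding c00_def supp_def restr_def by (auto elim!: rev_finite_subset)

lemma c00_unit_vec: "n \<ge> 1 \<Longrightarrow> unit_vec n \<in> c00"
  unfolding c00_def supp_def unit_vec_def by auto

lemma G1j_subset_c00: "G1j j \<subseteq> c00"
proof
  fix f assume "f \<in> G1j j"
  then obtain B \<epsilon> where B: "finite B" "B \<subseteq> {1..}"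
    and f: "f = (\<lambda>k. (\<Sum>i\<in>B. \<epsilon> i * unit_vec i k) / real (mseq (2 * j - 1)) ^ 2)"
    unfolding G1j_def by blast
  have "(\<lambda>k. \<Sum>i\<in>B. \<epsilon> i * unit_vec i k) \<in> c00"
    by (rule c00_sum) (use B c00_unit_vec in auto)
  then show "f \<in> c00"
    using c00_scale[of _ "1 / real (mseq (2 * j - 1)) ^ 2"] unfolding f by fastforce
qed

lemma special_subset_c00:
  assumes "special L \<xi> M1 \<sigma>1 fs"
  shows "set fs \<subseteq> c00"
  using assms G1j_subset_c00 unfolding special_def Useq_def by (fastforce simp: in_set_conv_nth)

lemma Gsp_ind_subset_c00:
  assumes "(\<phi>, I) \<in> Gsp_ind L \<xi> M1 \<sigma>1"
  shows "\<phi> \<in> c00"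
proof -
  obtain E fs \<epsilon> where \<phi>: "\<phi> = restr E (\<lambda>n. \<Sum>i<length fs. \<epsilon> i * (fs ! i) n)"
    and s: "special L \<xi> M1 \<sigma>1 fs"
    using assms unfolding Gsp_ind_def by blast
  show ?thesis
    unfolding \<phi> by (intro c00_restr c00_sum) (use special_subset_c00[OF s] in auto)
qed

lemma Gset_subset_c00: "Gset L \<xi> M1 \<sigma>1 \<subseteq> c00"
proof -
  have "G0 \<subseteq> c00"
    unfolding G0_def using c00_unit_vec c00_scale by blast
  moreover have "G1 \<subseteq> c00"
    unfolding G1_def using G1j_subset_c00 by blast
  moreover have "Gsp L \<xi> M1 \<sigma>1 \<subseteq> c00"
    unfolding Gsp_def using Gsp_ind_subset_c00 by force
  moreover have "Gl2 L \<xi> M1 \<sigma>1 \<subseteq> c00"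
  proof
    fix f assume "f \<in> Gl2 L \<xi> M1 \<sigma>1"
    then obtain d a \<phi> I where f: "f = (\<lambda>n. \<Sum>i\<in>{1..d::nat}. a i * \<phi> i n)"
      and \<phi>: "\<forall>i\<in>{1..d}. (\<phi> i, I i) \<in> Gsp_ind L \<xi> M1 \<sigma>1 \<union> G1_ind"
      unfolding Gl2_def by blast
    show "f \<in> c00"
      unfolding f
    proof (rule c00_sum)
      fix i assume "i \<in> {1..d}"
      then show "\<phi> i \<in> c00"
        using \<phi> Gsp_ind_subset_c00 G1j_subset_c00 unfolding G1_ind_def by fastforce
    qed simp
  qed
  ultimately show ?thesis unfolding Gset_def by blast
qed

lemma op_result_mono: "A \<subseteq> B \<Longrightarrow> op_result A n \<theta> f \<Longrightarrow> op_result B n \<theta> f"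
  unfolding op_result_def by blast

lemma attractor_seq_mono:
  "A \<subseteq> B \<Longrightarrow> attractor_seq \<Lambda> N1 \<sigma> A j fs \<Longrightarrow> attractor_seq \<Lambda> N1 \<sigma> B j fs"
  unfolding attractor_seq_def by (meson op_result_mono order_trans)

lemma op_result_c00: "op_result c00 n \<theta> f \<Longrightarrow> f \<in> c00"
proof -
  assume "op_result c00 n \<theta> f"
  then obtain fs where fs: "set fs \<subseteq> c00" and f: "f = (\<lambda>k. \<theta> * (\<Sum>i<length fs. (fs ! i) k))"
    unfolding op_result_def by blast
  have "(\<lambda>k. \<Sum>i<length fs. 1 * (fs ! i) k) \<in> c00"
    by (rule c00_sum) (use fs in auto)
  then show ?thesis unfolding f using c00_scale by fastforce
qed

lemma K_closed_c00: "G \<subseteq> c00 \<Longrightarrow> K_closed G \<Lambda> N1 \<sigma> c00"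
proof -
  assume G: "G \<subseteq> c00"
  have "(\<lambda>n. 1 / real (mseq (2 * j - 1)) * (\<Sum>i<length fs. (fs ! i) n)) \<in> c00"
    if "attractor_seq \<Lambda> N1 \<sigma> c00 j fs" for j fs
  proof -
    have "(\<lambda>k. \<Sum>i<length fs. 1 * (fs ! i) k) \<in> c00"
      by (rule c00_sum) (use that in \<open>auto simp: attractor_seq_def\<close>)
    from c00_scale[OF this] show ?thesis by (simp only: mult_1)
  qed
  note attr = this
  show ?thesis
    unfolding K_closed_def
  proof (intro conjI allI impI ballI)
    show "(\<lambda>n. - f n) \<in> c00" if "f \<in> c00" for f
      using c00_scale[OF that, of "-1"] by simp
    show "restr E f \<in> c00" if "f \<in> c00" for f E
      using that by (rule c00_restr)
    show "G \<subseteq> c00" by (rule G)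
  qed (erule op_result_c00, erule attr, (rule c00_sum, blast, blast)+)
qed

lemma K_closed_Inter:
  assumes "\<And>A. A \<in> \<A> \<Longrightarrow> K_closed G \<Lambda> N1 \<sigma> A"
  shows "K_closed G \<Lambda> N1 \<sigma> (\<Inter>\<A>)"
proof -
  have le: "\<Inter>\<A> \<subseteq> A" if "A \<in> \<A>" for A using that by (rule Inter_lower)
  note om = op_result_mono[OF le] and am = attractor_seq_mono[OF le]
  note cl = assms[unfolded K_closed_def]
  note c1 = cl[THEN conjunct1]
    and c2 = cl[THEN conjunct2, THEN conjunct1]
    and c3 = cl[THEN conjunct2, THEN conjunct2, THEN conjunct1]
    and c4 = cl[THEN conjunct2, THEN conjunct2, THEN conjunct2, THEN conjunct1, rule_format]
    and c5 = cl[THEN conjunct2, THEN conjunct2, THEN conjunct2, THEN conjunct2, THEN conjunct1, rule_format]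
    and c6 = cl[THEN conjunct2, THEN conjunct2, THEN conjunct2, THEN conjunct2, THEN conjunct2, THEN conjunct1]
    and c7 = cl[THEN conjunct2, THEN conjunct2, THEN conjunct2, THEN conjunct2, THEN conjunct2, THEN conjunct2,
        THEN spec, THEN spec, THEN spec, THEN mp]
  show ?thesis
    unfolding K_closed_def
  proof (intro conjI)
    show "\<forall>f\<in>\<Inter>\<A>. (\<lambda>n. - f n) \<in> \<Inter>\<A>" using c1 by blast
    show "\<forall>f\<in>\<Inter>\<A>. \<forall>E. nat_interval E \<longrightarrow> restr E f \<in> \<Inter>\<A>" using c2 by blast
    show "G \<subseteq> \<Inter>\<A>" using c3 by blast
    show "\<forall>j\<ge>1. \<forall>f. op_result (\<Inter>\<A>) (nseq (2 * j)) (1 / real (mseq (2 * j))) f \<longrightarrow> f \<in> \<Inter>\<A>"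
      by (intro allI impI InterI) (rule c4, assumption+, rule om, assumption+)
    show "\<forall>j\<ge>1. \<forall>fs. attractor_seq \<Lambda> N1 \<sigma> (\<Inter>\<A>) j fs \<longrightarrow>
        (\<lambda>n. 1 / real (mseq (2 * j - 1)) * (\<Sum>i<length fs. (fs ! i) n)) \<in> \<Inter>\<A>"
      by (intro allI impI InterI) (rule c5, assumption+, rule am, assumption+)
    show "\<forall>(I::nat set) c f j. finite I \<and>
        (\<forall>i\<in>I. f i \<in> \<Inter>\<A> \<and> j i \<ge> 1 \<and> op_result (\<Inter>\<A>) (nseq (j i)) (1 / real (mseq (j i))) (f i)) \<and>
        inj_on (\<lambda>i. nseq (j i)) I \<and> (\<forall>i\<in>I. c i \<in> \<rat>) \<and> (\<Sum>i\<in>I. (c i)\<^sup>2) \<le> 1 \<longrightarrow>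
        (\<lambda>n. \<Sum>i\<in>I. c i * f i n) \<in> \<Inter>\<A>"
    proof (intro allI impI InterI)
      fix I :: "nat set" and c :: "nat \<Rightarrow> real" and f j A
      assume A: "A \<in> \<A>" and *: "finite I \<and>
        (\<forall>i\<in>I. f i \<in> \<Inter>\<A> \<and> j i \<ge> 1 \<and> op_result (\<Inter>\<A>) (nseq (j i)) (1 / real (mseq (j i))) (f i)) \<and>
        inj_on (\<lambda>i. nseq (j i)) I \<and> (\<forall>i\<in>I. c i \<in> \<rat>) \<and> (\<Sum>i\<in>I. (c i)\<^sup>2) \<le> 1"
      show "(\<lambda>n. \<Sum>i\<in>I. c i * f i n) \<in> A"
      proof (rule c6[OF A, THEN spec[of _ I], THEN spec[of _ c], THEN spec[of _ f], THEN spec[of _ j], THEN mp],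
          intro conjI ballI)
        fix i assume i: "i \<in> I"
        show "f i \<in> A" using * i A by blast
        show "op_result A (nseq (j i)) (1 / real (mseq (j i))) (f i)"
          by (rule om[OF A]) (use * i in blast)
      qed (use * in blast)+
    qed
    show "\<forall>(I::nat set) c f. finite I \<and> (\<forall>i\<in>I. f i \<in> \<Inter>\<A> \<and> c i \<in> \<rat> \<and> c i \<ge> 0) \<and>
        (\<Sum>i\<in>I. c i) = 1 \<longrightarrow> (\<lambda>n. \<Sum>i\<in>I. c i * f i n) \<in> \<Inter>\<A>"
      by (intro allI impI InterI, rule c7, assumption) blast
  qed
qed

lemma Kset_minimal:
  shows "Kset L \<xi> M1 \<sigma>1 \<Lambda> N1 \<sigma> \<subseteq> c00"
    and "K_closed (Gset L \<xi> M1 \<sigma>1) \<Lambda> N1 \<sigma> (Kset L \<xi> M1 \<sigma>1 \<Lambda> N1 \<sigma>)"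
    and "A \<subseteq> c00 \<Longrightarrow> K_closed (Gset L \<xi> M1 \<sigma>1) \<Lambda> N1 \<sigma> A \<Longrightarrow> Kset L \<xi> M1 \<sigma>1 \<Lambda> N1 \<sigma> \<subseteq> A"
proof -
  have c: "K_closed (Gset L \<xi> M1 \<sigma>1) \<Lambda> N1 \<sigma> c00"
    by (rule K_closed_c00[OF Gset_subset_c00])
  show "Kset L \<xi> M1 \<sigma>1 \<Lambda> N1 \<sigma> \<subseteq> c00"
    unfolding Kset_def K_gen_def by (rule Inter_lower) (simp add: c)
  show "K_closed (Gset L \<xi> M1 \<sigma>1) \<Lambda> N1 \<sigma> (Kset L \<xi> M1 \<sigma>1 \<Lambda> N1 \<sigma>)"
    unfolding Kset_def K_gen_def by (rule K_closed_Inter) simp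
  show "A \<subseteq> c00 \<Longrightarrow> K_closed (Gset L \<xi> M1 \<sigma>1) \<Lambda> N1 \<sigma> A \<Longrightarrow> Kset L \<xi> M1 \<sigma>1 \<Lambda> N1 \<sigma> \<subseteq> A"
    unfolding Kset_def K_gen_def by (rule Inter_lower) simp
qed

text \<open>A completion of \<^const>\<open>c00\<close> under the norm \<open>N\<close>: a linear isometry \<open>T\<close> into a Banach space,
  together with the closure \<open>X\<close> of its range.\<close>

definition is_completion ::
    "((nat \<Rightarrow> real) \<Rightarrow> real) \<Rightarrow> ((nat \<Rightarrow> real) \<Rightarrow> 'a::banach) \<Rightarrow> 'a set \<Rightarrow> bool" where
  "is_completion N T X \<longleftrightarrow>
     (\<forall>x\<in>c00. \<forall>y\<in>c00. T (\<lambda>n. x n + y n) = T x + T y) \<and>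
     (\<forall>x\<in>c00. \<forall>c. T (\<lambda>n. c * x n) = c *\<^sub>R T x) \<and>
     (\<forall>x\<in>c00. norm (T x) = N x) \<and> X = closure (T ` c00)"


section \<open>Spreading models\<close>

text \<open>Sequences \<open>x\<close> are used at the indices \<open>1, 2, \<dots>\<close> only; they are basic if they form a Schauder
  basis of their closed linear span.\<close>

definition basic_sequence :: "(nat \<Rightarrow> 'a::real_normed_vector) \<Rightarrow> bool" where
  "basic_sequence x \<longleftrightarrow>
     (\<forall>v\<in>closure (span (x ` {1..})). \<exists>!a::nat \<Rightarrow> real. (\<lambda>i. a i *\<^sub>R x (Suc i)) sums v)"

definition lp_norm :: "real \<Rightarrow> nat set \<Rightarrow> (nat \<Rightarrow> real) \<Rightarrow> real" where
  "lp_norm p F a = (\<Sum>i\<in>F. \<bar>a i\<bar> powr p) powr (1 / p)"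

definition linf_norm :: "nat set \<Rightarrow> (nat \<Rightarrow> real) \<Rightarrow> real" where
  "linf_norm F a = Max (insert 0 ((\<lambda>i. \<bar>a i\<bar>) ` F))"

definition equiv_on :: "real \<Rightarrow> (nat set \<Rightarrow> (nat \<Rightarrow> real) \<Rightarrow> real) \<Rightarrow> (nat \<Rightarrow> 'a::real_normed_vector)
    \<Rightarrow> nat set \<Rightarrow> bool" where
  "equiv_on C N x F \<longleftrightarrow>
     (\<forall>a. N F a / C \<le> norm (\<Sum>i\<in>F. a i *\<^sub>R x i) \<and> norm (\<Sum>i\<in>F. a i *\<^sub>R x i) \<le> C * N F a)"

definition admits_spreading_model ::
    "'a::real_normed_vector set \<Rightarrow> (nat set \<Rightarrow> (nat \<Rightarrow> real) \<Rightarrow> real) \<Rightarrow> bool" where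
  "admits_spreading_model X N \<longleftrightarrow>
     (\<exists>x. (\<forall>i\<ge>1. x i \<in> X \<and> norm (x i) = 1) \<and> basic_sequence x \<and>
        (\<exists>C\<ge>1. \<forall>F\<in>schreier1. equiv_on C N x F))"

definition admits_lp_spreading_model :: "'a::real_normed_vector set \<Rightarrow> real \<Rightarrow> bool" where
  "admits_lp_spreading_model X p \<longleftrightarrow> admits_spreading_model X (lp_norm p)"

definition admits_c0_spreading_model :: "'a::real_normed_vector set \<Rightarrow> bool" where
  "admits_c0_spreading_model X \<longleftrightarrow> admits_spreading_model X linf_norm"

end

theory Submission
  imports Defs "HOL-Library.Ramsey" "HOL-Library.Sublist"
begin

text \<open>For \<open>p > 1\<close> and for \<open>c\<^sub>0\<close>, the differences of a spreading sequence are close to blocks, and the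
  \<open>(\<A>\<^bsub>n\<^esub>, m\<^sup>-\<^sup>1)\<close>-operations with even index make the norm of \<open>n\<close> blocks at least a multiple of
  \<open>n / m\<close>, where \<open>n\<close> exceeds every power of \<open>m\<close>.

  For \<open>p = 1\<close>, James' argument gives blocks of norm at most \<open>1\<close> all of whose averages far out have
  norm above \<open>1/2\<close>. No analysis of the tree structure of \<open>K\<close> is needed to refute this: it suffices
  to bound at a sparse average the functionals of the ground set and the \<open>\<ell>\<^sub>2\<close>-sums of weighted
  functionals. Small weights are killed by averaging. By the \<open>\<ell>\<^sub>2\<close>-sums in \<open>K\<close>, a subsequence has
  small energy on all other weights that are visible from earlier blocks, and the new weights of
  distinct blocks are disjoint, hence add up only in \<open>\<ell>\<^sub>2\<close>. In the ground set, one special functional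
  may act on many blocks. Such functionals have, up to the \<open>n\<close>-th block, finitely many initial parts
  because \<open>\<sigma>\<^sub>1\<close> is injective, so by Ramsey's theorem and Koenig's lemma they would produce an
  infinite special branch, against the compactness of the Schreier family.\<close>

section \<open>The duality pairing\<close>

text \<open>Only sign vectors are tested in the sequence norms; there all of them equal
  \<open>card F powr \<rho>\<close> with \<open>\<rho> = 1/p\<close>, or \<open>\<rho> = 0\<close>
  for \<open>c0\<close>, so the two arguments are for \<open>\<rho> < 1\<close> and
  \<open>\<rho> = 1\<close>. Differences are taken because a bounded sequence always has members
  that nearly agree on a given finite set of coordinates, while nothing makes the members themselves
  small there.

  Tree analysis is avoided as follows: the result of any operation is an l2-sum with a single
  coefficient 1, so a bound for all l2-sums of weighted functionals already covers it, and convex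
  combinations preserve bounds. An l2-sum with disjoint rows costs \<open>t\<close> on
  \<open>t^2\<close> blocks, hence averages of square length.

  The special functionals are the obstacle to this gain: all members of one special list carry one
  common coefficient, so disjoint windows do not make the coefficients seen by different blocks
  disjoint. The gain returns if each list acts substantially on at most one block after its first
  one. What counts as substantial must beat the number of lists already present, so it depends on
  the block, and the selection of blocks is diagonal.\<close>

lemma supp_c00: "f \<in> c00 \<Longrightarrow> finite (supp f)"
  by (simp add: c00_def)

lemma act_eq_sum:
  assumes "f \<in> c00" "finite S" "supp f \<inter> supp x \<subseteq> S"
  shows "act f x = (\<Sum>n\<in>S. f n * x n)"
proof -
  have "act f x = (\<Sum>n\<in>supp f \<inter> supp x. f n * x n)"
    unfolding act_def by (rule sum.mono_neutral_right) (use assms supp_c00 in \<open>auto simp: supp_def\<close>)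
  also have "\<dots> = (\<Sum>n\<in>S. f n * x n)"
    by (rule sum.mono_neutral_left) (use assms in \<open>auto simp: supp_def\<close>)
  finally show ?thesis .
qed

lemma act_sum_right:
  assumes "f \<in> c00"
  shows "act f (\<lambda>n. \<Sum>i\<in>I. c i * x i n) = (\<Sum>i\<in>I. c i * act f (x i))"
proof -
  have "act f (\<lambda>n. \<Sum>i\<in>I. c i * x i n) = (\<Sum>n\<in>supp f. \<Sum>i\<in>I. c i * (f n * x i n))"
    unfolding act_def by (simp add: sum_distrib_left algebra_simps)
  also have "\<dots> = (\<Sum>i\<in>I. \<Sum>n\<in>supp f. c i * (f n * x i n))"
    by (rule sum.swap)
  finally show ?thesis unfolding act_def by (simp add: sum_distrib_left)
qed

lemma act_sum_left:
  assumes "finite I" "\<And>i. i \<in> I \<Longrightarrow> f i \<in> c00"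
  shows "act (\<lambda>n. \<Sum>i\<in>I. c i * f i n) x = (\<Sum>i\<in>I. c i * act (f i) x)"
proof -
  define S where "S = (\<Union>i\<in>I. supp (f i))"
  have S: "finite S" unfolding S_def using assms supp_c00 by auto
  have *: "supp (\<lambda>n. \<Sum>i\<in>I. c i * f i n) \<subseteq> S"
    unfolding S_def supp_def by (auto intro: ccontr simp: sum.neutral)
  have "act (\<lambda>n. \<Sum>i\<in>I. c i * f i n) x = (\<Sum>n\<in>S. (\<Sum>i\<in>I. c i * f i n) * x n)"
    by (rule act_eq_sum[OF c00_sum S]) (use assms * in auto)
  also have "\<dots> = (\<Sum>i\<in>I. c i * (\<Sum>n\<in>S. f i n * x n))"
    by (simp add: sum_distrib_left sum_distrib_right mult.assoc sum.swap[of _ I S])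
  also have "\<dots> = (\<Sum>i\<in>I. c i * act (f i) x)"
  proof (rule sum.cong)
    fix i assume "i \<in> I"
    then show "c i * (\<Sum>n\<in>S. f i n * x n) = c i * act (f i) x"
      using act_eq_sum[OF assms(2) S, of i x] UN_upper[of i I "\<lambda>i. supp (f i)"] unfolding S_def by force
  qed simp
  finally show ?thesis .
qed

lemma act_scale_left: "f \<in> c00 \<Longrightarrow> act (\<lambda>n. c * f n) x = c * act f x"
  using act_sum_left[of "{()}" "\<lambda>_. f" "\<lambda>_. c" x] by simp

lemma act_minus_left: "f \<in> c00 \<Longrightarrow> act (\<lambda>n. - f n) x = - act f x"
  using act_scale_left[of f "-1" x] by simp

lemma act_scale_right: "f \<in> c00 \<Longrightarrow> act f (\<lambda>n. c * x n) = c * act f x"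
  using act_sum_right[where I = "{()}" and c = "\<lambda>_. c" and x = "\<lambda>_. x"] by simp

lemma act_sum_right': "f \<in> c00 \<Longrightarrow> act f (\<lambda>n. \<Sum>i\<in>I. x i n) = (\<Sum>i\<in>I. act f (x i))"
  using act_sum_right[where c = "\<lambda>_. 1"] by simp

lemma act_zero_left [simp]: "act (\<lambda>_. 0) x = 0"
  unfolding act_def by simp

lemma supp_restr: "supp (restr E f) = supp f \<inter> E"
  unfolding supp_def restr_def by auto

lemma act_restr: "f \<in> c00 \<Longrightarrow> act (restr E f) x = act f (restr E x)"
proof -
  assume f: "f \<in> c00"
  have "act (restr E f) x = (\<Sum>n\<in>supp f. restr E f n * x n)"
    by (rule act_eq_sum) (use f c00_restr supp_c00 in \<open>auto simp: supp_restr\<close>)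
  then show ?thesis
    unfolding act_def restr_def by (auto intro!: sum.cong)
qed

lemma act_unit_vec: "n \<ge> 1 \<Longrightarrow> act (unit_vec n) x = x n"
  using act_eq_sum[OF c00_unit_vec, of n "{n}" x] by (auto simp: unit_vec_def supp_def)

text \<open>It dominates the norm (\<open>N_le_l1\<close>). It is finite but in general not bounded
  along a block sequence, so it serves against weights that are chosen after the vector.\<close>

definition l1 :: "(nat \<Rightarrow> real) \<Rightarrow> real" where
  "l1 x = (\<Sum>n\<in>supp x. \<bar>x n\<bar>)"

lemma l1_nonneg: "0 \<le> l1 x"
  unfolding l1_def by (simp add: sum_nonneg)

lemma abs_act_le:
  assumes "f \<in> c00" "x \<in> c00" "\<And>n. \<bar>f n\<bar> \<le> b"
  shows "\<bar>act f x\<bar> \<le> b * l1 x"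
proof -
  have "act f x = (\<Sum>n\<in>supp x. f n * x n)"
    by (rule act_eq_sum) (use assms supp_c00 in auto)
  also have "\<bar>\<dots>\<bar> \<le> (\<Sum>n\<in>supp x. \<bar>f n * x n\<bar>)" by (rule sum_abs)
  also have "\<dots> \<le> (\<Sum>n\<in>supp x. b * \<bar>x n\<bar>)"
    by (rule sum_mono) (use assms(3) in \<open>simp add: abs_mult mult_right_mono\<close>)
  finally show ?thesis unfolding l1_def by (simp add: sum_distrib_left)
qed

lemma restr_restr: "restr E (restr E' f) = restr (E \<inter> E') f"
  unfolding restr_def by auto

lemma restr_UNIV [simp]: "restr UNIV f = f"
  unfolding restr_def by auto

lemma restr_sum: "restr E (\<lambda>n. \<Sum>i\<in>I. c i * f i n) = (\<lambda>n. \<Sum>i\<in>I. c i * restr E (f i) n)"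
  unfolding restr_def by auto

lemma nat_intervalD: "nat_interval E \<Longrightarrow> a \<in> E \<Longrightarrow> c \<in> E \<Longrightarrow> a \<le> b \<Longrightarrow> b \<le> c \<Longrightarrow> b \<in> E"
  by (rule nat_interval_def[THEN iffD1, rule_format]) auto

lemma nat_intervalI: "(\<And>a b c. a \<in> E \<Longrightarrow> c \<in> E \<Longrightarrow> a \<le> b \<Longrightarrow> b \<le> c \<Longrightarrow> b \<in> E) \<Longrightarrow> nat_interval E"
  unfolding nat_interval_def by (intro ballI allI impI) (elim conjE)

lemma nat_interval_Int:
  assumes "nat_interval E" "nat_interval E'"
  shows "nat_interval (E \<inter> E')"
proof (rule nat_intervalI)
  fix a b c assume "a \<in> E \<inter> E'" "c \<in> E \<inter> E'" "a \<le> b" "b \<le> c"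
  then show "b \<in> E \<inter> E'"
    using nat_intervalD[OF assms(1), of a c b] nat_intervalD[OF assms(2), of a c b] by simp
qed

lemma nat_interval_UNIV [simp]: "nat_interval UNIV"
  by (rule nat_intervalI) simp

lemma nat_interval_greaterThanAtMost [simp]: "nat_interval {a<..b}"
  by (rule nat_intervalI) simp

text \<open>The norming set is closed under restriction to intervals only, so functionals are
  localized to the hull of a support and not to the support itself.\<close>

definition hull_interval :: "nat set \<Rightarrow> nat set" where
  "hull_interval S = {n. (\<exists>a\<in>S. a \<le> n) \<and> (\<exists>b\<in>S. n \<le> b)}"

lemma nat_interval_hull: "nat_interval (hull_interval S)"
  by (rule nat_intervalI) (unfold hull_interval_def, simp, meson le_trans)

lemma hull_interval_superset: "S \<subseteq> hull_interval S"
  unfolding hull_interval_def by auto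

lemma restr_hull_supp: "restr (hull_interval (supp x)) x = x"
  by (rule ext) (use hull_interval_superset[of "supp x"] in \<open>auto simp: restr_def supp_def\<close>)

lemma act_eq_0: "supp f \<inter> supp x = {} \<Longrightarrow> act f x = 0"
  unfolding act_def by (rule sum.neutral) (auto simp: supp_def)

text \<open>At most one summand is nonzero at the coordinate \<open>n\<close>.\<close>

lemma disjoint_supp_sum_le:
  assumes "\<And>a b. a \<in> Q \<Longrightarrow> b \<in> Q \<Longrightarrow> a \<noteq> b \<Longrightarrow> supp (g a) \<inter> supp (g b) = {}"
    and "finite Q" "0 \<le> B" "\<And>a. a \<in> Q \<Longrightarrow> \<bar>g a n\<bar> \<le> (B::real)"
  shows "(\<Sum>a\<in>Q. \<bar>g a n\<bar>) \<le> B"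
proof (cases "\<exists>a\<in>Q. g a n \<noteq> 0")
  case True
  then obtain a where a: "a \<in> Q" "g a n \<noteq> 0" by blast
  then have "(\<Sum>b\<in>Q. \<bar>g b n\<bar>) = (\<Sum>b\<in>{a}. \<bar>g b n\<bar>)"
    by (intro sum.mono_neutral_right) (use assms in \<open>auto simp: supp_def\<close>)
  then show ?thesis using assms a by simp
next
  case False
  then have "(\<Sum>a\<in>Q. \<bar>g a n\<bar>) = 0" by (simp add: sum.neutral)
  then show ?thesis using assms by simp
qed

lemma before_supp_disjoint:
  assumes "\<And>k l. k \<in> S \<Longrightarrow> l \<in> S \<Longrightarrow> k < l \<Longrightarrow> before (x k) (x l)"
    and "k \<in> S" "l \<in> S" "(k::nat) \<noteq> l"
  shows "supp (x k) \<inter> supp (x l) = {}"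
  using assms(1)[of k l] assms(1)[of l k] assms(2-)
  by (cases k l rule: linorder_cases) (force simp: before_def)+

lemma successive_nth: "successive fs \<Longrightarrow> p < q \<Longrightarrow> q < length fs \<Longrightarrow> before (fs ! p) (fs ! q)"
  unfolding successive_def by (simp add: sorted_wrt_iff_nth_less)

lemma successive_disjoint:
  assumes "successive fs" "p < length fs" "q < length fs" "p \<noteq> q"
  shows "supp (fs ! p) \<inter> supp (fs ! q) = {}"
  by (rule before_supp_disjoint[where S = "{..<length fs}"]) (use assms successive_nth in auto)

lemma successive_sum_le:
  assumes "successive fs" "\<And>p. p < length fs \<Longrightarrow> \<bar>(fs ! p) n\<bar> \<le> B" "0 \<le> B"
  shows "(\<Sum>p<length fs. \<bar>(fs ! p) n\<bar>) \<le> B"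
  by (rule disjoint_supp_sum_le) (use assms successive_disjoint in auto)

lemma successive_map_restr: "successive fs \<Longrightarrow> successive (map (restr E) fs)"
  unfolding successive_def sorted_wrt_map
  by (rule sorted_wrt_mono_rel) (auto simp: before_def supp_restr)


section \<open>Real inequalities\<close>

text \<open>Converse of the Cauchy-Schwarz inequality, tested on rational vectors because the
  l2-sums in the norming set have rational coefficients. Instead of \<open>r\<close> divided by its
  norm, the test vectors are rational truncations \<open>q\<close> of \<open>r\<close> towards zero,
  suitably rescaled.\<close>

lemma rational_dual_ball:
  fixes r :: "'i \<Rightarrow> real"
  assumes fin: "finite I"
    and dual: "\<And>a. (\<forall>i\<in>I. a i \<in> \<rat>) \<Longrightarrow> (\<Sum>i\<in>I. (a i)\<^sup>2) \<le> 1 \<Longrightarrow> (\<Sum>i\<in>I. a i * r i) \<le> 1"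
  shows "(\<Sum>i\<in>I. (r i)\<^sup>2) \<le> 1"
proof -
  have approx: "(\<Sum>i\<in>I. (q i)\<^sup>2) \<le> 1"
    if q: "\<forall>i\<in>I. q i \<in> \<rat>" "\<forall>i\<in>I. (q i)\<^sup>2 \<le> q i * r i" for q
  proof (rule ccontr)
    define Q where "Q = (\<Sum>i\<in>I. (q i)\<^sup>2)"
    assume "\<not> (\<Sum>i\<in>I. (q i)\<^sup>2) \<le> 1"
    then have Q: "Q > 1" by (simp add: Q_def)
    then have "sqrt Q < Q"
      by (intro real_less_lsqrt) (auto simp: power2_eq_square)
    \<comment> \<open>\<open>sqrt Q\<close> may be irrational, so the test vector is divided by a
      rational \<open>c\<close> slightly above it; \<open>c < Q\<close> then contradicts
      \<open>Q \<le> c\<close>.\<close>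
    then obtain c where c: "c \<in> \<rat>" "sqrt Q < c" "c < Q"
      using Rats_dense_in_real by blast
    have c0: "c > 0" using c(2) Q real_sqrt_gt_zero[of Q] by linarith
    have "Q \<le> c\<^sup>2" using c(2) by (intro sqrt_le_D) simp
    then have "(\<Sum>i\<in>I. (q i / c)\<^sup>2) \<le> 1"
      using c0 by (simp add: power_divide Q_def flip: sum_divide_distrib)
    then have "(\<Sum>i\<in>I. q i / c * r i) \<le> 1"
      by (intro dual) (use q c in auto)
    then have "(\<Sum>i\<in>I. q i * r i) \<le> c"
      using c0 by (simp add: field_simps flip: sum_divide_distrib)
    moreover have "Q \<le> (\<Sum>i\<in>I. q i * r i)"
      unfolding Q_def by (rule sum_mono) (use q in auto)
    ultimately show False using c by simp
  qed
  have "\<exists>q. \<forall>n::nat. q n \<in> \<rat> \<and> (q n)\<^sup>2 \<le> q n * x \<and> \<bar>x\<bar> - \<bar>q n\<bar> \<le> 1 / Suc n \<and> \<bar>q n\<bar> \<le> \<bar>x\<bar>" for x :: real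
  proof (rule choice, rule allI)
    fix n :: nat
    show "\<exists>q. q \<in> \<rat> \<and> q\<^sup>2 \<le> q * x \<and> \<bar>x\<bar> - \<bar>q\<bar> \<le> 1 / Suc n \<and> \<bar>q\<bar> \<le> \<bar>x\<bar>"
    proof (cases "\<bar>x\<bar> \<le> 1 / Suc n")
      case True
      then show ?thesis by (intro exI[of _ 0]) auto
    next
      case False
      then obtain q where q: "q \<in> \<rat>" "\<bar>x\<bar> - 1 / Suc n < q" "q < \<bar>x\<bar>"
        using Rats_dense_in_real[of "\<bar>x\<bar> - 1 / Suc n" "\<bar>x\<bar>"] by auto
      then have "q > 0" using False by linarith
      then show ?thesis
        by (intro exI[of _ "sgn x * q"])
          (use q mult_left_mono[of q "\<bar>x\<bar>" q] \<open>q > 0\<close> in \<open>cases "x < 0"; auto simp: sgn_if power2_eq_square\<close>)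
    qed
  qed
  then obtain q where q: "\<And>x n. q x n \<in> \<rat> \<and> (q x n)\<^sup>2 \<le> q x n * x \<and> \<bar>x\<bar> - \<bar>q x n\<bar> \<le> 1 / real (Suc n) \<and> \<bar>q x n\<bar> \<le> \<bar>x\<bar>"
    by metis
  have lim: "(\<lambda>n. (q x n)\<^sup>2) \<longlonglongrightarrow> x\<^sup>2" for x
  proof -
    have "(\<lambda>n. \<bar>q x n\<bar>) \<longlonglongrightarrow> \<bar>x\<bar>"
    proof (rule tendsto_sandwich[where f = "\<lambda>n. \<bar>x\<bar> - 1 / real (Suc n)" and h = "\<lambda>_. \<bar>x\<bar>"])
      show "(\<lambda>n. \<bar>x\<bar> - 1 / real (Suc n)) \<longlonglongrightarrow> \<bar>x\<bar>"
        using tendsto_diff[OF tendsto_const LIMSEQ_inverse_real_of_nat, of "\<bar>x\<bar>"]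
        by (simp add: inverse_eq_divide)
      show "\<forall>\<^sub>F n in sequentially. \<bar>x\<bar> - 1 / real (Suc n) \<le> \<bar>q x n\<bar>"
        using q[of x] by (intro always_eventually allI) (smt (verit))
      show "\<forall>\<^sub>F n in sequentially. \<bar>q x n\<bar> \<le> \<bar>x\<bar>"
        using q[of x] by (intro always_eventually allI) simp
    qed simp
    then have "(\<lambda>n. \<bar>q x n\<bar>\<^sup>2) \<longlonglongrightarrow> \<bar>x\<bar>\<^sup>2" by (rule tendsto_power)
    then show ?thesis by simp
  qed
  have "(\<lambda>n. \<Sum>i\<in>I. (q (r i) n)\<^sup>2) \<longlonglongrightarrow> (\<Sum>i\<in>I. (r i)\<^sup>2)"
    by (rule tendsto_sum) (rule lim)
  then show ?thesis
    by (rule LIMSEQ_le_const2) (intro exI[of _ 0] allI impI approx; simp add: q)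
qed

lemma abs_coeff_le_one:
  fixes a :: "'i \<Rightarrow> real"
  assumes "(\<Sum>i\<in>I. (a i)\<^sup>2) \<le> 1" "finite I" "i \<in> I"
  shows "\<bar>a i\<bar> \<le> 1"
proof -
  have "(a i)\<^sup>2 \<le> (\<Sum>i\<in>I. (a i)\<^sup>2)" by (rule member_le_sum) (use assms in auto)
  then show ?thesis using assms(1) by (simp flip: abs_square_le_1)
qed

lemma cauchy_schwarz_ball:
  fixes a y :: "'i \<Rightarrow> real"
  assumes "(\<Sum>i\<in>I. (a i)\<^sup>2) \<le> 1" "(\<Sum>i\<in>I. (y i)\<^sup>2) \<le> e\<^sup>2" "0 \<le> e"
  shows "\<bar>\<Sum>i\<in>I. a i * y i\<bar> \<le> e"
proof -
  have "(\<Sum>i\<in>I. a i * y i)\<^sup>2 \<le> (\<Sum>i\<in>I. (a i)\<^sup>2) * (\<Sum>i\<in>I. (y i)\<^sup>2)"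
    by (rule Cauchy_Schwarz_ineq_sum)
  also have "\<dots> \<le> 1 * e\<^sup>2"
    by (rule mult_mono) (use assms in \<open>auto intro: sum_nonneg\<close>)
  finally have "\<bar>\<Sum>i\<in>I. a i * y i\<bar>\<^sup>2 \<le> e\<^sup>2" by simp
  then show ?thesis using assms(3) power2_le_imp_le by blast
qed

text \<open>Each index \<open>i\<close> meets at most one \<open>s\<close>, so the square sums over the rows add up to at most
  \<open>1\<close>, and the columns contribute at most \<open>t\<^sup>2\<close>; AM-GM balances the two.\<close>

lemma disjoint_rows_bound:
  fixes a :: "'i \<Rightarrow> real" and y :: "'i \<Rightarrow> nat \<Rightarrow> real"
  assumes fin: "finite I" and t: "t > 0"
    and a: "(\<Sum>i\<in>I. (a i)\<^sup>2) \<le> 1"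
    and y: "\<And>s. s < t\<^sup>2 \<Longrightarrow> (\<Sum>i\<in>{i\<in>I. R i s}. (y i s)\<^sup>2) \<le> 1"
    and R: "\<And>i s s'. i \<in> I \<Longrightarrow> s < t\<^sup>2 \<Longrightarrow> s' < t\<^sup>2 \<Longrightarrow> R i s \<Longrightarrow> R i s' \<Longrightarrow> s = s'"
  shows "(\<Sum>s<t\<^sup>2. \<Sum>i\<in>{i\<in>I. R i s}. \<bar>a i * y i s\<bar>) \<le> t"
proof -
  have am: "\<bar>x * z\<bar> \<le> (t * x\<^sup>2 + z\<^sup>2 / t) / 2" for x z :: real
  proof -
    have "0 \<le> (t * \<bar>x\<bar> - \<bar>z\<bar>)\<^sup>2 / t" using t by simp
    also have "\<dots> = t * x\<^sup>2 - 2 * \<bar>x * z\<bar> + z\<^sup>2 / t"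
      using t by (simp add: power2_diff field_simps power2_eq_square abs_mult)
    finally show ?thesis by simp
  qed
  have fs: "finite {i\<in>I. R i s}" for s using fin by simp
  have "(\<Sum>s<t\<^sup>2. \<Sum>i\<in>{i\<in>I. R i s}. (a i)\<^sup>2) = (\<Sum>(s,i)\<in>Sigma {..<t\<^sup>2} (\<lambda>s. {i\<in>I. R i s}). (a i)\<^sup>2)"
    by (rule sum.Sigma) (use fs in auto)
  also have "\<dots> = (\<Sum>i\<in>snd ` Sigma {..<t\<^sup>2} (\<lambda>s. {i\<in>I. R i s}). (a i)\<^sup>2)"
    by (subst sum.reindex) (use R in \<open>auto simp: inj_on_def case_prod_unfold\<close>)
  also have "\<dots> \<le> (\<Sum>i\<in>I. (a i)\<^sup>2)"
    by (rule sum_mono2) (use fin in auto)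
  finally have A: "(\<Sum>s<t\<^sup>2. \<Sum>i\<in>{i\<in>I. R i s}. (a i)\<^sup>2) \<le> 1" using a by simp
  have B: "(\<Sum>s<t\<^sup>2. \<Sum>i\<in>{i\<in>I. R i s}. (y i s)\<^sup>2) \<le> t\<^sup>2"
    using sum_mono[of "{..<t\<^sup>2}" "\<lambda>s. \<Sum>i\<in>{i\<in>I. R i s}. (y i s)\<^sup>2" "\<lambda>_. 1"] y by simp
  have "(\<Sum>s<t\<^sup>2. \<Sum>i\<in>{i\<in>I. R i s}. \<bar>a i * y i s\<bar>)
      \<le> (\<Sum>s<t\<^sup>2. \<Sum>i\<in>{i\<in>I. R i s}. (t * (a i)\<^sup>2 + (y i s)\<^sup>2 / t) / 2)"
    by (intro sum_mono am)
  also have "\<dots> = (t * (\<Sum>s<t\<^sup>2. \<Sum>i\<in>{i\<in>I. R i s}. (a i)\<^sup>2)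
      + (\<Sum>s<t\<^sup>2. \<Sum>i\<in>{i\<in>I. R i s}. (y i s)\<^sup>2) / t) / 2"
    by (simp add: sum.distrib sum_distrib_left flip: sum_divide_distrib)
  also have "\<dots> \<le> (t * 1 + t\<^sup>2 / t) / 2"
    by (intro divide_right_mono add_mono mult_left_mono A B) (use t B A in auto)
  also have "\<dots> = t" using t by (simp add: power2_eq_square)
  finally show ?thesis .
qed

section \<open>The weights\<close>

text \<open>The doubly exponential sequence \<open>2 ^ (5 ^ j)\<close> is replaced by a geometric
  one, so that sums over distinct weights reduce to geometric tails.\<close>

lemma mseq_ge:
  assumes "j \<ge> 1" shows "32 ^ j \<le> mseq j"
proof -
  obtain i where j: "j = Suc i" using assms by (cases j) auto
  have "5 * Suc i \<le> 5 ^ Suc i" by (induction i) auto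
  then have "(2::nat) ^ (5 * Suc i) \<le> 2 ^ (5 ^ Suc i)" by (rule power_increasing) simp
  then show ?thesis unfolding j mseq_Suc by (simp only: power_mult) simp
qed

lemma inverse_mseq_le:
  assumes "j \<ge> 1" shows "1 / real (mseq j) \<le> (1/32) ^ j"
proof -
  have "real (32 ^ j) \<le> real (mseq j)" using mseq_ge[OF assms] by (simp only: of_nat_le_iff)
  moreover have "0 < real (32 ^ j)" by simp
  ultimately have "1 / real (mseq j) \<le> 1 / real (32 ^ j)"
    by (intro divide_left_mono mult_pos_pos) linarith+
  then show ?thesis by (simp add: power_one_over)
qed

text \<open>With this bound the index of a functional in \<open>G1\<close> and the weight index of
  an operation are handled by the same geometric estimates.\<close>

lemma inverse_mseq_sq_le:
  assumes "j \<ge> 1" shows "1 / real (mseq (2 * j - 1)) ^ 2 \<le> (1/32) ^ j"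
proof -
  define i where "i = 2 * j - 1"
  have i: "i \<ge> 1" "j \<le> i" using assms unfolding i_def by auto
  have "1 / real (mseq i) ^ 2 = (1 / real (mseq i)) * (1 / real (mseq i))"
    by (simp add: power2_eq_square)
  also have "\<dots> \<le> (1/32) ^ i * 1"
    by (rule mult_mono) (use inverse_mseq_le[OF i(1)] in \<open>auto simp: divide_le_eq_1\<close>)
  also have "\<dots> \<le> (1/32) ^ j" using i by (simp add: power_decreasing)
  finally show ?thesis unfolding i_def .
qed

lemma geometric_tail_le:
  assumes "finite J" "\<And>j. j \<in> J \<Longrightarrow> j0 < j"
  shows "(\<Sum>j\<in>J. (1/32) ^ j) \<le> (1/32::real) ^ j0 / 31"
proof -
  have e: "(\<Sum>j\<in>{Suc j0..<Suc j0 + d}. (1/32::real) ^ j) = (1/32) ^ j0 / 31 * (1 - (1/32) ^ d)" for d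
  proof (induction d)
    case (Suc d)
    have "(\<Sum>j\<in>{Suc j0..<Suc j0 + Suc d}. (1/32::real) ^ j)
        = (1/32) ^ j0 / 31 * (1 - (1/32) ^ d) + (1/32) ^ (Suc j0 + d)"
      using Suc by simp
    also have "\<dots> = (1/32) ^ j0 / 31 * (1 - (1/32) ^ d) + (1/32) ^ j0 * ((1/32) ^ d / 32)"
      by (simp add: power_add)
    also have "\<dots> = (1/32) ^ j0 / 31 * (1 - (1/32) ^ Suc d)"
      by (simp add: algebra_simps diff_divide_distrib)
    finally show ?case .
  qed simp
  obtain d where d: "J \<subseteq> {..<d}" using assms(1) finite_nat_iff_bounded by blast
  have "J \<subseteq> {Suc j0..<Suc j0 + d}"
  proof
    fix j assume "j \<in> J"
    then show "j \<in> {Suc j0..<Suc j0 + d}" using assms(2)[of j] d by auto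
  qed
  then have "(\<Sum>j\<in>J. (1/32::real) ^ j) \<le> (\<Sum>j\<in>{Suc j0..<Suc j0 + d}. (1/32) ^ j)"
    by (intro sum_mono2) auto
  also have "\<dots> \<le> (1/32) ^ j0 / 31"
    unfolding e by (rule mult_right_le_one_le) (auto simp: power_le_one)
  finally show ?thesis .
qed


section \<open>The ground set\<close>

lemma mseq_pos: "j \<ge> 1 \<Longrightarrow> mseq j > 0"
  using mseq_ge[of j] by (meson less_le_trans zero_less_numeral zero_less_power)

text \<open>In terms of support and modulus, stability under restriction and under change of sign
  becomes visible.\<close>

lemma G1j_iff:
  "f \<in> G1j j \<longleftrightarrow> j \<ge> 1 \<and> finite (supp f) \<and> supp f \<subseteq> {1..} \<and> supp f \<noteq> {} \<and>
    card (supp f) \<le> nseq (2 * j - 1) \<and> (\<forall>n\<in>supp f. \<bar>f n\<bar> = 1 / real (mseq (2 * j - 1)) ^ 2)"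
  (is "?l \<longleftrightarrow> ?r")
proof
  assume ?l
  then obtain B \<epsilon> where f: "f = (\<lambda>k. (\<Sum>i\<in>B. \<epsilon> i * unit_vec i k) / real (mseq (2 * j - 1)) ^ 2)"
    and B: "j \<ge> 1" "finite B" "B \<subseteq> {1..}" "1 \<le> card B" "card B \<le> nseq (2 * j - 1)"
      "\<forall>i\<in>B. \<epsilon> i \<in> {-1, 1::real}"
    unfolding G1j_def by blast
  have fk: "f k = (if k \<in> B then \<epsilon> k / real (mseq (2 * j - 1)) ^ 2 else 0)" for k
  proof -
    have "(\<Sum>i\<in>B. \<epsilon> i * unit_vec i k) = (\<Sum>i\<in>B. if i = k then \<epsilon> k else 0)"
      by (rule sum.cong) (auto simp: unit_vec_def)
    then show ?thesis unfolding f using B by simp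
  qed
  have "mseq (2 * j - 1) > 0" using B mseq_pos[of "2*j-1"] by simp
  then have s: "supp f = B" using B(6) unfolding supp_def fk by auto
  show ?r unfolding s fk using B by (auto simp: fk)
next
  assume r: ?r
  define M where "M = real (mseq (2 * j - 1)) ^ 2"
  have "2 * j - 1 \<ge> 1" using r by linarith
  then have M: "M > 0" using mseq_pos[of "2*j-1"] by (simp add: M_def)
  have "f = (\<lambda>k. (\<Sum>i\<in>supp f. (f i * M) * unit_vec i k) / M)"
  proof
    fix k
    have "(\<Sum>i\<in>supp f. (f i * M) * unit_vec i k) = (\<Sum>i\<in>supp f. if i = k then f k * M else 0)"
      by (rule sum.cong) (auto simp: unit_vec_def)
    then show "f k = (\<Sum>i\<in>supp f. (f i * M) * unit_vec i k) / M"
      using r M by (simp add: supp_def)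
  qed
  moreover have "f i * M \<in> {-1, 1}" if "i \<in> supp f" for i
  proof -
    have "\<bar>f i\<bar> * M = 1" using r that M by (simp add: M_def)
    then show ?thesis by (auto simp: abs_if split: if_splits)
  qed
  moreover have "1 \<le> card (supp f)" using r by (simp add: Suc_leI card_gt_0_iff)
  ultimately show ?l unfolding G1j_def M_def[symmetric] using r
    by (intro CollectI exI[of _ "supp f"] exI[of _ "\<lambda>i. f i * M"]) simp
qed

lemma mseq_strict_mono: "1 \<le> i \<Longrightarrow> i < j \<Longrightarrow> mseq i < mseq j"
proof -
  assume *: "1 \<le> i" "i < j"
  then obtain i' j' where ij: "i = Suc i'" "j = Suc j'" by (metis Suc_le_D One_nat_def less_imp_Suc_add)
  have "(5::nat) ^ Suc i' < 5 ^ Suc j'" using * ij by (intro power_strict_increasing) auto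
  then show ?thesis unfolding ij mseq_Suc by (rule power_strict_increasing) simp
qed

text \<open>All nonzero coordinates have the same modulus, and it determines \<open>j\<close>
  because \<open>mseq\<close> is strictly increasing.\<close>

lemma G1j_unique:
  assumes "f \<in> G1j i" "f \<in> G1j j" shows "i = j"
proof -
  have ij: "i \<ge> 1" "j \<ge> 1" using assms by (auto simp: G1j_iff)
  obtain n where n: "n \<in> supp f" using assms by (auto simp: G1j_iff)
  then have "1 / real (mseq (2 * i - 1)) ^ 2 = 1 / real (mseq (2 * j - 1)) ^ 2"
    using assms by (metis G1j_iff)
  moreover have "mseq (2*i-1) > 0" "mseq (2*j-1) > 0" using mseq_pos ij by auto
  ultimately have "real (mseq (2 * i - 1)) ^ 2 = real (mseq (2 * j - 1)) ^ 2"
    by (simp add: field_simps)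
  then have "mseq (2*i-1) = mseq (2*j-1)"
    by (simp add: power2_eq_iff_nonneg)
  then have "2*i-1 = 2*j-1"
  proof (cases "2*i-1" "2*j-1" rule: linorder_cases)
    case less
    have "1 \<le> 2*i-1" using ij by linarith
    from mseq_strict_mono[OF this less] show ?thesis using \<open>mseq (2*i-1) = mseq (2*j-1)\<close> by simp
  next
    case greater
    have "1 \<le> 2*j-1" using ij by linarith
    from mseq_strict_mono[OF this greater] show ?thesis using \<open>mseq (2*i-1) = mseq (2*j-1)\<close> by simp
  qed
  then show ?thesis using ij by linarith
qed

definition gind :: "(nat \<Rightarrow> real) \<Rightarrow> nat" where
  "gind f = (THE j. f \<in> G1j j)"

lemma gind_eq: "f \<in> G1j j \<Longrightarrow> gind f = j"
  unfolding gind_def using G1j_unique by blast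

lemma G1j_abs_le:
  assumes "f \<in> G1j j" shows "\<bar>f n\<bar> \<le> (1/32) ^ j"
proof (cases "n \<in> supp f")
  case True
  then show ?thesis using assms inverse_mseq_sq_le[of j] by (auto simp: G1j_iff)
qed (simp add: supp_def)

lemma G1j_restr:
  assumes "f \<in> G1j j" "restr E f \<noteq> (\<lambda>_. 0)"
  shows "restr E f \<in> G1j j"
proof -
  have "card (supp f \<inter> E) \<le> card (supp f)"
    by (rule card_mono) (use assms in \<open>auto simp: G1j_iff\<close>)
  moreover obtain x where "x \<in> E" "f x \<noteq> 0"
    using assms(2) unfolding restr_def by (auto simp: fun_eq_iff split: if_splits)
  then have "supp f \<inter> E \<noteq> {}" by (auto simp: supp_def)
  ultimately show ?thesis using assms(1) unfolding G1j_iff supp_restr by (auto simp: restr_def)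
qed

lemma G1j_scale_sign:
  assumes "f \<in> G1j j" "e \<in> {-1, 1::real}"
  shows "(\<lambda>n. e * f n) \<in> G1j j"
proof -
  have "supp (\<lambda>n. e * f n) = supp f" using assms(2) unfolding supp_def by auto
  then show ?thesis using assms unfolding G1j_iff by (auto simp: abs_mult)
qed

section \<open>Sequences in \<open>G1\<close> with increasing indices\<close>

lemma Useq_nth:
  assumes "fs \<in> Useq" "p < length fs"
  shows "fs ! p \<in> G1j (gind (fs ! p))"
  using assms gind_eq unfolding Useq_def by fastforce

lemma Useq_gind_less:
  assumes "fs \<in> Useq" "p < q" "q < length fs"
  shows "gind (fs ! p) < gind (fs ! q)"
proof -
  obtain js where js: "length js = length fs" "sorted_wrt (<) js" "\<forall>i<length fs. fs ! i \<in> G1j (js ! i)"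
    using assms(1) unfolding Useq_def by blast
  then have "gind (fs ! p) = js ! p" "gind (fs ! q) = js ! q"
    using assms gind_eq by auto
  then show ?thesis using js assms by (simp add: sorted_wrt_iff_nth_less)
qed

lemma Useq_gind_inj:
  assumes "fs \<in> Useq" "p < length fs" "q < length fs" "gind (fs ! p) = gind (fs ! q)"
  shows "p = q"
  using Useq_gind_less[OF assms(1), of p q] Useq_gind_less[OF assms(1), of q p] assms
  by (cases p q rule: linorder_cases) auto

lemma Useq_successive: "fs \<in> Useq \<Longrightarrow> successive fs"
  unfolding Useq_def by blast

lemma Useq_c00: "fs \<in> Useq \<Longrightarrow> p < length fs \<Longrightarrow> fs ! p \<in> c00"
  using Useq_nth G1j_subset_c00 by blast

lemma Useq_take: "fs \<in> Useq \<Longrightarrow> 0 < p \<Longrightarrow> take p fs \<in> Useq"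
proof -
  assume fs: "fs \<in> Useq" and p: "0 < p"
  then obtain js where js: "length js = length fs" "sorted_wrt (<) js" "\<forall>i<length fs. fs ! i \<in> G1j (js ! i)"
    unfolding Useq_def by blast
  have "sorted_wrt (<) (take p js)" using js(2) by (rule sorted_wrt_take)
  moreover have "successive (take p fs)"
    using fs unfolding Useq_def successive_def by (auto intro: sorted_wrt_take)
  ultimately show ?thesis using fs js p unfolding Useq_def
    by (auto intro!: exI[of _ "take p js"])
qed

lemma Useq_single: "f \<in> G1j j \<Longrightarrow> [f] \<in> Useq"
  unfolding Useq_def successive_def by (auto intro!: exI[of _ "[j]"])

section \<open>Special functionals, windows of indices, and l2-sums\<close>

text \<open>The part of \<open>E (\<Sum> \<epsilon>\<^sub>p f\<^sub>p)\<close> with indices in \<open>W\<close>.\<close>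

definition gpart :: "nat set \<Rightarrow> (nat \<Rightarrow> real) list \<Rightarrow> (nat \<Rightarrow> real) \<Rightarrow> nat set \<Rightarrow> nat \<Rightarrow> real" where
  "gpart W fs \<epsilon> E = (\<lambda>n. \<Sum>p\<in>{p. p < length fs \<and> gind (fs ! p) \<in> W}. \<epsilon> p * restr E (fs ! p) n)"

definition ginds :: "nat set \<Rightarrow> (nat \<Rightarrow> real) list \<Rightarrow> nat set" where
  "ginds E fs = {gind (fs ! p) | p. p < length fs \<and> restr E (fs ! p) \<noteq> (\<lambda>_. 0)}"

lemma gpart_c00: "fs \<in> Useq \<Longrightarrow> gpart W fs \<epsilon> E \<in> c00"
  unfolding gpart_def by (rule c00_sum) (use Useq_c00 c00_restr in auto)

lemma act_gpart:
  "fs \<in> Useq \<Longrightarrow> act (gpart W fs \<epsilon> E) u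
    = (\<Sum>p\<in>{p. p < length fs \<and> gind (fs ! p) \<in> W}. \<epsilon> p * act (restr E (fs ! p)) u)"
  unfolding gpart_def by (rule act_sum_left) (use Useq_c00 c00_restr in auto)

lemma restr_gpart: "restr E' (gpart W fs \<epsilon> E) = gpart W fs \<epsilon> (E' \<inter> E)"
  unfolding gpart_def restr_sum restr_restr by simp

lemma ginds_mono: "E \<subseteq> E' \<Longrightarrow> ginds E fs \<subseteq> ginds E' fs"
  unfolding ginds_def restr_def by (auto simp: fun_eq_iff subset_iff)

lemma gpart_eq_zero: "ginds E fs \<inter> W = {} \<Longrightarrow> gpart W fs \<epsilon> E = (\<lambda>_. 0)"
  unfolding gpart_def ginds_def by (rule ext, rule sum.neutral) (auto simp: fun_eq_iff)

text \<open>A functional of \<open>G1\<close> counts as a list of length one, even when its index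
  lies in \<open>M2\<close> and the list is not special. Both kinds of terms of \<open>Gl2\<close>
  then have the same form.\<close>

definition spec_list :: "(omega1 \<Rightarrow> nat \<Rightarrow> omega1) \<Rightarrow> omega1 \<Rightarrow> nat set \<Rightarrow> ((nat \<Rightarrow> real) list \<Rightarrow> nat)
    \<Rightarrow> (nat \<Rightarrow> real) list \<Rightarrow> bool" where
  "spec_list L \<xi> M1 \<sigma>1 fs \<longleftrightarrow> special L \<xi> M1 \<sigma>1 fs \<or> (\<exists>f j. fs = [f] \<and> f \<in> G1j j)"

lemma spec_list_Useq: "spec_list L \<xi> M1 \<sigma>1 fs \<Longrightarrow> fs \<in> Useq"
  unfolding spec_list_def special_def using Useq_single by blast

definition gtriple :: "(omega1 \<Rightarrow> nat \<Rightarrow> omega1) \<Rightarrow> omega1 \<Rightarrow> nat set \<Rightarrow> ((nat \<Rightarrow> real) list \<Rightarrow> nat)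
    \<Rightarrow> (nat \<Rightarrow> real) list \<Rightarrow> (nat \<Rightarrow> real) \<Rightarrow> nat set \<Rightarrow> bool" where
  "gtriple L \<xi> M1 \<sigma>1 fs \<epsilon> E \<longleftrightarrow>
     spec_list L \<xi> M1 \<sigma>1 fs \<and> nat_interval E \<and> (\<forall>p<length fs. \<epsilon> p \<in> {-1, 1})"

lemma gtriple_Useq: "gtriple L \<xi> M1 \<sigma>1 fs \<epsilon> E \<Longrightarrow> fs \<in> Useq"
  unfolding gtriple_def using spec_list_Useq by blast

text \<open>The members with index in an interval \<open>W\<close> are consecutive in the list, and
  supports are successive, so a window of indices amounts to a restriction to an interval of
  coordinates. The result is again a generator, unless it vanishes, which for a single functional of
  \<open>G1\<close> has no index set.\<close>

lemma gpart_in_ind: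
  assumes t: "gtriple L \<xi> M1 \<sigma>1 fs \<epsilon> E" and W: "nat_interval W"
    and nz: "gpart W fs \<epsilon> E \<noteq> (\<lambda>_. 0)"
  shows "(gpart W fs \<epsilon> E, ginds E fs \<inter> W) \<in> Gsp_ind L \<xi> M1 \<sigma>1 \<union> G1_ind"
proof (cases "special L \<xi> M1 \<sigma>1 fs")
  case True
  have U: "fs \<in> Useq" by (rule gtriple_Useq[OF t])
  define S where "S = (\<Union>p\<in>{p. p < length fs \<and> gind (fs ! p) \<in> W}. supp (fs ! p))"
  define E' where "E' = E \<inter> hull_interval S"
  have E': "nat_interval E'"
    unfolding E'_def using t nat_interval_hull by (auto simp: gtriple_def intro: nat_interval_Int)
  have in_W: "restr E' (fs ! p) = restr E (fs ! p)" if "p < length fs" "gind (fs ! p) \<in> W" for p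
  proof
    fix n
    have "n \<in> hull_interval S" if "(fs ! p) n \<noteq> 0"
      using \<open>p < length fs\<close> \<open>gind (fs ! p) \<in> W\<close> that hull_interval_superset[of S]
      unfolding S_def supp_def by blast
    then show "restr E' (fs ! p) n = restr E (fs ! p) n" unfolding E'_def restr_def by auto
  qed
  \<comment> \<open>A member meeting the hull stands between two members with index in
    \<open>W\<close>; since indices increase along the list, its own index lies in \<open>W\<close>
    as well.\<close>
  have not_W: "restr E' (fs ! p) = (\<lambda>_. 0)" if p: "p < length fs" "gind (fs ! p) \<notin> W" for p
  proof
    fix n
    have "(fs ! p) n = 0" if n: "n \<in> hull_interval S"
    proof (rule ccontr)
      assume "(fs ! p) n \<noteq> 0"
      then have np: "n \<in> supp (fs ! p)" by (simp add: supp_def)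
      obtain q a r b where q: "q < length fs" "gind (fs ! q) \<in> W" "a \<in> supp (fs ! q)" "a \<le> n"
        and r: "r < length fs" "gind (fs ! r) \<in> W" "b \<in> supp (fs ! r)" "n \<le> b"
        using n unfolding hull_interval_def S_def by blast
      have "q < p"
        using successive_nth[OF Useq_successive[OF U], of p q] q p np
        by (cases q p rule: linorder_cases) (force simp: before_def)+
      moreover have "p < r"
        using successive_nth[OF Useq_successive[OF U], of r p] r p np
        by (cases r p rule: linorder_cases) (force simp: before_def)+
      ultimately have "gind (fs ! p) \<in> W"
        using nat_intervalD[OF W q(2) r(2)] Useq_gind_less[OF U, of q p] Useq_gind_less[OF U, of p r] p r
        by simp
      then show False using p by simp
    qed
    then show "restr E' (fs ! p) n = 0" unfolding E'_def restr_def by auto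
  qed
  have "gpart W fs \<epsilon> E = restr E' (\<lambda>n. \<Sum>i<length fs. \<epsilon> i * (fs ! i) n)"
    unfolding gpart_def restr_sum
    by (rule ext, rule sum.mono_neutral_cong_left) (use in_W not_W in auto)
  moreover have "ginds E fs \<inter> W = {j. \<exists>i<length fs. fs ! i \<in> G1j j \<and> restr E' (fs ! i) \<noteq> (\<lambda>_. 0)}"
    unfolding ginds_def using in_W not_W Useq_nth[OF U] gind_eq by fastforce
  ultimately show ?thesis
    unfolding Gsp_ind_def using True E' t unfolding gtriple_def
    by (intro UnI1 CollectI exI[of _ E'] exI[of _ fs] exI[of _ \<epsilon>]) auto
next
  case False
  then obtain f j where f: "fs = [f]" "f \<in> G1j j" using t unfolding gtriple_def spec_list_def by blast
  have g: "gind f = j" using f gind_eq by simp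
  have j: "j \<in> W"
  proof (rule ccontr)
    assume "j \<notin> W"
    then have e: "{p. p < length fs \<and> gind (fs ! p) \<in> W} = {}" using f g by auto
    have "gpart W fs \<epsilon> E = (\<lambda>_. 0)" unfolding gpart_def e by simp
    then show False using nz by simp
  qed
  have "{p. p < length fs \<and> gind (fs ! p) \<in> W} = {0}" using f g j by auto
  then have eq: "gpart W fs \<epsilon> E = (\<lambda>n. \<epsilon> 0 * restr E f n)" unfolding gpart_def f by simp
  then have nz': "restr E f \<noteq> (\<lambda>_. 0)" using nz by auto
  then have "ginds E fs = {j}" unfolding ginds_def f using g by auto
  moreover have "gpart W fs \<epsilon> E \<in> G1j j"
    unfolding eq by (rule G1j_scale_sign[OF G1j_restr[OF f(2) nz']]) (use t f in \<open>auto simp: gtriple_def\<close>)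
  ultimately show ?thesis using j unfolding G1_ind_def by auto
qed

lemma Gl2_intro:
  assumes fin: "finite I" and t: "\<And>i. i \<in> I \<Longrightarrow> (\<phi> i, J i) \<in> Gsp_ind L \<xi> M1 \<sigma>1 \<union> G1_ind"
    and dis: "\<And>i k. i \<in> I \<Longrightarrow> k \<in> I \<Longrightarrow> i \<noteq> k \<Longrightarrow> J i \<inter> J k = {}"
    and a: "\<And>i. i \<in> I \<Longrightarrow> a i \<in> \<rat>" "(\<Sum>i\<in>I. (a i)\<^sup>2) \<le> 1" and ne: "I \<noteq> {}"
  shows "(\<lambda>n. \<Sum>i\<in>I. a i * \<phi> i n) \<in> Gl2 L \<xi> M1 \<sigma>1"
proof -
  obtain h where h: "bij_betw h {1..card I} I" using ex_bij_betw_nat_finite_1[OF fin] by blast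
  have hI: "h i \<in> I" if "i \<in> {1..card I}" for i using h that bij_betwE by blast
  have r: "(\<Sum>i\<in>I. F i) = (\<Sum>i\<in>{1..card I}. F (h i))" for F :: "_ \<Rightarrow> real"
    using sum.reindex_bij_betw[OF h] by metis
  show ?thesis unfolding Gl2_def
  proof (intro CollectI exI conjI ballI impI)
    show "(\<lambda>n. \<Sum>i\<in>I. a i * \<phi> i n) = (\<lambda>n. \<Sum>i\<in>{1..card I}. (a \<circ> h) i * (\<phi> \<circ> h) i n)"
      by (simp add: r)
    show "1 \<le> card I" using fin ne by (simp add: Suc_leI card_gt_0_iff)
    show "(\<Sum>i\<in>{1..card I}. ((a \<circ> h) i)\<^sup>2) \<le> 1" using a(2) by (simp add: r)
    fix i assume i: "i \<in> {1..card I}"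
    show "(a \<circ> h) i \<in> \<rat>" using a hI[OF i] by simp
    show "((\<phi> \<circ> h) i, (J \<circ> h) i) \<in> Gsp_ind L \<xi> M1 \<sigma>1 \<union> G1_ind" using t hI[OF i] by simp
    fix k assume k: "k \<in> {1..card I}" "i \<noteq> k"
    then have "h i \<noteq> h k" using h i by (metis bij_betw_def inj_on_eq_iff)
    then show "(J \<circ> h) i \<inter> (J \<circ> h) k = {}" using dis hI i k by simp
  qed
qed

text \<open>Data of a functional of the form in \<open>Gl2\<close>. Keeping the lists, and not only
  the functionals they define, makes it possible to cut each one by windows of indices.\<close>

definition ground_rep where
  "ground_rep L \<xi> M1 \<sigma>1 I a fs \<epsilon> E \<longleftrightarrow> finite (I::nat set) \<and> (\<Sum>i\<in>I. (a i)\<^sup>2) \<le> (1::real) \<and>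
     (\<forall>i\<in>I. gtriple L \<xi> M1 \<sigma>1 (fs i) (\<epsilon> i) (E i)) \<and>
     (\<forall>i\<in>I. \<forall>k\<in>I. i \<noteq> k \<longrightarrow> ginds (E i) (fs i) \<inter> ginds (E k) (fs k) = {})"

definition ground_fun where
  "ground_fun I a fs \<epsilon> E = (\<lambda>n. \<Sum>i\<in>(I::nat set). a i * gpart UNIV (fs i) (\<epsilon> i) (E i) n)"

lemma ind_gtriple:
  assumes "(\<phi>, J) \<in> Gsp_ind L \<xi> M1 \<sigma>1 \<union> G1_ind"
  shows "\<exists>fs \<epsilon> E. gtriple L \<xi> M1 \<sigma>1 fs \<epsilon> E \<and> \<phi> = gpart UNIV fs \<epsilon> E \<and> J = ginds E fs"
  using assms
proof
  assume "(\<phi>, J) \<in> Gsp_ind L \<xi> M1 \<sigma>1"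
  then obtain E fs \<epsilon> where e: "\<phi> = restr E (\<lambda>n. \<Sum>i<length fs. \<epsilon> i * (fs ! i) n)"
    "J = {j. \<exists>i<length fs. fs ! i \<in> G1j j \<and> restr E (fs ! i) \<noteq> (\<lambda>_. 0)}"
    "special L \<xi> M1 \<sigma>1 fs" "nat_interval E" "\<forall>i<length fs. \<epsilon> i \<in> {-1, 1}"
    unfolding Gsp_ind_def by blast
  have t: "gtriple L \<xi> M1 \<sigma>1 fs \<epsilon> E" using e unfolding gtriple_def spec_list_def by auto
  have "\<phi> = gpart UNIV fs \<epsilon> E" unfolding e gpart_def restr_sum by (simp add: lessThan_def)
  moreover have "J = ginds E fs"
    unfolding e ginds_def using Useq_nth[OF gtriple_Useq[OF t]] gind_eq by fastforce
  ultimately show ?thesis using t by blast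
next
  assume "(\<phi>, J) \<in> G1_ind"
  then obtain j where j: "J = {j}" "\<phi> \<in> G1j j" unfolding G1_ind_def by blast
  have "gtriple L \<xi> M1 \<sigma>1 [\<phi>] (\<lambda>_. 1) UNIV"
    using j unfolding gtriple_def spec_list_def by auto
  moreover have "\<phi> = gpart UNIV [\<phi>] (\<lambda>_. 1) UNIV"
    unfolding gpart_def by simp
  moreover have "\<phi> \<noteq> (\<lambda>_. 0)" using j by (auto simp: G1j_iff supp_def)
  then have "J = ginds UNIV [\<phi>]" unfolding ginds_def j using gind_eq[OF j(2)] by auto
  ultimately show ?thesis by blast
qed

text \<open>Members of \<open>G1\<close> and of \<open>Gsp\<close> are l2-sums with a single
  coefficient 1.\<close>

lemma Gset_ground_rep:
  assumes "g \<in> Gset L \<xi> M1 \<sigma>1" "g \<notin> G0"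
  shows "\<exists>I a fs \<epsilon> E. ground_rep L \<xi> M1 \<sigma>1 I a fs \<epsilon> E \<and> g = ground_fun I a fs \<epsilon> E"
proof -
  have "g \<in> Gl2 L \<xi> M1 \<sigma>1"
  proof (cases "g \<in> Gl2 L \<xi> M1 \<sigma>1")
    case False
    then have "g \<in> G1 \<union> Gsp L \<xi> M1 \<sigma>1" using assms unfolding Gset_def by blast
    then obtain J where "(g, J) \<in> Gsp_ind L \<xi> M1 \<sigma>1 \<union> G1_ind"
      unfolding G1_def Gsp_def G1_ind_def by force
    then have "(\<lambda>n. \<Sum>i\<in>{1..1::nat}. 1 * g n) \<in> Gl2 L \<xi> M1 \<sigma>1"
      by (intro Gl2_intro[where a = "\<lambda>_. 1" and \<phi> = "\<lambda>_. g" and J = "\<lambda>_. J"]) auto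
    then show ?thesis by simp
  qed
  then obtain d a \<phi> J where g: "g = (\<lambda>n. \<Sum>i\<in>{1..d::nat}. a i * \<phi> i n)" "(\<Sum>i\<in>{1..d}. (a i)\<^sup>2) \<le> 1"
    "\<forall>i\<in>{1..d}. (\<phi> i, J i) \<in> Gsp_ind L \<xi> M1 \<sigma>1 \<union> G1_ind"
    "\<forall>i\<in>{1..d}. \<forall>k\<in>{1..d}. i \<noteq> k \<longrightarrow> J i \<inter> J k = {}"
    unfolding Gl2_def by blast
  have "\<forall>i\<in>{1..d}. \<exists>fs \<epsilon> E. gtriple L \<xi> M1 \<sigma>1 fs \<epsilon> E \<and> \<phi> i = gpart UNIV fs \<epsilon> E \<and> J i = ginds E fs"
    using g(3) ind_gtriple by blast
  then obtain fs \<epsilon> E where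
    *: "\<forall>i\<in>{1..d}. gtriple L \<xi> M1 \<sigma>1 (fs i) (\<epsilon> i) (E i) \<and> \<phi> i = gpart UNIV (fs i) (\<epsilon> i) (E i)
      \<and> J i = ginds (E i) (fs i)"
    by metis
  have "ground_rep L \<xi> M1 \<sigma>1 {1..d} a fs \<epsilon> E" unfolding ground_rep_def using g * by auto
  moreover have "g = ground_fun {1..d} a fs \<epsilon> E" unfolding ground_fun_def g using * by auto
  ultimately show ?thesis by blast
qed

lemma ground_rep_restr:
  assumes "ground_rep L \<xi> M1 \<sigma>1 I a fs \<epsilon> E" "nat_interval E'"
  shows "ground_rep L \<xi> M1 \<sigma>1 I a fs \<epsilon> (\<lambda>i. E' \<inter> E i)"
    and "restr E' (ground_fun I a fs \<epsilon> E) = ground_fun I a fs \<epsilon> (\<lambda>i. E' \<inter> E i)"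
proof -
  have m: "ginds (E' \<inter> E i) (fs i) \<subseteq> ginds (E i) (fs i)" for i by (rule ginds_mono) blast
  show "ground_rep L \<xi> M1 \<sigma>1 I a fs \<epsilon> (\<lambda>i. E' \<inter> E i)"
    using assms m nat_interval_Int unfolding ground_rep_def gtriple_def by (meson disjoint_iff subsetD)
  show "restr E' (ground_fun I a fs \<epsilon> E) = ground_fun I a fs \<epsilon> (\<lambda>i. E' \<inter> E i)"
    unfolding ground_fun_def restr_sum restr_gpart by simp
qed

definition pieces where
  "pieces I fs E = {(i, p). i \<in> I \<and> p < length (fs i) \<and> restr (E i) (fs i ! p) \<noteq> (\<lambda>_. 0)}"

lemma finite_pieces: "finite I \<Longrightarrow> finite (pieces I fs E)"
  by (rule finite_subset[of _ "Sigma I (\<lambda>i. {..<length (fs i)})"]) (auto simp: pieces_def)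

text \<open>Indices increase within one list, and different lists have disjoint index sets. Hence a
  sum over pieces is a sum over distinct indices and is dominated by a geometric series.\<close>

lemma pieces_inj:
  assumes "ground_rep L \<xi> M1 \<sigma>1 I a fs \<epsilon> E"
  shows "inj_on (\<lambda>(i, p). gind (fs i ! p)) (pieces I fs E)"
proof (rule inj_onI, clarify)
  fix i p k q assume *: "(i, p) \<in> pieces I fs E" "(k, q) \<in> pieces I fs E" "gind (fs i ! p) = gind (fs k ! q)"
  then have "gind (fs i ! p) \<in> ginds (E i) (fs i) \<inter> ginds (E k) (fs k)"
    unfolding pieces_def ginds_def by auto
  then have "i = k" using assms * unfolding ground_rep_def pieces_def by blast
  moreover have "fs i \<in> Useq" using assms * gtriple_Useq unfolding ground_rep_def pieces_def by blast
  ultimately show "i = k \<and> p = q" using Useq_gind_inj * unfolding pieces_def by blast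
qed

lemma gpart_pieces:
  assumes "finite I"
  shows "(\<Sum>i\<in>I. a i * gpart W (fs i) (\<epsilon> i) (E i) n) =
    (\<Sum>(i, p)\<in>{(i, p)\<in>pieces I fs E. gind (fs i ! p) \<in> W}. a i * \<epsilon> i p * restr (E i) (fs i ! p) n)"
proof -
  have "(\<Sum>i\<in>I. a i * gpart W (fs i) (\<epsilon> i) (E i) n) =
    (\<Sum>i\<in>I. \<Sum>p\<in>{p. p < length (fs i) \<and> gind (fs i ! p) \<in> W}. a i * \<epsilon> i p * restr (E i) (fs i ! p) n)"
    unfolding gpart_def by (simp add: sum_distrib_left mult.assoc)
  also have "\<dots> = (\<Sum>(i, p)\<in>Sigma I (\<lambda>i. {p. p < length (fs i) \<and> gind (fs i ! p) \<in> W}).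
      a i * \<epsilon> i p * restr (E i) (fs i ! p) n)"
    by (rule sum.Sigma) (use assms in auto)
  also have "\<dots> = (\<Sum>(i, p)\<in>{(i, p)\<in>pieces I fs E. gind (fs i ! p) \<in> W}. a i * \<epsilon> i p * restr (E i) (fs i ! p) n)"
    by (rule sum.mono_neutral_right) (use assms in \<open>auto simp: pieces_def\<close>)
  finally show ?thesis .
qed

lemma piece_G1j:
  assumes "ground_rep L \<xi> M1 \<sigma>1 I a fs \<epsilon> E" "(i, p) \<in> pieces I fs E"
  shows "restr (E i) (fs i ! p) \<in> G1j (gind (fs i ! p))" "\<epsilon> i p \<in> {-1, 1}" "i \<in> I"
proof -
  have t: "gtriple L \<xi> M1 \<sigma>1 (fs i) (\<epsilon> i) (E i)" and p: "p < length (fs i)"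
    using assms unfolding ground_rep_def pieces_def by auto
  show "restr (E i) (fs i ! p) \<in> G1j (gind (fs i ! p))"
    by (rule G1j_restr[OF Useq_nth[OF gtriple_Useq[OF t] p]]) (use assms in \<open>auto simp: pieces_def\<close>)
  show "\<epsilon> i p \<in> {-1, 1}" "i \<in> I" using t p assms unfolding gtriple_def pieces_def by auto
qed

lemma ground_rep_coeff:
  "ground_rep L \<xi> M1 \<sigma>1 I a fs \<epsilon> E \<Longrightarrow> i \<in> I \<Longrightarrow> \<bar>a i\<bar> \<le> 1"
  unfolding ground_rep_def by (rule abs_coeff_le_one) auto

lemma ground_fun_abs_le:
  assumes r: "ground_rep L \<xi> M1 \<sigma>1 I a fs \<epsilon> E"
  shows "\<bar>ground_fun I a fs \<epsilon> E n\<bar> \<le> 1"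
proof -
  let ?D = "{(i, p)\<in>pieces I fs E. gind (fs i ! p) \<in> UNIV}"
  have fI: "finite I" using r unfolding ground_rep_def by blast
  have "ground_fun I a fs \<epsilon> E n = (\<Sum>(i, p)\<in>?D. a i * \<epsilon> i p * restr (E i) (fs i ! p) n)"
    unfolding ground_fun_def by (rule gpart_pieces[OF fI])
  also have "?D = pieces I fs E" by auto
  finally have "\<bar>ground_fun I a fs \<epsilon> E n\<bar> \<le> (\<Sum>(i, p)\<in>pieces I fs E. \<bar>a i * \<epsilon> i p * restr (E i) (fs i ! p) n\<bar>)"
    by (simp add: case_prod_unfold)
  also have "\<dots> \<le> (\<Sum>(i, p)\<in>pieces I fs E. (1/32) ^ (gind (fs i ! p)))"
  proof (rule sum_mono, clarify)
    fix i p assume ip: "(i, p) \<in> pieces I fs E"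
    have "\<bar>a i\<bar> * \<bar>\<epsilon> i p\<bar> * \<bar>restr (E i) (fs i ! p) n\<bar> \<le> 1 * 1 * (1/32) ^ (gind (fs i ! p))"
      by (intro mult_mono ground_rep_coeff[OF r] G1j_abs_le) (use piece_G1j[OF r ip] in auto)
    then show "\<bar>a i * \<epsilon> i p * restr (E i) (fs i ! p) n\<bar> \<le> (1/32) ^ (gind (fs i ! p))"
      by (simp add: abs_mult)
  qed
  also have "\<dots> = (\<Sum>j\<in>(\<lambda>(i, p). gind (fs i ! p)) ` pieces I fs E. (1/32) ^ j)"
    by (subst sum.reindex[OF pieces_inj[OF r]]) (simp add: case_prod_unfold)
  also have "\<dots> \<le> (1/32) ^ 0 / 31"
  proof (rule geometric_tail_le)
    fix j assume "j \<in> (\<lambda>(i, p). gind (fs i ! p)) ` pieces I fs E"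
    then show "0 < j" using piece_G1j(1)[OF r] by (force simp: G1j_iff)
  qed (simp add: finite_pieces[OF fI])
  finally show ?thesis by simp
qed

section \<open>The norming set\<close>

lemma nseq_pos: "j \<ge> 1 \<Longrightarrow> nseq j > 0"
  by (induction j rule: nseq.induct) auto

lemma sexp_pos: "sexp j > 0"
proof (rule ccontr)
  assume "\<not> sexp j > 0"
  then have "mseq (Suc j) ^ 3 = 1" using two_power_sexp[of j] by simp
  then show False using mseq_ge[of "Suc j"] one_less_power[of "32::nat" "Suc j"] by simp
qed

lemma nseq_less_Suc: "j \<ge> 1 \<Longrightarrow> nseq j < nseq (Suc j)"
proof -
  assume j: "j \<ge> 1"
  then obtain i where i: "j = Suc i" by (cases j) auto
  have "nseq j < (2 * nseq j) ^ 1" using nseq_pos[OF j] by simp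
  also have "\<dots> \<le> (2 * nseq j) ^ sexp j"
    using sexp_pos[of j] nseq_pos[OF j] by (intro power_increasing) auto
  finally show ?thesis unfolding i by simp
qed

lemma nseq_strict_mono: "1 \<le> i \<Longrightarrow> i < j \<Longrightarrow> nseq i < nseq j"
proof (induction j)
  case (Suc j)
  show ?case
  proof (cases "i = j")
    case True
    then show ?thesis using nseq_less_Suc Suc by simp
  next
    case False
    then have "nseq i < nseq j" using Suc by simp
    also have "\<dots> < nseq (Suc j)" using nseq_less_Suc[of j] Suc False by simp
    finally show ?thesis .
  qed
qed simp

lemma nseq_inj: "inj_on nseq {1..}"
  by (rule linorder_inj_onI') (use nseq_strict_mono in fastforce)

lemma op_result_abs_le:
  assumes "op_result A n \<theta> f" "\<And>g m. g \<in> A \<Longrightarrow> \<bar>g m\<bar> \<le> 1" "0 \<le> \<theta>"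
  shows "\<bar>f k\<bar> \<le> \<theta>"
proof -
  obtain fs where fs: "set fs \<subseteq> A" "successive fs" "f = (\<lambda>k. \<theta> * (\<Sum>i<length fs. (fs ! i) k))"
    using assms(1) unfolding op_result_def by blast
  have "\<bar>\<Sum>i<length fs. (fs ! i) k\<bar> \<le> (\<Sum>i<length fs. \<bar>(fs ! i) k\<bar>)" by (rule sum_abs)
  also have "\<dots> \<le> 1"
  proof (rule successive_sum_le[OF fs(2)])
    fix p assume "p < length fs"
    then have "fs ! p \<in> A" using fs(1) by auto
    then show "\<bar>(fs ! p) k\<bar> \<le> 1" by (rule assms(2))
  qed simp
  finally show ?thesis
    unfolding fs(3) using assms(3) by (simp add: abs_mult mult_left_le)
qed

lemma op_result_restr:
  assumes "op_result A n \<theta> f" "\<And>g. g \<in> A \<Longrightarrow> restr E g \<in> A"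
  shows "op_result A n \<theta> (restr E f)"
proof -
  obtain fs where fs: "fs \<noteq> []" "length fs \<le> n" "set fs \<subseteq> A" "successive fs"
    "f = (\<lambda>k. \<theta> * (\<Sum>i<length fs. (fs ! i) k))"
    using assms(1) unfolding op_result_def by blast
  show ?thesis unfolding op_result_def
    by (intro exI[of _ "map (restr E) fs"])
      (use fs assms(2) successive_map_restr in \<open>auto simp: restr_def\<close>)
qed

text \<open>Two chains of successive sets meet in a staircase pattern, and a staircase has at most
  as many cells as its rows and columns together.\<close>

lemma card_meeting_pairs:
  fixes u :: "nat \<Rightarrow> nat \<Rightarrow> real"
  assumes "finite H" "\<And>k l. k \<in> H \<Longrightarrow> l \<in> H \<Longrightarrow> k < l \<Longrightarrow> before (u k) (u l)" "successive fs"
  shows "card {(k, q). k \<in> H \<and> q < length fs \<and> supp (fs ! q) \<inter> supp (u k) \<noteq> {}} \<le> card H + length fs"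
proof -
  define P where "P = {(k, q). k \<in> H \<and> q < length fs \<and> supp (fs ! q) \<inter> supp (u k) \<noteq> {}}"
  define first where "first k q \<longleftrightarrow> (\<forall>q'<q. supp (fs ! q') \<inter> supp (u k) = {})" for k q
  \<comment> \<open>A pair is charged to the row \<open>k\<close> if \<open>q\<close> is the first
    column that meets it, and to the column \<open>q\<close> otherwise. Two rows cannot charge the
    same column: the later row also meets an earlier column, and this contradicts the order of the
    supports.\<close>
  define \<phi> where "\<phi> = (\<lambda>(k, q). if first k q then Inl k else Inr q)"
  have no: False if kq: "(k, q) \<in> P" "(k', q) \<in> P" "k < k'" "\<not> first k' q" for k k' q
  proof -
    obtain n1 where n1: "n1 \<in> supp (fs ! q)" "n1 \<in> supp (u k)" using kq unfolding P_def by blast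
    obtain q' n2 where n2: "q' < q" "n2 \<in> supp (fs ! q')" "n2 \<in> supp (u k')"
      using kq unfolding first_def by blast
    have "n1 < n2" using assms(2)[of k k'] kq n1 n2 unfolding P_def before_def by auto
    moreover have "n2 < n1"
      using successive_nth[OF assms(3) n2(1)] kq n1 n2 unfolding P_def before_def by auto
    ultimately show False by simp
  qed
  have inj: "inj_on \<phi> P"
  proof (rule inj_onI, clarify)
    fix k q k' q' assume *: "(k, q) \<in> P" "(k', q') \<in> P" "\<phi> (k, q) = \<phi> (k', q')"
    show "k = k' \<and> q = q'"
    proof (cases "first k q")
      case True
      then have k: "k = k'" "first k' q'" using *(3) unfolding \<phi>_def by (auto split: if_splits)
      then have "q = q'"
        using True *(1,2) unfolding first_def P_def
        by (cases q q' rule: linorder_cases) auto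
      then show ?thesis using k by simp
    next
      case False
      then have q: "q = q'" "\<not> first k' q'" using *(3) unfolding \<phi>_def by (auto split: if_splits)
      then have "k = k'"
        using no[of k q k'] no[of k' q k] False *(1,2) by (cases k k' rule: linorder_cases) auto
      then show ?thesis using q by simp
    qed
  qed
  have "\<phi> z \<in> H <+> {..<length fs}" if "z \<in> P" for z
    using that unfolding \<phi>_def P_def by (cases z) (simp add: InlI InrI)
  then have "\<phi> ` P \<subseteq> H <+> {..<length fs}" by blast
  then have "card P \<le> card (H <+> {..<length fs})"
    by (rule card_inj_on_le[OF inj]) (use assms(1) in auto)
  also have "\<dots> = card H + length fs" using assms(1) by (simp add: card_Plus)
  finally show ?thesis unfolding P_def .
qed


section \<open>The norming set \<open>K\<close> and its closure properties\<close>

locale attractor_space =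
  fixes L :: "omega1 \<Rightarrow> nat \<Rightarrow> omega1" and \<xi> :: omega1 and M1 M2 N1 :: "nat set"
    and \<sigma>1 \<sigma> :: "(nat \<Rightarrow> real) list \<Rightarrow> nat" and \<Lambda> :: "nat \<Rightarrow> nat set"
  assumes ladder: "ladder_system L" and M12: "partition_pair M1 M2" and cod1: "coding1 M2 \<sigma>1"
begin

abbreviation K :: "(nat \<Rightarrow> real) set" where
  "K \<equiv> Kset L \<xi> M1 \<sigma>1 \<Lambda> N1 \<sigma>"

abbreviation N :: "(nat \<Rightarrow> real) \<Rightarrow> real" where
  "N \<equiv> norm_of K"

lemma K_c00: "f \<in> K \<Longrightarrow> f \<in> c00"
  using Kset_minimal(1) by blast

lemmas K_closed = Kset_minimal(2)[of L \<xi> M1 \<sigma>1 \<Lambda> N1 \<sigma>, unfolded K_closed_def]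

lemma K_uminus: "f \<in> K \<Longrightarrow> (\<lambda>n. - f n) \<in> K"
  by (rule K_closed[THEN conjunct1, rule_format])

lemma K_restr: "f \<in> K \<Longrightarrow> nat_interval E \<Longrightarrow> restr E f \<in> K"
  by (rule K_closed[THEN conjunct2, THEN conjunct1, rule_format])

lemma K_G: "f \<in> Gset L \<xi> M1 \<sigma>1 \<Longrightarrow> f \<in> K"
  by (rule subsetD[OF K_closed[THEN conjunct2, THEN conjunct2, THEN conjunct1]])

lemma K_even_op: "j \<ge> 1 \<Longrightarrow> op_result K (nseq (2 * j)) (1 / real (mseq (2 * j))) f \<Longrightarrow> f \<in> K"
  by (rule K_closed[THEN conjunct2, THEN conjunct2, THEN conjunct2, THEN conjunct1, rule_format])

text \<open>The parity of \<open>j\<close> is left free, so that results of attractor sequences are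
  treated together with those of the even operations.\<close>

definition isop :: "nat \<Rightarrow> (nat \<Rightarrow> real) \<Rightarrow> bool" where
  "isop j f \<longleftrightarrow> j \<ge> 1 \<and> f \<in> K \<and> op_result K (nseq j) (1 / real (mseq j)) f"

lemma K_l2_sum:
  assumes "finite (I::nat set)" "\<And>i. i \<in> I \<Longrightarrow> isop (j i) (f i)" "inj_on j I"
    "\<And>i. i \<in> I \<Longrightarrow> c i \<in> \<rat>" "(\<Sum>i\<in>I. (c i)\<^sup>2) \<le> 1"
  shows "(\<lambda>n. \<Sum>i\<in>I. c i * f i n) \<in> K"
proof -
  have "inj_on (nseq \<circ> j) I"
    by (rule comp_inj_on[OF assms(3)], rule inj_on_subset[OF nseq_inj])
      (use assms(2) in \<open>auto simp: isop_def\<close>)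
  then have *: "finite I \<and> (\<forall>i\<in>I. f i \<in> K \<and> j i \<ge> 1 \<and> op_result K (nseq (j i)) (1 / real (mseq (j i))) (f i)) \<and>
        inj_on (\<lambda>i. nseq (j i)) I \<and> (\<forall>i\<in>I. c i \<in> \<rat>) \<and> (\<Sum>i\<in>I. (c i)\<^sup>2) \<le> 1"
    using assms unfolding isop_def comp_def by blast
  show ?thesis
    by (rule K_closed[THEN conjunct2, THEN conjunct2, THEN conjunct2, THEN conjunct2, THEN conjunct2,
          THEN conjunct1, rule_format, OF *])
qed

lemma Gset_abs_le: "g \<in> Gset L \<xi> M1 \<sigma>1 \<Longrightarrow> \<bar>g n\<bar> \<le> 1"
proof (cases "g \<in> G0")
  case True
  then show ?thesis unfolding G0_def by (auto simp: unit_vec_def)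
next
  case False
  assume "g \<in> Gset L \<xi> M1 \<sigma>1"
  then show ?thesis using Gset_ground_rep[OF _ False] ground_fun_abs_le by metis
qed

lemma K_induct_closed:
  assumes "A \<subseteq> c00" "K_closed (Gset L \<xi> M1 \<sigma>1) \<Lambda> N1 \<sigma> A" shows "K \<subseteq> A"
  using Kset_minimal(3) assms by blast

text \<open>The unit ball of the sup norm has the closure properties of \<open>K\<close>. The
  critical one is for l2-sums: their terms have distinct weights, and the weights sum to less than
  1.\<close>

lemma K_abs_le:
  assumes "f \<in> K" shows "\<bar>f n\<bar> \<le> 1"
proof -
  define A where "A = {f\<in>c00. \<forall>n. \<bar>f n\<bar> \<le> 1}"
  have cl: "K_closed (Gset L \<xi> M1 \<sigma>1) \<Lambda> N1 \<sigma> c00" by (rule K_closed_c00[OF Gset_subset_c00])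
  note c = cl[unfolded K_closed_def]
  have inv1: "1 / real m \<le> 1" for m by (cases m) auto
  have op1: "\<bar>g n\<bar> \<le> 1 / real m" if "op_result A k (1 / real m) g" for g k m n
    by (rule op_result_abs_le[OF that]) (auto simp: A_def)
  have opc: "g \<in> c00" if "op_result A k \<theta> g" for g k \<theta>
    by (rule op_result_c00[OF op_result_mono[OF _ that]]) (auto simp: A_def)
  have opA: "g \<in> A" if "op_result A k (1 / real m) g" for g k m
    using opc[OF that] op1[OF that] inv1[of m] unfolding A_def by (auto intro: order_trans)
  have "K \<subseteq> A"
  proof (rule K_induct_closed)
    show "A \<subseteq> c00" unfolding A_def by blast
    show "K_closed (Gset L \<xi> M1 \<sigma>1) \<Lambda> N1 \<sigma> A"
      unfolding K_closed_def
    proof (intro conjI ballI allI impI)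
      show "(\<lambda>n. - f n) \<in> A" if "f \<in> A" for f
        using that c00_scale[of f "-1"] unfolding A_def by simp
      show "restr E f \<in> A" if "f \<in> A" for f E
        using that c00_restr[of f E] unfolding A_def by (simp add: restr_def)
      show "Gset L \<xi> M1 \<sigma>1 \<subseteq> A"
        using Gset_subset_c00 Gset_abs_le unfolding A_def by blast
      show "f \<in> A" if "op_result A (nseq (2 * j)) (1 / real (mseq (2 * j))) f" for j f
        by (rule opA[OF that])
      show "(\<lambda>n. 1 / real (mseq (2 * j - 1)) * (\<Sum>i<length fs. (fs ! i) n)) \<in> A"
        if "attractor_seq \<Lambda> N1 \<sigma> A j fs" for j fs
        by (rule opA[of "nseq (2 * j - 1)" "mseq (2*j-1)"])
          (use that in \<open>auto simp: attractor_seq_def Qs_def op_result_def intro!: exI[of _ fs]\<close>)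
    next
      fix I :: "nat set" and c :: "nat \<Rightarrow> real" and f j
      assume h: "finite I \<and> (\<forall>i\<in>I. f i \<in> A \<and> j i \<ge> 1 \<and> op_result A (nseq (j i)) (1 / real (mseq (j i))) (f i)) \<and>
        inj_on (\<lambda>i. nseq (j i)) I \<and> (\<forall>i\<in>I. c i \<in> \<rat>) \<and> (\<Sum>i\<in>I. (c i)\<^sup>2) \<le> 1"
      have ji: "inj_on j I" using h unfolding inj_on_def by metis
      have ci: "\<bar>c i\<bar> \<le> 1" if "i \<in> I" for i
        by (rule abs_coeff_le_one[of c I]) (use h that in auto)
      have "\<bar>\<Sum>i\<in>I. c i * f i n\<bar> \<le> 1" for n
      proof -
        have "\<bar>\<Sum>i\<in>I. c i * f i n\<bar> \<le> (\<Sum>i\<in>I. \<bar>c i * f i n\<bar>)" by (rule sum_abs)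
        also have "\<dots> \<le> (\<Sum>i\<in>I. (1/32) ^ j i)"
        proof (rule sum_mono)
          fix i assume i: "i \<in> I"
          have "\<bar>c i\<bar> * \<bar>f i n\<bar> \<le> 1 * (1/32) ^ j i"
            using op1[of "nseq (j i)" "mseq (j i)" "f i" n] inverse_mseq_le[of "j i"] h i ci[OF i]
            by (intro mult_mono) auto
          then show "\<bar>c i * f i n\<bar> \<le> (1/32) ^ j i" by (simp add: abs_mult)
        qed
        also have "\<dots> = (\<Sum>k\<in>j ` I. (1/32) ^ k)" by (simp add: sum.reindex[OF ji])
        also have "\<dots> \<le> (1/32) ^ 0 / 31"
          by (rule geometric_tail_le) (use h in \<open>auto simp: Suc_le_eq\<close>)
        finally show ?thesis by simp
      qed
      moreover have "(\<lambda>n. \<Sum>i\<in>I. c i * f i n) \<in> c00" by (rule c00_sum) (use h in \<open>auto simp: A_def\<close>)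
      ultimately show "(\<lambda>n. \<Sum>i\<in>I. c i * f i n) \<in> A" unfolding A_def by simp
    next
      fix I :: "nat set" and c :: "nat \<Rightarrow> real" and f
      assume h: "finite I \<and> (\<forall>i\<in>I. f i \<in> A \<and> c i \<in> \<rat> \<and> c i \<ge> 0) \<and> (\<Sum>i\<in>I. c i) = 1"
      have "\<bar>\<Sum>i\<in>I. c i * f i n\<bar> \<le> 1" for n
      proof -
        have "\<bar>\<Sum>i\<in>I. c i * f i n\<bar> \<le> (\<Sum>i\<in>I. \<bar>c i * f i n\<bar>)" by (rule sum_abs)
        also have "\<dots> \<le> (\<Sum>i\<in>I. c i)"
          by (rule sum_mono) (use h in \<open>auto simp: abs_mult A_def intro: mult_left_le\<close>)
        finally show ?thesis using h by simp
      qed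
      moreover have "(\<lambda>n. \<Sum>i\<in>I. c i * f i n) \<in> c00" by (rule c00_sum) (use h in \<open>auto simp: A_def\<close>)
      ultimately show "(\<lambda>n. \<Sum>i\<in>I. c i * f i n) \<in> A" unfolding A_def by simp
    qed
  qed
  then show ?thesis using assms unfolding A_def by blast
qed

section \<open>The norm induced by \<open>K\<close>\<close>

lemma unit_vec_K: "n \<ge> 1 \<Longrightarrow> s \<in> {-1, 1} \<Longrightarrow> (\<lambda>k. s * unit_vec n k) \<in> K"
  by (rule K_G) (auto simp: Gset_def G0_def)

lemma K_act_le_l1: "f \<in> K \<Longrightarrow> x \<in> c00 \<Longrightarrow> \<bar>act f x\<bar> \<le> l1 x"
  using abs_act_le[of f x 1] K_c00 K_abs_le by simp

lemma K_bdd: "x \<in> c00 \<Longrightarrow> bdd_above ((\<lambda>f. act f x) ` K)"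
  using K_act_le_l1 by (intro bdd_aboveI2[where M = "l1 x"]) (simp add: abs_le_iff)

lemma K_nonempty: "K \<noteq> {}"
  using unit_vec_K[of 1 1] by blast

lemma act_le_N: "f \<in> K \<Longrightarrow> x \<in> c00 \<Longrightarrow> act f x \<le> N x"
  unfolding norm_of_def by (rule cSUP_upper) (use K_bdd in auto)

lemma abs_act_le_N: "f \<in> K \<Longrightarrow> x \<in> c00 \<Longrightarrow> \<bar>act f x\<bar> \<le> N x"
  using act_le_N[of f x] act_le_N[OF K_uminus, of f x] act_minus_left[OF K_c00, of f x] by linarith

lemma N_le: "(\<And>f. f \<in> K \<Longrightarrow> act f x \<le> B) \<Longrightarrow> N x \<le> B"
  unfolding norm_of_def using K_nonempty by (rule cSUP_least)

lemma N_nonneg: "x \<in> c00 \<Longrightarrow> 0 \<le> N x"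
  using abs_act_le_N[OF unit_vec_K[of 1 1], of x] by auto

lemma N_less_ex: "x \<in> c00 \<Longrightarrow> b < N x \<Longrightarrow> \<exists>f\<in>K. b < act f x"
  unfolding norm_of_def using less_cSUP_iff[OF K_nonempty K_bdd] by blast

lemma N_le_l1: "x \<in> c00 \<Longrightarrow> N x \<le> l1 x"
  by (rule N_le) (use K_act_le_l1 in \<open>simp add: abs_le_iff\<close>)

lemma coord_le_N:
  assumes "x \<in> c00" shows "\<bar>x n\<bar> \<le> N x"
proof (cases "n = 0")
  case False
  then show ?thesis
    using abs_act_le_N[OF unit_vec_K[of n 1] assms] act_unit_vec[of n x] by simp
qed (use assms N_nonneg in \<open>auto simp: c00_def\<close>)

section \<open>Weighted functionals and Bessel inequalities\<close>

lemma isop_restr: "isop j f \<Longrightarrow> nat_interval E \<Longrightarrow> isop j (restr E f)"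
  unfolding isop_def using op_result_restr K_restr by blast

lemma isop_abs_le: "isop j f \<Longrightarrow> \<bar>f n\<bar> \<le> 1 / real (mseq j)"
  unfolding isop_def using op_result_abs_le K_abs_le by fastforce

lemma isop_act_le_l1:
  assumes "isop j f" "u \<in> c00" shows "\<bar>act f u\<bar> \<le> (1/32) ^ j * l1 u"
proof -
  have "\<bar>act f u\<bar> \<le> 1 / real (mseq j) * l1 u"
    by (rule abs_act_le) (use assms isop_abs_le K_c00 in \<open>auto simp: isop_def\<close>)
  also have "\<dots> \<le> (1/32) ^ j * l1 u"
    by (rule mult_right_mono) (use assms inverse_mseq_le l1_nonneg in \<open>auto simp: isop_def\<close>)
  finally show ?thesis .
qed

text \<open>All rational l2-sums of the \<open>f j\<close> lie in \<open>K\<close>, so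
  \<open>x\<close> is tested against the whole Euclidean ball of coefficients.\<close>

lemma op_bessel:
  assumes "finite J" "\<And>j. j \<in> J \<Longrightarrow> isop j (f j)" "x \<in> c00" "N x \<le> 1"
  shows "(\<Sum>j\<in>J. (act (f j) x)\<^sup>2) \<le> 1"
proof (rule rational_dual_ball[OF assms(1)])
  fix a :: "nat \<Rightarrow> real" assume a: "\<forall>i\<in>J. a i \<in> \<rat>" "(\<Sum>i\<in>J. (a i)\<^sup>2) \<le> 1"
  have "(\<lambda>n. \<Sum>i\<in>J. a i * f i n) \<in> K"
    by (rule K_l2_sum[where j = "\<lambda>j. j"]) (use assms a in auto)
  then have "act (\<lambda>n. \<Sum>i\<in>J. a i * f i n) x \<le> 1" using act_le_N assms by fastforce
  moreover have "act (\<lambda>n. \<Sum>i\<in>J. a i * f i n) x = (\<Sum>i\<in>J. a i * act (f i) x)"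
    by (rule act_sum_left) (use assms K_c00 in \<open>auto simp: isop_def\<close>)
  ultimately show "(\<Sum>i\<in>J. a i * act (f i) x) \<le> 1" by simp
qed

text \<open>As \<open>op_bessel\<close>, with \<open>Gl2\<close> supplying the l2-sums. Index sets
  have to be disjoint only after each functional is cut to its window \<open>W i\<close>.\<close>

lemma ground_bessel:
  assumes fin: "finite I" and t: "\<And>i. i \<in> I \<Longrightarrow> gtriple L \<xi> M1 \<sigma>1 (fs i) (\<epsilon> i) (E i)"
    and W: "\<And>i. i \<in> I \<Longrightarrow> nat_interval (W i)"
    and dis: "\<And>i k. i \<in> I \<Longrightarrow> k \<in> I \<Longrightarrow> i \<noteq> k \<Longrightarrow> ginds (E i) (fs i) \<inter> W i \<inter> (ginds (E k) (fs k) \<inter> W k) = {}"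
    and x: "x \<in> c00" "N x \<le> 1"
  shows "(\<Sum>i\<in>I. (act (gpart (W i) (fs i) (\<epsilon> i) (E i)) x)\<^sup>2) \<le> 1"
proof (rule rational_dual_ball[OF fin])
  let ?g = "\<lambda>i. gpart (W i) (fs i) (\<epsilon> i) (E i)"
  fix a :: "'a \<Rightarrow> real" assume a: "\<forall>i\<in>I. a i \<in> \<rat>" "(\<Sum>i\<in>I. (a i)\<^sup>2) \<le> 1"
  \<comment> \<open>Terms that vanish are dropped, because \<open>gpart_in_ind\<close> provides
    generators for nonzero functionals only.\<close>
  define I' where "I' = {i\<in>I. ?g i \<noteq> (\<lambda>_. 0)}"
  have I': "finite I'" "I' \<subseteq> I" using fin unfolding I'_def by auto
  have c: "?g i \<in> c00" if "i \<in> I" for i using gpart_c00 gtriple_Useq[OF t[OF that]] by blast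
  have e: "(\<Sum>i\<in>I. a i * act (?g i) x) = (\<Sum>i\<in>I'. a i * act (?g i) x)"
    by (rule sum.mono_neutral_right) (use fin in \<open>auto simp: I'_def\<close>)
  show "(\<Sum>i\<in>I. a i * act (?g i) x) \<le> 1"
  proof (cases "I' = {}")
    case True
    then show ?thesis using e by simp
  next
    case False
    have "(\<lambda>n. \<Sum>i\<in>I'. a i * ?g i n) \<in> Gl2 L \<xi> M1 \<sigma>1"
    proof (rule Gl2_intro[where J = "\<lambda>i. ginds (E i) (fs i) \<inter> W i"])
      show "(?g i, ginds (E i) (fs i) \<inter> W i) \<in> Gsp_ind L \<xi> M1 \<sigma>1 \<union> G1_ind" if "i \<in> I'" for i
        by (rule gpart_in_ind) (use that t W in \<open>auto simp: I'_def\<close>)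
      have "(\<Sum>i\<in>I'. (a i)\<^sup>2) \<le> (\<Sum>i\<in>I. (a i)\<^sup>2)" by (rule sum_mono2) (use fin I' in auto)
      then show "(\<Sum>i\<in>I'. (a i)\<^sup>2) \<le> 1" using a by simp
      fix i k assume "i \<in> I'" "k \<in> I'" "i \<noteq> k"
      then show "ginds (E i) (fs i) \<inter> W i \<inter> (ginds (E k) (fs k) \<inter> W k) = {}"
        using I' by (intro dis) auto
    qed (use I' False a in auto)
    then have "(\<lambda>n. \<Sum>i\<in>I'. a i * ?g i n) \<in> K" by (intro K_G) (simp add: Gset_def)
    then have "act (\<lambda>n. \<Sum>i\<in>I'. a i * ?g i n) x \<le> 1" using act_le_N x by fastforce
    moreover have "act (\<lambda>n. \<Sum>i\<in>I'. a i * ?g i n) x = (\<Sum>i\<in>I'. a i * act (?g i) x)"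
      by (rule act_sum_left) (use I' c in auto)
    ultimately show ?thesis using e by simp
  qed
qed

lemma G1_bessel:
  assumes "finite J" "\<And>j. j \<in> J \<Longrightarrow> f j \<in> G1j j" "x \<in> c00" "N x \<le> 1"
  shows "(\<Sum>j\<in>J. (act (f j) x)\<^sup>2) \<le> 1"
proof -
  have eq: "gpart UNIV [f j] (\<lambda>_. 1) UNIV = f j" for j
    unfolding gpart_def by simp
  have g: "ginds UNIV [f j] \<subseteq> {j}" if "j \<in> J" for j
    unfolding ginds_def using gind_eq[OF assms(2)[OF that]] by auto
  have "(\<Sum>j\<in>J. (act (gpart UNIV [f j] (\<lambda>_. 1) UNIV) x)\<^sup>2) \<le> 1"
  proof (rule ground_bessel[OF assms(1) _ nat_interval_UNIV _ assms(3,4)])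
    show "gtriple L \<xi> M1 \<sigma>1 [f j] (\<lambda>_. 1) UNIV" if "j \<in> J" for j
      using assms(2)[OF that] unfolding gtriple_def spec_list_def by auto
    show "ginds UNIV [f j] \<inter> UNIV \<inter> (ginds UNIV [f k] \<inter> UNIV) = {}" if "j \<in> J" "k \<in> J" "j \<noteq> k" for j k
      using g[OF that(1)] g[OF that(2)] that(3) by auto
  qed
  then show ?thesis unfolding eq .
qed

text \<open>Each constituent of \<open>f\<close> contributes at most 1 on each block that it meets,
  and \<open>card_meeting_pairs\<close> counts the meetings.\<close>

lemma isop_sum_blocks:
  fixes u :: "nat \<Rightarrow> nat \<Rightarrow> real"
  assumes f: "isop j f" and H: "finite H"
    and u: "\<And>k. k \<in> H \<Longrightarrow> u k \<in> c00" "\<And>k. k \<in> H \<Longrightarrow> N (u k) \<le> 1"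
    and b: "\<And>k l. k \<in> H \<Longrightarrow> l \<in> H \<Longrightarrow> k < l \<Longrightarrow> before (u k) (u l)"
  shows "(\<Sum>k\<in>H. \<bar>act f (u k)\<bar>) \<le> (real (card H) + real (nseq j)) / real (mseq j)"
proof -
  obtain fs where fs: "length fs \<le> nseq j" "set fs \<subseteq> K" "successive fs"
    and fe: "f = (\<lambda>k. 1 / real (mseq j) * (\<Sum>i<length fs. (fs ! i) k))"
    using f unfolding isop_def op_result_def by blast
  have fsK: "fs ! q \<in> K" if "q < length fs" for q using fs(2) that by auto
  define P where "P = {(k, q). k \<in> H \<and> q < length fs \<and> supp (fs ! q) \<inter> supp (u k) \<noteq> {}}"
  have a: "act f x = (\<Sum>q<length fs. act (fs ! q) x) / real (mseq j)" for x
  proof -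
    have "f = (\<lambda>k. \<Sum>i<length fs. (1 / real (mseq j)) * (fs ! i) k)"
      unfolding fe by (simp add: sum_distrib_left)
    then have "act f x = (\<Sum>q<length fs. (1 / real (mseq j)) * act (fs ! q) x)"
      using act_sum_left[of "{..<length fs}" "\<lambda>i. fs ! i" "\<lambda>_. 1 / real (mseq j)" x] fsK K_c00 by simp
    then show ?thesis by (simp add: sum_divide_distrib)
  qed
  have "(\<Sum>k\<in>H. \<bar>act f (u k)\<bar>) \<le> (\<Sum>k\<in>H. (\<Sum>q<length fs. \<bar>act (fs ! q) (u k)\<bar>) / real (mseq j))"
    unfolding a by (intro sum_mono) (simp add: abs_divide divide_right_mono sum_abs)
  also have "\<dots> = (\<Sum>k\<in>H. \<Sum>q<length fs. \<bar>act (fs ! q) (u k)\<bar>) / real (mseq j)"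
    by (simp add: sum_divide_distrib)
  also have "\<dots> \<le> (real (card H) + real (nseq j)) / real (mseq j)"
  proof (rule divide_right_mono)
    have "(\<Sum>k\<in>H. \<Sum>q<length fs. \<bar>act (fs ! q) (u k)\<bar>)
        = (\<Sum>(k, q)\<in>H \<times> {..<length fs}. \<bar>act (fs ! q) (u k)\<bar>)"
      by (simp add: sum.cartesian_product)
    also have "\<dots> = (\<Sum>(k, q)\<in>P. \<bar>act (fs ! q) (u k)\<bar>)"
      by (rule sum.mono_neutral_right) (use H act_eq_0 in \<open>auto simp: P_def\<close>)
    also have "\<dots> \<le> (\<Sum>(k, q)\<in>P. 1)"
    proof (rule sum_mono, clarify)
      fix k q assume "(k, q) \<in> P"
      then show "\<bar>act (fs ! q) (u k)\<bar> \<le> 1"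
        using abs_act_le_N[OF fsK u(1)] u(2) unfolding P_def by force
    qed
    also have "\<dots> = real (card P)" by (simp add: case_prod_unfold)
    also have "\<dots> \<le> real (card H + length fs)"
      unfolding P_def using card_meeting_pairs[OF H b fs(3)] by (simp only: of_nat_le_iff)
    also have "\<dots> \<le> real (card H) + real (nseq j)" using fs(1) by simp
    finally show "(\<Sum>k\<in>H. \<Sum>q<length fs. \<bar>act (fs ! q) (u k)\<bar>) \<le> real (card H) + real (nseq j)" .
  qed simp
  finally show ?thesis .
qed

end

section \<open>Compactness of the Schreier families\<close>

text \<open>Every infinite set leaves the family at a finite stage, uniformly in the member. If all
  members are finite, this means that the family of their subsets is compact in the Cantor
  space.\<close>

definition no_infinite_branch :: "nat set set \<Rightarrow> bool" where
  "no_infinite_branch \<F> \<longleftrightarrow> (\<forall>A. infinite A \<longrightarrow> (\<exists>n. \<forall>F\<in>\<F>. \<not> A \<inter> {..n} \<subseteq> F))"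

text \<open>Induction on the number of sets: the first set fails to cover \<open>A\<close> up to
  some \<open>n1\<close>, and from then on the remaining sets have to do it. The bound depends on
  \<open>A\<close> and \<open>m\<close>, but not on the sets.\<close>

lemma no_infinite_branch_union:
  fixes m :: nat
  assumes F: "no_infinite_branch \<F>" and A: "infinite A"
  shows "\<exists>n. \<forall>G. (\<forall>i<m. G i \<in> \<F>) \<longrightarrow> (\<forall>i j. i < j \<and> j < m \<longrightarrow> (\<forall>a\<in>G i. \<forall>b\<in>G j. a < b))
    \<longrightarrow> \<not> A \<inter> {..n} \<subseteq> (\<Union>i<m. G i)"
  using A
proof (induction m arbitrary: A)
  case 0
  then obtain a where "a \<in> A" using infinite_imp_nonempty by blast
  then show ?case by (intro exI[of _ a]) auto
next
  case (Suc m)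
  obtain n1 where n1: "\<forall>F\<in>\<F>. \<not> A \<inter> {..n1} \<subseteq> F"
    using F Suc.prems unfolding no_infinite_branch_def by blast
  have inf: "infinite (A - {..n1})" using Suc.prems by simp
  obtain n2 where n2: "\<And>G. (\<forall>i<m. G i \<in> \<F>) \<Longrightarrow> (\<forall>i j. i < j \<and> j < m \<longrightarrow> (\<forall>a\<in>G i. \<forall>b\<in>G j. a < b))
    \<Longrightarrow> \<not> (A - {..n1}) \<inter> {..n2} \<subseteq> (\<Union>i<m. G i)"
    using Suc.IH[OF inf] by blast
  show ?case
  proof (intro exI[of _ "max n1 n2"] allI impI notI)
    fix G assume G: "\<forall>i<Suc m. G i \<in> \<F>"
      "\<forall>i j. i < j \<and> j < Suc m \<longrightarrow> (\<forall>a\<in>G i. \<forall>b\<in>G j. a < b)"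
      and sub: "A \<inter> {..max n1 n2} \<subseteq> (\<Union>i<Suc m. G i)"
    obtain a where a: "a \<in> A" "a \<le> n1" "a \<notin> G 0" using n1 G(1) by blast
    then obtain i where i: "i < Suc m" "a \<in> G i" using sub by fastforce
    then have "0 < i" using a by (cases i) auto
    have less: "b < a" if "b \<in> G 0" for b
      by (rule G(2)[rule_format, of 0 i]) (use i \<open>0 < i\<close> that in auto)
    \<comment> \<open>The point \<open>a \<le> n1\<close> lies in a later set, so all of
      \<open>G 0\<close> is below \<open>n1\<close> and the other \<open>m\<close> sets cover
      \<open>A\<close> beyond \<open>n1\<close>.\<close>
    have "(A - {..n1}) \<inter> {..n2} \<subseteq> (\<Union>i<m. G (Suc i))"
    proof
      fix b assume b: "b \<in> (A - {..n1}) \<inter> {..n2}"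
      then obtain k where k: "k < Suc m" "b \<in> G k" using sub by fastforce
      have "k \<noteq> 0" using less[of b] k b a by (cases k) auto
      then obtain k' where "k = Suc k'" by (cases k) auto
      then show "b \<in> (\<Union>i<m. G (Suc i))" using k by auto
    qed
    moreover have "\<not> (A - {..n1}) \<inter> {..n2} \<subseteq> (\<Union>i<m. G (Suc i))"
    proof (rule n2)
      show "\<forall>i<m. G (Suc i) \<in> \<F>" using G(1) by simp
      show "\<forall>i j. i < j \<and> j < m \<longrightarrow> (\<forall>a\<in>G (Suc i). \<forall>b\<in>G (Suc j). a < b)"
      proof (intro allI impI ballI)
        fix i j a b assume "i < j \<and> j < m" "a \<in> G (Suc i)" "b \<in> G (Suc j)"
        then show "a < b" by (intro G(2)[rule_format, of "Suc i" "Suc j"]) auto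
      qed
    qed
    ultimately show False by blast
  qed
qed

text \<open>A member that covers \<open>A\<close> far enough contains \<open>a0\<close>. In the
  successor and in the limit clause the parameter \<open>m\<close> is at most every element of the
  member, hence at most \<open>a0\<close>. So finitely many bounds from smaller ordinals come into
  question, and their maximum serves.\<close>

lemma schreier_no_infinite_branch:
  assumes "ladder_system L"
  shows "no_infinite_branch {F. schreier L \<xi> F}"
proof (induction \<xi> rule: less_induct)
  case (less \<xi>)
  show ?case unfolding no_infinite_branch_def
  proof (intro allI impI)
    fix A :: "nat set" assume A: "infinite A"
    obtain a0 where a0: "a0 \<in> A" using A infinite_imp_nonempty by blast
    \<comment> \<open>Two elements of \<open>A\<close> rule out the members of order
      \<open>ozero\<close>, which are empty or singletons.\<close>
    obtain a1 where a1: "a1 \<in> A" "a0 < a1" using A by (meson infinite_nat_iff_unbounded)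
    define Q where "Q \<eta> m n \<longleftrightarrow> (\<forall>G. (\<forall>i<m. schreier L \<eta> (G i)) \<longrightarrow>
        (\<forall>i j. i < j \<and> j < m \<longrightarrow> (\<forall>a\<in>G i. \<forall>b\<in>G j. a < b)) \<longrightarrow> \<not> A \<inter> {..n} \<subseteq> (\<Union>i<m. G i))"
      for \<eta> and m n :: nat
    have "\<exists>n. Q \<eta> m n" if "\<eta> < \<xi>" for \<eta> m
      using no_infinite_branch_union[OF less[OF that] A, of m] unfolding Q_def by (simp only: mem_Collect_eq)
    then obtain bs where Qbs: "\<And>\<eta> m. \<eta> < \<xi> \<Longrightarrow> Q \<eta> m (bs \<eta> m)" by metis
    note bs = Qbs[unfolded Q_def, rule_format]
    have one: "\<not> A \<inter> {..bs \<eta> 1} \<subseteq> F" if "\<eta> < \<xi>" "schreier L \<eta> F" for \<eta> F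
    proof -
      have "\<not> A \<inter> {..bs \<eta> 1} \<subseteq> (\<Union>i<(1::nat). F)"
        by (rule bs[OF that(1)]) (use that(2) in auto)
      moreover have "(\<Union>i<(1::nat). F) = F" by auto
      ultimately show ?thesis by metis
    qed
    define S where "S = {bs \<eta> m | \<eta> m. \<xi> = osuc \<eta> \<and> m \<le> a0} \<union> {bs (L \<xi> m) 1 | m. m \<le> a0}"
    have "finite {bs \<eta> m | \<eta> m. \<xi> = osuc \<eta> \<and> m \<le> a0}"
    proof (cases "\<exists>\<eta>. \<xi> = osuc \<eta>")
      case True
      then obtain \<eta> where "\<xi> = osuc \<eta>" by blast
      then have "{bs \<eta> m | \<eta> m. \<xi> = osuc \<eta> \<and> m \<le> a0} \<subseteq> bs \<eta> ` {..a0}" using osuc_inj by auto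
      then show ?thesis by (rule finite_subset) simp
    qed auto
    moreover have "finite {bs (L \<xi> m) 1 | m. m \<le> a0}" by simp
    ultimately have S: "finite S" unfolding S_def by simp
    define n where "n = Max (insert a1 S)"
    have nS: "s \<le> n" if "s \<in> S" for s unfolding n_def using S that by simp
    have na: "a1 \<le> n" unfolding n_def using S by simp
    show "\<exists>n. \<forall>F\<in>{F. schreier L \<xi> F}. \<not> A \<inter> {..n} \<subseteq> F"
    proof (intro exI[of _ n] ballI notI)
      fix F assume "F \<in> {F. schreier L \<xi> F}" and sub: "A \<inter> {..n} \<subseteq> F"
      then have F: "schreier L \<xi> F" by simp
      have aF: "a0 \<in> F" "a1 \<in> F" using sub a0 a1 na by auto
      from F show False
      proof cases
        case zero_empty
        then show False using aF by simp
      next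
        case (zero_single k)
        then show False using aF a1 by simp
      next
        case (succ m \<eta> G)
        obtain i where i: "i < m" "a0 \<in> G i" using aF(1) unfolding succ(2) by blast
        have "m \<le> a0" by (rule succ(5)[rule_format, OF i])
        then have "bs \<eta> m \<in> S" using succ(1) unfolding S_def by blast
        then have "bs \<eta> m \<le> n" by (rule nS)
        then have "A \<inter> {..bs \<eta> m} \<subseteq> (\<Union>i<m. G i)" using sub unfolding succ(2) by auto
        moreover have "\<eta> < \<xi>" using succ(1) less_osuc by simp
        have "\<not> A \<inter> {..bs \<eta> m} \<subseteq> (\<Union>i<m. G i)"
          by (rule bs[OF \<open>\<eta> < \<xi>\<close> succ(4)], assumption, rule succ(6)[rule_format]) auto
        ultimately show False by blast
      next
        case (limit m)
        have "m \<le> a0" using limit(4) aF(1) by blast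
        then have "bs (L \<xi> m) 1 \<in> S" unfolding S_def by blast
        then have "bs (L \<xi> m) 1 \<le> n" by (rule nS)
        then have "A \<inter> {..bs (L \<xi> m) 1} \<subseteq> F" using sub by auto
        moreover have "L \<xi> m < \<xi>" using assms limit(1,2) unfolding ladder_system_def by blast
        ultimately show False using one[OF _ limit(3)] by blast
      qed
    qed
  qed
qed


section \<open>Special functionals hit sparse blocks at most once\<close>

context attractor_space
begin

lemma special_Useq: "special L \<xi> M1 \<sigma>1 fs \<Longrightarrow> fs \<in> Useq"
  unfolding special_def by blast

lemma special_gind_Suc:
  assumes "special L \<xi> M1 \<sigma>1 fs" "1 \<le> p" "p < length fs"
  shows "gind (fs ! p) = \<sigma>1 (take p fs)" "gind (fs ! p) \<in> M2"
proof -
  show "gind (fs ! p) = \<sigma>1 (take p fs)"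
    using assms unfolding special_def by (intro gind_eq) blast
  moreover have "take p fs \<in> Useq" using Useq_take special_Useq assms by simp
  ultimately show "gind (fs ! p) \<in> M2" using cod1 unfolding coding1_def by auto
qed

lemma special_gind_0: "special L \<xi> M1 \<sigma>1 fs \<Longrightarrow> gind (fs ! 0) \<in> M1"
  unfolding special_def using gind_eq by metis

text \<open>Since \<open>\<sigma>1\<close> is injective, an index determines the predecessors.\<close>

lemma special_same_prefix:
  assumes s: "special L \<xi> M1 \<sigma>1 fs" "special L \<xi> M1 \<sigma>1 gs"
    and p: "p < length fs" "q < length gs" "gind (fs ! p) = gind (gs ! q)"
  shows "take p fs = take q gs"
proof -
  have d: "M1 \<inter> M2 = {}" using M12 unfolding partition_pair_def by blast
  consider "p = 0" "q = 0" | "1 \<le> p" "q = 0" | "p = 0" "1 \<le> q" | "1 \<le> p" "1 \<le> q" by linarith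
  then show ?thesis
  proof cases
    case 2
    then show ?thesis
      using special_gind_Suc(2)[OF s(1) 2(1) p(1)] special_gind_0[OF s(2)] p(3) d by auto
  next
    case 3
    then show ?thesis
      using special_gind_Suc(2)[OF s(2) 3(2) p(2)] special_gind_0[OF s(1)] p(3) d by auto
  next
    case 4
    then have "\<sigma>1 (take p fs) = \<sigma>1 (take q gs)" using special_gind_Suc(1) s p by metis
    moreover have "take p fs \<in> Useq" "take q gs \<in> Useq"
      using Useq_take special_Useq s 4 by auto
    ultimately show ?thesis using cod1 unfolding coding1_def inj_on_def by blast
  qed simp
qed

text \<open>Signs and interval are hidden in the quantifier, so that being a hit is a property of
  the list alone; the colouring and the tree in \<open>one_hit\<close> deal with lists.\<close>

definition hits :: "real \<Rightarrow> nat set \<Rightarrow> (nat \<Rightarrow> real) \<Rightarrow> (nat \<Rightarrow> real) list \<Rightarrow> bool" where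
  "hits \<delta> W x fs \<longleftrightarrow> (\<exists>\<epsilon> E. nat_interval E \<and> (\<forall>p<length fs. \<epsilon> p \<in> {-1, 1}) \<and>
     \<delta> \<le> \<bar>act (gpart W fs \<epsilon> E) x\<bar>)"

text \<open>Indices increase along members of \<open>Useq\<close>, so for them this part contains
  every member with index at most \<open>b\<close>, and a window below \<open>b\<close> cannot
  distinguish it from the full list.\<close>

definition prefix_ind :: "nat \<Rightarrow> (nat \<Rightarrow> real) list \<Rightarrow> (nat \<Rightarrow> real) list" where
  "prefix_ind b fs = takeWhile (\<lambda>f. gind f \<le> b) fs"

lemma prefix_ind_take:
  assumes "p < length fs" "b < gind (fs ! p)"
  shows "prefix_ind b fs = prefix_ind b (take p fs)"
proof -
  have "fs = take p fs @ fs ! p # drop (Suc p) fs" using assms(1) by (simp add: id_take_nth_drop)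
  then have "takeWhile (\<lambda>f. gind f \<le> b) fs
      = takeWhile (\<lambda>f. gind f \<le> b) (take p fs @ fs ! p # drop (Suc p) fs)"
    by (rule arg_cong)
  also have "\<dots> = takeWhile (\<lambda>f. gind f \<le> b) (take p fs)"
    using assms(2) takeWhile_eq_all_conv[of "\<lambda>f. gind f \<le> b" "take p fs"]
    by (simp add: takeWhile_append eq_commute[of "take p fs"])
  finally show ?thesis unfolding prefix_ind_def .
qed

lemma prefix_ind_nth:
  assumes "fs \<in> Useq" "p < length fs"
  shows "p < length (prefix_ind b fs) \<longleftrightarrow> gind (fs ! p) \<le> b"
    and "p < length (prefix_ind b fs) \<Longrightarrow> prefix_ind b fs ! p = fs ! p"
proof -
  show "p < length (prefix_ind b fs) \<longleftrightarrow> gind (fs ! p) \<le> b"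
  proof
    assume "p < length (prefix_ind b fs)"
    then show "gind (fs ! p) \<le> b"
      unfolding prefix_ind_def by (metis nth_mem set_takeWhileD takeWhile_nth)
  next
    assume a: "gind (fs ! p) \<le> b"
    show "p < length (prefix_ind b fs)"
    proof (rule ccontr)
      assume "\<not> p < length (prefix_ind b fs)"
      then have l: "length (prefix_ind b fs) \<le> p" by simp
      then have "\<not> gind (fs ! length (prefix_ind b fs)) \<le> b"
        unfolding prefix_ind_def by (metis (no_types, lifting) assms(2) dual_order.strict_trans2 nth_length_takeWhile)
      moreover have "gind (fs ! length (prefix_ind b fs)) \<le> gind (fs ! p)"
        using Useq_gind_less[OF assms(1), of "length (prefix_ind b fs)" p] l assms(2)
        by (cases "length (prefix_ind b fs) = p") auto
      ultimately show False using a by simp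
    qed
  qed
  show "p < length (prefix_ind b fs) \<Longrightarrow> prefix_ind b fs ! p = fs ! p"
    unfolding prefix_ind_def by (rule takeWhile_nth)
qed

lemma length_prefix_ind_le: "length (prefix_ind b fs) \<le> length fs"
  unfolding prefix_ind_def by (rule length_takeWhile_le)

lemma gpart_prefix_ind:
  assumes fs: "fs \<in> Useq" and W: "W \<subseteq> {..b}"
  shows "gpart W (prefix_ind b fs) \<epsilon> E = gpart W fs \<epsilon> E"
  unfolding gpart_def
proof (rule ext, rule sum.cong)
  show "{p. p < length (prefix_ind b fs) \<and> gind (prefix_ind b fs ! p) \<in> W} = {p. p < length fs \<and> gind (fs ! p) \<in> W}"
    (is "?l = ?r")
  proof (rule set_eqI)
    fix p
    show "p \<in> ?l \<longleftrightarrow> p \<in> ?r"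
      using prefix_ind_nth[OF fs, of p b] W length_prefix_ind_le[of b fs] by fastforce
  qed
  fix n p assume "p \<in> {p. p < length fs \<and> gind (fs ! p) \<in> W}"
  then show "\<epsilon> p * restr E (prefix_ind b fs ! p) n = \<epsilon> p * restr E (fs ! p) n"
    using prefix_ind_nth[OF fs, of p b] W by fastforce
qed

lemma hits_prefix_ind:
  assumes fs: "fs \<in> Useq" and W: "W \<subseteq> {..b}"
  shows "hits \<delta> W x fs \<Longrightarrow> hits \<delta> W x (prefix_ind b fs)"
  unfolding hits_def gpart_prefix_ind[OF assms]
  using length_prefix_ind_le[of b fs] by (meson less_le_trans)

lemma hits_ex_gind:
  assumes "hits \<delta> W x fs" "\<delta> > 0"
  shows "\<exists>p<length fs. gind (fs ! p) \<in> W"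
proof (rule ccontr)
  assume "\<not> ?thesis"
  then have e: "{p. p < length fs \<and> gind (fs ! p) \<in> W} = {}" by blast
  have "gpart W fs \<epsilon> E = (\<lambda>_. 0)" for \<epsilon> E unfolding gpart_def e by simp
  then show False using assms unfolding hits_def by auto
qed

text \<open>Special sequences whose parts up to \<open>b\<close> differ cannot share an index above
  \<open>b\<close>, since a common index would give common predecessors. So representatives of the
  different parts satisfy Bessel's inequality on the window \<open>W\<close>, and each contributes
  at least \<open>\<delta>^2\<close>.\<close>

lemma card_hit_prefixes:
  assumes x: "x \<in> c00" "N x \<le> 1" and \<delta>: "\<delta> > 0" and r: "1 / \<delta>\<^sup>2 \<le> real r"
    and W: "nat_interval W" "\<And>j. j \<in> W \<Longrightarrow> b < j"
  defines "P \<equiv> prefix_ind b ` {fs. special L \<xi> M1 \<sigma>1 fs \<and> hits \<delta> W x fs}"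
  shows "finite P \<and> card P \<le> r"
proof (rule finite_if_finite_subsets_card_bdd)
  fix Y assume Y: "Y \<subseteq> P" "finite Y"
  have "\<forall>t\<in>Y. \<exists>fs \<epsilon> E. special L \<xi> M1 \<sigma>1 fs \<and> prefix_ind b fs = t \<and> nat_interval E
      \<and> (\<forall>p<length fs. \<epsilon> p \<in> {-1, 1}) \<and> \<delta> \<le> \<bar>act (gpart W fs \<epsilon> E) x\<bar>"
    using Y unfolding P_def hits_def by blast
  then obtain fs \<epsilon> E where h: "\<And>t. t \<in> Y \<Longrightarrow> special L \<xi> M1 \<sigma>1 (fs t) \<and> prefix_ind b (fs t) = t \<and> nat_interval (E t)
      \<and> (\<forall>p<length (fs t). \<epsilon> t p \<in> {-1, 1}) \<and> \<delta> \<le> \<bar>act (gpart W (fs t) (\<epsilon> t) (E t)) x\<bar>"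
    by metis
  have "(\<Sum>t\<in>Y. (act (gpart W (fs t) (\<epsilon> t) (E t)) x)\<^sup>2) \<le> 1"
  proof (rule ground_bessel[OF Y(2) _ W(1) _ x])
    show "gtriple L \<xi> M1 \<sigma>1 (fs t) (\<epsilon> t) (E t)" if "t \<in> Y" for t
      using h[OF that] unfolding gtriple_def spec_list_def by blast
    fix t t' assume t: "t \<in> Y" "t' \<in> Y" "t \<noteq> t'"
    show "ginds (E t) (fs t) \<inter> W \<inter> (ginds (E t') (fs t') \<inter> W) = {}"
    proof (rule ccontr)
      assume "\<not> ?thesis"
      then obtain p q where p: "p < length (fs t)" "gind (fs t ! p) \<in> W"
        and q: "q < length (fs t')" "gind (fs t ! p) = gind (fs t' ! q)"
        unfolding ginds_def by fastforce
      have "take p (fs t) = take q (fs t')"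
        by (rule special_same_prefix) (use h t p q in auto)
      then have "prefix_ind b (fs t) = prefix_ind b (fs t')"
        using prefix_ind_take[of p "fs t" b] prefix_ind_take[of q "fs t'" b] p q W(2) by simp
      then show False using h t by metis
    qed
  qed
  moreover have "(\<Sum>t\<in>Y. \<delta>\<^sup>2) \<le> (\<Sum>t\<in>Y. (act (gpart W (fs t) (\<epsilon> t) (E t)) x)\<^sup>2)"
  proof (rule sum_mono)
    fix t assume "t \<in> Y"
    then have "\<delta> \<le> \<bar>act (gpart W (fs t) (\<epsilon> t) (E t)) x\<bar>" using h by blast
    then show "\<delta>\<^sup>2 \<le> (act (gpart W (fs t) (\<epsilon> t) (E t)) x)\<^sup>2"
      using \<delta> by (metis abs_le_square_iff abs_of_pos)
  qed
  ultimately have "real (card Y) * \<delta>\<^sup>2 \<le> 1" by simp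
  then have "real (card Y) \<le> 1 / \<delta>\<^sup>2" using \<delta> by (simp add: field_simps)
  then show "card Y \<le> r" using r by linarith
qed

text \<open>The minima of the supports along an infinite branch would form an infinite set whose initial
  segments are all contained in members of the Schreier family.\<close>

lemma special_no_infinite_branch:
  assumes "\<And>n. \<exists>fs. special L \<xi> M1 \<sigma>1 fs \<and> n \<le> length fs \<and> (\<forall>p<n. fs ! p = g p)"
  shows False
proof -
  define a where "a p = Min (supp (g p))" for p
  have g: "finite (supp (g p))" "supp (g p) \<noteq> {}" for p
  proof -
    obtain fs where "special L \<xi> M1 \<sigma>1 fs" "Suc p \<le> length fs" "fs ! p = g p" using assms[of "Suc p"] by auto
    then have "g p \<in> G1j (gind (g p))" using Useq_nth[OF special_Useq, of fs p] by simp
    then show "finite (supp (g p))" "supp (g p) \<noteq> {}" by (auto simp: G1j_iff)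
  qed
  have "strict_mono a"
  proof (rule strict_monoI_Suc)
    fix p
    obtain fs where fs: "special L \<xi> M1 \<sigma>1 fs" "Suc (Suc p) \<le> length fs" "fs ! p = g p" "fs ! Suc p = g (Suc p)"
      using assms[of "Suc (Suc p)"] by auto
    then have "before (g p) (g (Suc p))"
      using successive_nth[OF Useq_successive[OF special_Useq[OF fs(1)]], of p "Suc p"] by simp
    then show "a p < a (Suc p)" unfolding a_def before_def using g Min_in by blast
  qed
  then have inf: "infinite (range a)" using range_inj_infinite strict_mono_imp_inj_on by blast
  obtain n where n: "\<And>F. schreier L \<xi> F \<Longrightarrow> \<not> range a \<inter> {..n} \<subseteq> F"
    using schreier_no_infinite_branch[OF ladder, of \<xi>, unfolded no_infinite_branch_def, rule_format, OF inf]
    by auto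
  obtain fs where fs: "special L \<xi> M1 \<sigma>1 fs" "Suc n \<le> length fs" "\<forall>p<Suc n. fs ! p = g p"
    using assms[of "Suc n"] by blast
  \<comment> \<open>As \<open>a\<close> is strictly increasing, \<open>p \<le> a p\<close>; thus
    values up to \<open>n\<close> come from positions up to \<open>n\<close>, where
    \<open>fs\<close> agrees with the branch.\<close>
  have "range a \<inter> {..n} \<subseteq> (\<lambda>f. Min (supp f)) ` set fs"
  proof
    fix b assume "b \<in> range a \<inter> {..n}"
    then obtain p where p: "b = a p" "a p \<le> n" by auto
    have "p \<le> a p" using \<open>strict_mono a\<close> by (rule strict_mono_imp_increasing)
    then have "p < Suc n" using p by simp
    then have "fs ! p = g p" "p < length fs" using fs by auto
    then show "b \<in> (\<lambda>f. Min (supp f)) ` set fs" using p unfolding a_def by (metis imageI nth_mem)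
  qed
  then show False using n fs(1) unfolding special_def by blast
qed

text \<open>At each block only boundedly many initial parts belong to hitting sequences, so pairs of
  blocks can be coloured by the part responsible for a common hit. A homogeneous set with a common
  hit would carry a finitely branching tree of unbounded height.\<close>

lemma one_hit:
  assumes u: "\<And>k. u k \<in> c00" "\<And>k. N (u k) \<le> 1" and J: "strict_mono J" and \<delta>: "\<delta> > 0" and L: "infinite L0"
  shows "\<exists>L'\<subseteq>L0. infinite L' \<and> (\<forall>fs k l. special L \<xi> M1 \<sigma>1 fs \<longrightarrow> k \<in> L' \<longrightarrow> l \<in> L' \<longrightarrow>
    hits \<delta> {J k<..J (Suc k)} (u k) fs \<longrightarrow> hits \<delta> {J l<..J (Suc l)} (u l) fs \<longrightarrow> k = l)"
proof -
  let ?W = "\<lambda>k. {J k<..J (Suc k)}"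
  let ?sp = "special L \<xi> M1 \<sigma>1"
  have Jle: "J (Suc k) \<le> J l" if "k < l" for k l
    using that J by (simp add: Suc_leI strict_mono_less_eq)
  define P where "P k = prefix_ind (J k) ` {fs. ?sp fs \<and> hits \<delta> (?W k) (u k) fs}" for k
  obtain r :: nat where r: "1 / \<delta>\<^sup>2 \<le> real r" using real_arch_simple by blast
  have P: "finite (P k)" "card (P k) \<le> r" for k
    using card_hit_prefixes[OF u \<delta> r, of "?W k" "J k"] unfolding P_def by auto
  have "\<exists>e. P k \<subseteq> e ` {..<r}" for k
  proof -
    obtain e where "bij_betw e {0..<card (P k)} (P k)" using ex_bij_betw_nat_finite[OF P(1)] by blast
    then have "P k = e ` {0..<card (P k)}" by (simp add: bij_betw_def)
    also have "\<dots> \<subseteq> e ` {..<r}" using P(2)[of k] by (intro image_mono) auto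
    finally show ?thesis by blast
  qed
  then obtain e where e: "\<And>k. P k \<subseteq> e k ` {..<r}" by metis
  define C where "C k l i \<longleftrightarrow> i < r \<and> e l i \<in> P l \<and> hits \<delta> (?W k) (u k) (e l i)" for k l i
  \<comment> \<open>The colour is the least number of an initial part, belonging to a sequence that
    hits the later block, which already hits the earlier block. The extra colour \<open>r\<close>
    means that there is none.\<close>
  define col where "col X = (let k = Min X; l = Max X in if \<exists>i. C k l i then (LEAST i. C k l i) else r)" for X
  have Cr: "i < r" if "C k l i" for k l i using that by (simp add: C_def)
  have colr: "col X < Suc r" for X
  proof (cases "\<exists>i. C (Min X) (Max X) i")
    case True
    then have "C (Min X) (Max X) (LEAST i. C (Min X) (Max X) i)" by (rule LeastI_ex)
    from Cr[OF this] show ?thesis unfolding col_def Let_def using True by simp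
  next
    case False
    have "col X = r" unfolding col_def Let_def by (rule if_not_P) (rule False)
    then show ?thesis by simp
  qed
  obtain Y t where Y: "Y \<subseteq> L0" "infinite Y" and t: "t < Suc r"
    and hom: "\<forall>x\<in>Y. \<forall>y\<in>Y. x \<noteq> y \<longrightarrow> col {x, y} = t"
    using Ramsey2[OF L, of col "Suc r"] colr by blast
  have hom': "col {k, l} = t" "Min {k, l} = k" "Max {k, l} = l" if "k \<in> Y" "l \<in> Y" "k < l" for k l
    using hom that by auto
  have sub: "hits \<delta> (?W k) (u k) (prefix_ind (J l) fs)" if "?sp fs" "hits \<delta> (?W k) (u k) fs" "k < l" for k l fs
    by (rule hits_prefix_ind[OF special_Useq[OF that(1)] _ that(2)]) (use Jle[OF that(3)] in auto)
  show ?thesis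
  proof (cases "t = r")
    case True
    have no: "\<not> C k l i" if "k \<in> Y" "l \<in> Y" "k < l" for k l i
    proof
      assume "C k l i"
      then have ex: "\<exists>i. C k l i" by blast
      then have "C k l (LEAST i. C k l i)" by (rule LeastI_ex)
      then show False using hom'[OF that] True ex unfolding col_def Let_def C_def by simp
    qed
    have no2: False if "?sp fs" "k \<in> Y" "l \<in> Y" "hits \<delta> (?W k) (u k) fs" "hits \<delta> (?W l) (u l) fs" "k < l" for fs k l
    proof -
      have "prefix_ind (J l) fs \<in> P l" using that unfolding P_def by blast
      then obtain i where "i < r" "prefix_ind (J l) fs = e l i" using e by blast
      then have "C k l i" using sub[of fs k l] that \<open>prefix_ind (J l) fs \<in> P l\<close> unfolding C_def by simp
      then show False using no that by blast
    qed
    show ?thesis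
      by (intro exI[of _ Y] conjI Y allI impI) (metis no2 linorder_neqE_nat)
  next
    case False
    \<comment> \<open>For a fixed colour \<open>t < r\<close>, one initial part \<open>T l\<close>
      per block hits all earlier blocks of \<open>Y\<close>.\<close>
    define T where "T l = e l t" for l
    have C: "C k l t" if "k \<in> Y" "l \<in> Y" "k < l" for k l
    proof -
      have c: "col {k, l} = t" using hom'(1) that by blast
      then have ex: "\<exists>i. C k l i" using hom'(2,3)[OF that] False unfolding col_def Let_def by (auto split: if_splits)
      then have "C k l (LEAST i. C k l i)" by (rule LeastI_ex)
      moreover have "(LEAST i. C k l i) = t"
        using c ex hom'(2,3)[OF that] unfolding col_def Let_def by simp
      ultimately show ?thesis by simp
    qed
    have T: "\<exists>fs. ?sp fs \<and> T l = prefix_ind (J l) fs" if "k \<in> Y" "l \<in> Y" "k < l" for k l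
      using C[OF that] unfolding C_def P_def T_def by auto
    \<comment> \<open>The nodes of the tree for Koenig's lemma: finite lists with which infinitely
      many \<open>T l\<close> begin.\<close>
    define D where "D = {s. infinite {l\<in>Y. prefix s (T l)}}"
    have D0: "[] \<in> D" unfolding D_def using Y by simp
    have step: "\<exists>f. s @ [f] \<in> D" if s: "s \<in> D" for s
    proof -
      define B where "B = {l\<in>Y. prefix s (T l)}"
      have B: "infinite B" using s unfolding D_def B_def by simp
      define m where "m = Max (insert 0 (gind ` set s))"
      have m: "gind f \<le> m" if "f \<in> set s" for f unfolding m_def using that by simp
      \<comment> \<open>Since \<open>T l\<close> hits block \<open>k0\<close>, it has a member with
        index in the window of \<open>k0\<close>. That index exceeds all indices in
        \<open>s\<close>, so \<open>T l\<close> properly extends \<open>s\<close>.\<close>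
      obtain k0 where k0: "k0 \<in> Y" "m \<le> k0"
        using Y(2) by (meson infinite_nat_iff_unbounded_le)
      have mJ: "m \<le> J k0" using k0 J by (meson order_trans strict_mono_imp_increasing)
      \<comment> \<open>The new member has index at most \<open>J k1\<close> and is visible in the
        part of \<open>T l\<close> up to \<open>J k1\<close>. These parts lie in the finite set
        \<open>P k1\<close>, which makes the branching finite.\<close>
      obtain k1 where k1: "k1 \<in> Y" "k0 < k1" using Y(2) by (meson infinite_nat_iff_unbounded)
      have B': "infinite (B - {..k1})" using B by simp
      have q: "prefix_ind (J k1) (T l) \<in> P k1 \<and> prefix (prefix_ind (J k1) (T l)) (T l)
          \<and> (\<exists>f. prefix (s @ [f]) (prefix_ind (J k1) (T l)))" if l: "l \<in> B - {..k1}" for l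
      proof -
        have lY: "l \<in> Y" "k1 < l" "k0 < l" "prefix s (T l)" using l k1 unfolding B_def by auto
        obtain fs where fs: "?sp fs" "T l = prefix_ind (J l) fs" using T[of k1 l] lY k1 by blast
        note U = special_Useq[OF fs(1)]
        have J1: "J k1 \<le> J l" using J lY by (simp add: strict_mono_less_eq)
        have pp: "prefix_ind (J k1) (T l) = prefix_ind (J k1) fs"
          unfolding fs(2) prefix_ind_def takeWhile_takeWhile using J1
          by (intro takeWhile_cong) auto
        have "hits \<delta> (?W k1) (u k1) (T l)" using C[of k1 l] lY k1 unfolding C_def T_def by blast
        then obtain \<epsilon> E where h: "nat_interval E" "\<forall>p<length (T l). \<epsilon> p \<in> {-1, 1}"
          "\<delta> \<le> \<bar>act (gpart (?W k1) (T l) \<epsilon> E) (u k1)\<bar>" unfolding hits_def by blast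
        have W1: "?W k1 \<subseteq> {..J l}" using Jle[OF lY(2)] by auto
        \<comment> \<open>The signs chosen for \<open>T l\<close> have to be continued to the
          possibly longer list \<open>fs\<close>; 1 is a filler.\<close>
        define \<epsilon>' where "\<epsilon>' p = (if p < length (T l) then \<epsilon> p else 1)" for p
        have "gpart (?W k1) (T l) \<epsilon>' E = gpart (?W k1) (T l) \<epsilon> E"
          unfolding gpart_def \<epsilon>'_def by (intro ext sum.cong) auto
        then have "gpart (?W k1) fs \<epsilon>' E = gpart (?W k1) (T l) \<epsilon> E"
          using gpart_prefix_ind[OF U W1, of \<epsilon>' E] fs(2) by simp
        then have "hits \<delta> (?W k1) (u k1) fs"
          unfolding hits_def using h by (intro exI[of _ \<epsilon>'] exI[of _ E]) (auto simp: \<epsilon>'_def)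
        then have 1: "prefix_ind (J k1) (T l) \<in> P k1" using fs(1) unfolding pp P_def by blast
        have 2: "prefix (prefix_ind (J k1) (T l)) (T l)"
          unfolding prefix_ind_def by (rule takeWhile_is_prefix)
        have "hits \<delta> (?W k0) (u k0) (T l)" using C[of k0 l] lY k0 unfolding C_def T_def by blast
        then obtain p where p: "p < length (T l)" "gind (T l ! p) \<in> ?W k0" using hits_ex_gind[OF _ \<delta>] by blast
        have Tp: "T l ! p = fs ! p" "p < length fs"
          using prefix_ind_nth(2)[OF U, of p "J l"] p fs(2) length_prefix_ind_le[of "J l" fs] by auto
        have pl: "p < length (prefix_ind (J k1) (T l))"
          unfolding pp using prefix_ind_nth(1)[OF U Tp(2), of "J k1"] p Tp Jle[OF k1(2)] by auto
        have sp: "length s \<le> p"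
        proof (rule ccontr)
          assume "\<not> length s \<le> p"
          then have "T l ! p \<in> set s" using lY(4) by (metis not_le nth_append nth_mem prefix_def)
          then show False using m[of "T l ! p"] mJ p by auto
        qed
        have "prefix s (prefix_ind (J k1) (T l))"
          using prefix_length_prefix[OF lY(4) 2] sp pl by simp
        then obtain z where z: "prefix_ind (J k1) (T l) = s @ z" by (auto simp: prefix_def)
        then obtain f z' where "z = f # z'" using sp pl by (cases z) auto
        then have "prefix (s @ [f]) (prefix_ind (J k1) (T l))" using z by (simp add: prefix_def)
        then show ?thesis using 1 2 by blast
      qed
      have "finite ((\<lambda>l. prefix_ind (J k1) (T l)) ` (B - {..k1}))"
        by (rule finite_subset[OF _ P(1)[of k1]]) (use q in blast)
      then obtain l0 where l0: "l0 \<in> B - {..k1}"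
        and inf: "infinite {l\<in>B - {..k1}. prefix_ind (J k1) (T l) = prefix_ind (J k1) (T l0)}"
        using pigeonhole_infinite[OF B'] by blast
      obtain f where f: "prefix (s @ [f]) (prefix_ind (J k1) (T l0))" using q[OF l0] by blast
      have "{l\<in>B - {..k1}. prefix_ind (J k1) (T l) = prefix_ind (J k1) (T l0)} \<subseteq> {l\<in>Y. prefix (s @ [f]) (T l)}"
      proof
        fix l assume "l \<in> {l\<in>B - {..k1}. prefix_ind (J k1) (T l) = prefix_ind (J k1) (T l0)}"
        then have l: "l \<in> B - {..k1}" "prefix_ind (J k1) (T l) = prefix_ind (J k1) (T l0)" by auto
        have "prefix (s @ [f]) (T l)"
          by (rule prefix_order.trans[of _ "prefix_ind (J k1) (T l)"]) (use q[OF l(1)] l(2) f in auto)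
        then show "l \<in> {l\<in>Y. prefix (s @ [f]) (T l)}" using l(1) unfolding B_def by simp
      qed
      then have "s @ [f] \<in> D" unfolding D_def using inf infinite_super by blast
      then show ?thesis by blast
    qed
    obtain S where S: "\<And>n. (S n \<in> D \<and> length (S n) = n) \<and> (\<exists>f. S (Suc n) = S n @ [f])"
      using dependent_nat_choice[of "\<lambda>n s. s \<in> D \<and> length s = n" "\<lambda>_ s s'. \<exists>f. s' = s @ [f]"]
      D0 step by (metis length_append_singleton list.size(3))
    define g where "g n = S (Suc n) ! n" for n
    have Sg: "S n ! p = g p" if "p < n" for n p
      using that
    proof (induction n)
      case (Suc n)
      obtain f where f: "S (Suc n) = S n @ [f]" using S by blast
      show ?case
      proof (cases "p = n")
        case True
        then show ?thesis unfolding g_def by simp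
      next
        case False
        then show ?thesis using Suc f S[of n] by (simp add: nth_append)
      qed
    qed simp
    have "\<exists>fs. ?sp fs \<and> n \<le> length fs \<and> (\<forall>p<n. fs ! p = g p)" for n
    proof -
      have inf: "infinite {l\<in>Y. prefix (S n) (T l)}" using S[of n] unfolding D_def by blast
      obtain k0 where k0: "k0 \<in> Y" using Y(2) infinite_imp_nonempty by blast
      obtain l where l: "l \<in> Y" "prefix (S n) (T l)" "k0 < l"
        using inf unfolding infinite_nat_iff_unbounded by blast
      obtain fs where fs: "?sp fs" "T l = prefix_ind (J l) fs" using T[of k0 l] k0 l by blast
      have "prefix (T l) fs" unfolding fs(2) prefix_ind_def by (rule takeWhile_is_prefix)
      then have "prefix (S n) fs" using l(2) prefix_order.trans by blast
      then obtain z where z: "fs = S n @ z" by (auto simp: prefix_def)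
      then show ?thesis using fs(1) S[of n] Sg by (intro exI[of _ fs]) (auto simp: nth_append)
    qed
    then have False by (rule special_no_infinite_branch)
    then show ?thesis ..
  qed
qed

end

section \<open>Thin sequences of blocks\<close>

text \<open>One functional is tested per weight, so \<open>\<eta>\<close> bounds the Euclidean norm
  of the profile of \<open>x\<close> over the weights in the range.\<close>

definition energy_le :: "(nat \<Rightarrow> (nat \<Rightarrow> real) \<Rightarrow> bool) \<Rightarrow> (nat \<Rightarrow> real) \<Rightarrow> nat \<Rightarrow> nat \<Rightarrow> real \<Rightarrow> bool" where
  "energy_le \<Phi> x a b \<eta> \<longleftrightarrow> (\<forall>J f. finite J \<longrightarrow> J \<subseteq> {a<..b} \<longrightarrow> (\<forall>j\<in>J. \<Phi> j (f j)) \<longrightarrow>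
     (\<Sum>j\<in>J. (act (f j) x)\<^sup>2) \<le> \<eta>\<^sup>2)"

lemma energy_le_mono:
  assumes "energy_le \<Phi> x a b \<eta>" "a \<le> a'" shows "energy_le \<Phi> x a' b \<eta>"
  unfolding energy_le_def
proof (intro allI impI)
  fix J f assume "finite J" "J \<subseteq> {a'<..b}" "\<forall>j\<in>J. \<Phi> j (f j)"
  moreover have "{a'<..b} \<subseteq> {a<..b}" using assms(2) by auto
  ultimately show "(\<Sum>j\<in>J. (act (f j) x)\<^sup>2) \<le> \<eta>\<^sup>2"
    by (intro assms(1)[unfolded energy_le_def, rule_format]) auto
qed

lemma energy_le_indexed:
  assumes e: "energy_le \<Phi> x a b \<eta>" and I: "finite I" "inj_on j I"
    and f: "\<And>i. i \<in> I \<Longrightarrow> a < j i \<and> j i \<le> b \<and> \<Phi> (j i) (f i)"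
  shows "(\<Sum>i\<in>I. (act (f i) x)\<^sup>2) \<le> \<eta>\<^sup>2"
proof -
  define g where "g k = f (the_inv_into I j k)" for k
  have g: "g (j i) = f i" if "i \<in> I" for i
    unfolding g_def using the_inv_into_f_f[OF I(2) that] by simp
  have "(\<Sum>k\<in>j ` I. (act (g k) x)\<^sup>2) \<le> \<eta>\<^sup>2"
  proof (rule e[unfolded energy_le_def, rule_format])
    show "\<Phi> k (g k)" if "k \<in> j ` I" for k using that f g by auto
  qed (use I f in auto)
  then show ?thesis by (simp add: sum.reindex[OF I(2)] g)
qed

text \<open>Otherwise, passing to subsets again and again, one finds vectors with arbitrarily large energy
  on disjoint ranges of weights.\<close>

lemma energy_extraction:
  assumes L: "infinite L0" and \<eta>: "\<eta> > 0"
    and bessel: "\<And>J f k. finite J \<Longrightarrow> (\<forall>j\<in>J. \<Phi> j (f j)) \<Longrightarrow> (\<Sum>j\<in>J. (act (f j) (u k))\<^sup>2) \<le> 1"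
  shows "\<exists>j0 L'. L' \<subseteq> L0 \<and> infinite L' \<and> (\<forall>b. finite {k\<in>L'. \<not> energy_le \<Phi> (u k) j0 b \<eta>})"
proof (rule ccontr)
  assume "\<not> ?thesis"
  then have no: "\<exists>b. infinite {k\<in>L'. \<not> energy_le \<Phi> (u k) j0 b \<eta>}" if "L' \<subseteq> L0" "infinite L'" for j0 L'
    using that by blast
  \<comment> \<open>After \<open>m\<close> rounds each remaining vector has energy at least
    \<open>m * \<eta>^2\<close> on weights up to a common bound \<open>c\<close>; the next round
    works beyond \<open>c\<close>.\<close>
  have "\<exists>c L'. L' \<subseteq> L0 \<and> infinite L' \<and> (\<forall>k\<in>L'. \<exists>J f. finite J \<and> J \<subseteq> {..c} \<and> (\<forall>j\<in>J. \<Phi> j (f j))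
      \<and> real m * \<eta>\<^sup>2 \<le> (\<Sum>j\<in>J. (act (f j) (u k))\<^sup>2))" for m
  proof (induction m)
    case 0
    show ?case
      by (rule exI[of _ 0], rule exI[of _ L0], intro conjI subset_refl L ballI exI[of _ "{}"]) simp_all
  next
    case (Suc m)
    then obtain c L' where L': "L' \<subseteq> L0" "infinite L'"
      and h: "\<And>k. k \<in> L' \<Longrightarrow> \<exists>J f. finite J \<and> J \<subseteq> {..c} \<and> (\<forall>j\<in>J. \<Phi> j (f j))
        \<and> real m * \<eta>\<^sup>2 \<le> (\<Sum>j\<in>J. (act (f j) (u k))\<^sup>2)" by blast
    obtain b where b: "infinite {k\<in>L'. \<not> energy_le \<Phi> (u k) c b \<eta>}" using no[OF L'] by blast
    have ext: "\<exists>J f. finite J \<and> J \<subseteq> {..max c b} \<and> (\<forall>j\<in>J. \<Phi> j (f j))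
        \<and> real (Suc m) * \<eta>\<^sup>2 \<le> (\<Sum>j\<in>J. (act (f j) (u k))\<^sup>2)"
      if k: "k \<in> L'" "\<not> energy_le \<Phi> (u k) c b \<eta>" for k
    proof -
      obtain J f where J: "finite J" "J \<subseteq> {..c}" "\<forall>j\<in>J. \<Phi> j (f j)"
        "real m * \<eta>\<^sup>2 \<le> (\<Sum>j\<in>J. (act (f j) (u k))\<^sup>2)" using h[OF k(1)] by blast
      obtain J' f' where J': "finite J'" "J' \<subseteq> {c<..b}" "\<forall>j\<in>J'. \<Phi> j (f' j)"
        "\<not> (\<Sum>j\<in>J'. (act (f' j) (u k))\<^sup>2) \<le> \<eta>\<^sup>2" using k(2) unfolding energy_le_def by blast
      define g where "g j = (if j \<in> J then f j else f' j)" for j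
      have dis: "J \<inter> J' = {}" by (auto dest!: subsetD[OF J(2)] subsetD[OF J'(2)])
      have g': "g j = f' j" if "j \<in> J'" for j using dis that unfolding g_def by auto
      have gJ: "g j = f j" if "j \<in> J" for j using that unfolding g_def by simp
      have "(\<Sum>j\<in>J \<union> J'. (act (g j) (u k))\<^sup>2) = (\<Sum>j\<in>J. (act (f j) (u k))\<^sup>2) + (\<Sum>j\<in>J'. (act (f' j) (u k))\<^sup>2)"
        unfolding sum.union_disjoint[OF J(1) J'(1) dis]
        by (rule arg_cong2[where f = "(+)"]; rule sum.cong) (simp_all add: g' gJ)
      then have "real (Suc m) * \<eta>\<^sup>2 \<le> (\<Sum>j\<in>J \<union> J'. (act (g j) (u k))\<^sup>2)"
        using J(4) J'(4) by (simp add: distrib_right)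
      moreover have "\<forall>j\<in>J \<union> J'. \<Phi> j (g j)" using J(3) J'(3) g' unfolding g_def by auto
      moreover have "J \<union> J' \<subseteq> {..max c b}" using J(2) J'(2) by auto
      ultimately show ?thesis using J(1) J'(1) by (intro exI[of _ "J \<union> J'"] exI[of _ g]) blast
    qed
    show ?case using b L'(1)
      by (intro exI[of _ "max c b"] exI[of _ "{k\<in>L'. \<not> energy_le \<Phi> (u k) c b \<eta>}"] conjI ballI ext) auto
  qed
  note ex = this
  \<comment> \<open>After more than \<open>1 / \<eta>^2\<close> rounds the energy would exceed the
    Bessel bound 1.\<close>
  obtain m :: nat where m: "1 / \<eta>\<^sup>2 < real m" using reals_Archimedean2 by blast
  obtain c L' where L': "infinite L'" and h: "\<forall>k\<in>L'. \<exists>J f. finite J \<and> J \<subseteq> {..c} \<and> (\<forall>j\<in>J. \<Phi> j (f j))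
      \<and> real m * \<eta>\<^sup>2 \<le> (\<Sum>j\<in>J. (act (f j) (u k))\<^sup>2)" using ex[of m] by blast
  obtain k where k: "k \<in> L'" using L' infinite_imp_nonempty by blast
  from bspec[OF h k] obtain J f where J: "finite J" "\<forall>j\<in>J. \<Phi> j (f j)" "real m * \<eta>\<^sup>2 \<le> (\<Sum>j\<in>J. (act (f j) (u k))\<^sup>2)"
    by (elim exE conjE)
  then have "real m * \<eta>\<^sup>2 \<le> 1" using bessel[OF J(1,2), of k] by linarith
  moreover have "1 < real m * \<eta>\<^sup>2" using m \<eta> by (simp add: field_simps)
  ultimately show False by simp
qed

text \<open>Used with \<open>a = j0\<close>, \<open>b = J k\<close> and
  \<open>c = J (Suc k)\<close>: fixed low weights, weights known before block \<open>k\<close>, its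
  own window, and the tail.\<close>

lemma sum_split4:
  fixes F :: "'i \<Rightarrow> real" and j :: "'i \<Rightarrow> nat"
  assumes "finite I" "a \<le> b" "b \<le> c"
  shows "(\<Sum>i\<in>I. F i) = (\<Sum>i\<in>{i\<in>I. j i \<le> a}. F i) + (\<Sum>i\<in>{i\<in>I. a < j i \<and> j i \<le> b}. F i)
    + (\<Sum>i\<in>{i\<in>I. j i \<in> {b<..c}}. F i) + (\<Sum>i\<in>{i\<in>I. c < j i}. F i)"
proof -
  have "I = {i\<in>I. j i \<le> a} \<union> ({i\<in>I. a < j i \<and> j i \<le> b} \<union> ({i\<in>I. j i \<in> {b<..c}} \<union> {i\<in>I. c < j i}))" (is "_ = ?A \<union> (?B \<union> (?C \<union> ?D))")
    by auto
  then have "(\<Sum>i\<in>I. F i) = (\<Sum>i\<in>?A \<union> (?B \<union> (?C \<union> ?D)). F i)" by simp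
  also have "\<dots> = (\<Sum>i\<in>?A. F i) + (\<Sum>i\<in>?B \<union> (?C \<union> ?D). F i)"
    by (rule sum.union_disjoint) (use assms in auto)
  also have "(\<Sum>i\<in>?B \<union> (?C \<union> ?D). F i) = (\<Sum>i\<in>?B. F i) + (\<Sum>i\<in>?C \<union> ?D. F i)"
    by (rule sum.union_disjoint) (use assms in auto)
  also have "(\<Sum>i\<in>?C \<union> ?D. F i) = (\<Sum>i\<in>?C. F i) + (\<Sum>i\<in>?D. F i)"
    by (rule sum.union_disjoint) (use assms in auto)
  finally show ?thesis by (simp only: add.assoc)
qed

text \<open>\<open>J k\<close> bounds the weights known when block \<open>k\<close> is chosen. By
  \<open>u_tail\<close>, weights beyond \<open>J (Suc k)\<close> are negligible on the block. By
  \<open>u_codes\<close>, once a special sequence continues with an index at most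
  \<open>J k\<close>, its earlier members end before the block; so at most one of its members with
  index up to \<open>J k\<close> acts on the block.\<close>

locale thin_blocks = attractor_space L \<xi> M1 M2 N1 \<sigma>1 \<sigma> \<Lambda>
  for L :: "omega1 \<Rightarrow> nat \<Rightarrow> omega1" and \<xi> :: omega1 and M1 M2 N1 :: "nat set"
    and \<sigma>1 \<sigma> :: "(nat \<Rightarrow> real) list \<Rightarrow> nat" and \<Lambda> :: "nat \<Rightarrow> nat set" +
  fixes u :: "nat \<Rightarrow> nat \<Rightarrow> real" and J :: "nat \<Rightarrow> nat" and j0 :: nat and \<eta> :: real
  assumes u_c00: "u k \<in> c00" and u_N: "N (u k) \<le> 1" and u_before: "k < l \<Longrightarrow> before (u k) (u l)"
    and J_mono: "strict_mono J" and J_ge: "j0 \<le> J k" and \<eta>: "\<eta> > 0"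
    and u_tail: "(1/32) ^ J (Suc k) * l1 (u k) \<le> \<eta>"
    and u_codes: "\<lbrakk>t \<in> Useq; \<sigma>1 t \<le> J k; f \<in> set t; n \<in> supp f; l \<in> supp (u k)\<rbrakk> \<Longrightarrow> n < l"
    and u_isop: "energy_le isop (u k) j0 (J k) \<eta>"
    and u_G1: "energy_le (\<lambda>j f. f \<in> G1j j) (u k) j0 (J k) \<eta>"

context attractor_space
begin

text \<open>Two energy extractions give a common \<open>j0\<close> beyond which each bounded range
  of weights is bad for finitely many selected blocks. Thresholds and blocks can then be chosen
  alternately.\<close>

lemma thinning:
  assumes u: "\<And>k. u k \<in> c00" "\<And>k. N (u k) \<le> 1" "\<And>k l. k < l \<Longrightarrow> before (u k) (u l)"
    and ge: "\<And>k n. n \<in> supp (u k) \<Longrightarrow> k \<le> n" and \<eta>: "\<eta> > 0"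
  shows "\<exists>r j0 J. strict_mono r \<and> thin_blocks L \<xi> M1 M2 N1 \<sigma>1 \<sigma> \<Lambda> (u \<circ> r) J j0 \<eta>"
proof -
  let ?G = "\<lambda>j f. f \<in> G1j j"
  have "\<exists>j1 L1. L1 \<subseteq> UNIV \<and> infinite L1 \<and> (\<forall>b. finite {k\<in>L1. \<not> energy_le isop (u k) j1 b \<eta>})"
    by (rule energy_extraction[OF infinite_UNIV_nat \<eta>], rule op_bessel[OF _ _ u(1,2)], assumption, erule bspec)
  then obtain j1 L1 where L1: "infinite L1" and e1: "\<And>b. finite {k\<in>L1. \<not> energy_le isop (u k) j1 b \<eta>}"
    by blast
  have "\<exists>j2 L2. L2 \<subseteq> L1 \<and> infinite L2 \<and> (\<forall>b. finite {k\<in>L2. \<not> energy_le ?G (u k) j2 b \<eta>})"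
    by (rule energy_extraction[OF L1 \<eta>], rule G1_bessel[OF _ _ u(1,2)], assumption, erule bspec)
  then obtain j2 L2 where L2: "L2 \<subseteq> L1" "infinite L2" and e2: "\<And>b. finite {k\<in>L2. \<not> energy_le ?G (u k) j2 b \<eta>}"
    by blast
  define j0 where "j0 = max j1 j2"
  define codes where "codes b k \<longleftrightarrow> (\<forall>t\<in>Useq. \<sigma>1 t \<le> b \<longrightarrow> (\<forall>f\<in>set t. \<forall>n\<in>supp f. \<forall>l\<in>supp (u k). n < l))" for b k
  define good where "good b k \<longleftrightarrow> energy_le isop (u k) j0 b \<eta> \<and> energy_le ?G (u k) j0 b \<eta> \<and> codes b k" for b k
  \<comment> \<open>As \<open>\<sigma>1\<close> is injective, finitely many sequences have code at
    most \<open>b\<close>. Their supports lie below some \<open>m\<close>, while block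
    \<open>k\<close> starts at \<open>k\<close> or later.\<close>
  have fin_codes: "finite {k. \<not> codes b k}" for b
  proof -
    have "finite {t\<in>Useq. \<sigma>1 t \<le> b}"
      by (rule inj_on_finite[of \<sigma>1 _ "{..b}"]) (use cod1 in \<open>auto simp: coding1_def inj_on_def\<close>)
    then have "finite (\<Union>t\<in>{t\<in>Useq. \<sigma>1 t \<le> b}. \<Union>f\<in>set t. supp f)"
      using Useq_c00 supp_c00 by (intro finite_UN_I finite_set) (auto simp: in_set_conv_nth)
    then obtain m where m: "(\<Union>t\<in>{t\<in>Useq. \<sigma>1 t \<le> b}. \<Union>f\<in>set t. supp f) \<subseteq> {..<m}"
      using finite_nat_iff_bounded by blast
    have "codes b k" if "m \<le> k" for k
      unfolding codes_def
    proof (intro ballI impI)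
      fix t f n l assume "t \<in> Useq" "\<sigma>1 t \<le> b" "f \<in> set t" "n \<in> supp f" "l \<in> supp (u k)"
      then have "n < m" "k \<le> l" using m ge by blast+
      then show "n < l" using that by simp
    qed
    then have "{k. \<not> codes b k} \<subseteq> {..<m}" by (auto simp: not_le[symmetric])
    then show ?thesis by (rule finite_subset) simp
  qed
  have fin: "finite {k\<in>L2. \<not> good b k}" for b
  proof -
    have "{k\<in>L2. \<not> good b k} \<subseteq> {k\<in>L1. \<not> energy_le isop (u k) j1 b \<eta>}
        \<union> {k\<in>L2. \<not> energy_le ?G (u k) j2 b \<eta>} \<union> {k. \<not> codes b k}"
      using L2(1) energy_le_mono[of isop _ j1 b \<eta> j0] energy_le_mono[of ?G _ j2 b \<eta> j0]
      unfolding good_def j0_def by auto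
    then show ?thesis by (rule finite_subset) (use e1 e2 fin_codes in auto)
  qed
  have ex: "\<exists>k>k'. good b k" for b k'
  proof -
    have "infinite (L2 - {k\<in>L2. \<not> good b k} - {..k'})" using L2(2) fin[of b] by simp
    then obtain k where "k \<in> L2 - {k\<in>L2. \<not> good b k} - {..k'}" using infinite_imp_nonempty by blast
    then show ?thesis by (intro exI[of _ k]) simp
  qed
  \<comment> \<open>A pair holds a block number and its threshold. The next threshold is taken large
    enough for the tail of the current block, and only then a block is taken that is good for the
    new threshold.\<close>
  have "\<exists>F. \<forall>n. (j0 \<le> snd (F n) \<and> good (snd (F n)) (fst (F n))) \<and> (fst (F n) < fst (F (Suc n))
      \<and> snd (F n) < snd (F (Suc n)) \<and> (1/32) ^ snd (F (Suc n)) * l1 (u (fst (F n))) \<le> \<eta>)"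
  proof (rule dependent_nat_choice)
    show "\<exists>x. j0 \<le> snd x \<and> good (snd x) (fst x)" using ex[of 0 j0] by (metis fst_conv snd_conv order_refl)
    fix x :: "nat \<times> nat" and n :: nat
    assume x: "j0 \<le> snd x \<and> good (snd x) (fst x)"
    have "(\<lambda>m. (1/32::real) ^ m * l1 (u (fst x))) \<longlonglongrightarrow> 0 * l1 (u (fst x))"
      by (intro tendsto_mult_right LIMSEQ_realpow_zero) auto
    then have "\<forall>\<^sub>F m in sequentially. (1/32::real) ^ m * l1 (u (fst x)) < \<eta>"
      using \<eta> by (intro order_tendstoD) auto
    then obtain m0 where m0: "\<And>m. m \<ge> m0 \<Longrightarrow> (1/32::real) ^ m * l1 (u (fst x)) < \<eta>"
      unfolding eventually_sequentially by blast
    define m where "m = max m0 (Suc (snd x))"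
    obtain k where "k > fst x" "good m k" using ex by blast
    then show "\<exists>y. (j0 \<le> snd y \<and> good (snd y) (fst y)) \<and> fst x < fst y \<and> snd x < snd y
        \<and> (1/32) ^ snd y * l1 (u (fst x)) \<le> \<eta>"
      using x m0[of m] by (intro exI[of _ "(k, m)"]) (auto simp: m_def)
  qed
  then obtain F where F: "\<And>n. j0 \<le> snd (F n)" "\<And>n. good (snd (F n)) (fst (F n))"
    "\<And>n. fst (F n) < fst (F (Suc n))" "\<And>n. snd (F n) < snd (F (Suc n))"
    "\<And>n. (1/32) ^ snd (F (Suc n)) * l1 (u (fst (F n))) \<le> \<eta>" by blast
  define r where "r n = fst (F n)" for n
  define J where "J n = snd (F n)" for n
  have r: "strict_mono r" unfolding strict_mono_Suc_iff r_def using F(3) by blast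
  have "thin_blocks L \<xi> M1 M2 N1 \<sigma>1 \<sigma> \<Lambda> (u \<circ> r) J j0 \<eta>"
  proof
    show "strict_mono J" unfolding strict_mono_Suc_iff J_def using F(4) by blast
    show "before ((u \<circ> r) k) ((u \<circ> r) l)" if "k < l" for k l
      using u(3) r that unfolding strict_mono_def by simp
    show "n < l" if "t \<in> Useq" "\<sigma>1 t \<le> J k" "f \<in> set t" "n \<in> supp f" "l \<in> supp ((u \<circ> r) k)" for t k f n l
      using F(2)[of k] that unfolding good_def codes_def J_def r_def comp_def by blast
  qed (use u \<eta> F in \<open>auto simp: good_def J_def r_def\<close>)
  then show ?thesis using r by blast
qed

end

section \<open>l2-sums of weighted functionals at thin blocks\<close>

context thin_blocks
begin

abbreviation Win :: "nat \<Rightarrow> nat set" where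
  "Win k \<equiv> {J k<..J (Suc k)}"

lemma Win_disjoint: "k \<noteq> l \<Longrightarrow> j \<in> Win k \<Longrightarrow> j \<in> Win l \<Longrightarrow> False"
proof -
  have *: False if "k < l" "j \<in> Win k" "j \<in> Win l" for k l
  proof -
    have "J (Suc k) \<le> J l" using that(1) J_mono by (simp add: Suc_leI strict_mono_less_eq)
    then show False using that by simp
  qed
  show "k \<noteq> l \<Longrightarrow> j \<in> Win k \<Longrightarrow> j \<in> Win l \<Longrightarrow> False"
    using *[of k l] *[of l k] by (cases k l rule: linorder_cases) auto
qed

lemma isop_energy_one: "energy_le isop (u k) a b 1"
  unfolding energy_le_def using op_bessel[OF _ _ u_c00 u_N] by auto

lemma tail_sum_le:
  assumes "finite I" "inj_on j I" "\<And>i. i \<in> I \<Longrightarrow> J (Suc k) < j i"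
    and "\<And>i. i \<in> I \<Longrightarrow> F i \<le> (1/32) ^ j i * l1 (u k)"
  shows "(\<Sum>i\<in>I. F i) \<le> \<eta>"
proof -
  have "(\<Sum>i\<in>I. F i) \<le> (\<Sum>i\<in>I. (1/32) ^ j i * l1 (u k))" by (rule sum_mono) (rule assms(4))
  also have "\<dots> = (\<Sum>j\<in>j ` I. (1/32) ^ j) * l1 (u k)"
    by (simp add: sum_distrib_right sum.reindex[OF assms(2)])
  also have "\<dots> \<le> ((1/32) ^ J (Suc k) / 31) * l1 (u k)"
    by (intro mult_right_mono geometric_tail_le l1_nonneg) (use assms in auto)
  also have "\<dots> \<le> (1/32) ^ J (Suc k) * l1 (u k)" using l1_nonneg[of "u k"] by simp
  also have "\<dots> \<le> \<eta>" by (rule u_tail)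
  finally show ?thesis .
qed

text \<open>Low weights: there are at least \<open>nseq j\<close> blocks, so a functional of weight
  \<open>j\<close> costs at most \<open>2 * t^2 / mseq j\<close>, and the total factor
  \<open>2 / 31\<close> is below \<open>1 / 10\<close>. Known weights and the tail cost
  \<open>\<eta>\<close> per block each, the windows \<open>t\<close> altogether.\<close>

lemma l2_sum_estimate:
  assumes I: "finite I" "\<And>i. i \<in> I \<Longrightarrow> isop (j i) (f i)" "inj_on j I" and c: "(\<Sum>i\<in>I. (c i)\<^sup>2) \<le> 1"
    and \<kappa>: "strict_mono \<kappa>" and t: "t > 0" "\<And>j. 1 \<le> j \<Longrightarrow> j \<le> j0 \<Longrightarrow> nseq j \<le> t\<^sup>2"
  shows "(\<Sum>s<t\<^sup>2. \<Sum>i\<in>I. \<bar>c i * act (f i) (u (\<kappa> s))\<bar>) \<le> t\<^sup>2 / 10 + 2 * \<eta> * t\<^sup>2 + t"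
proof -
  let ?F = "\<lambda>i s. \<bar>c i * act (f i) (u (\<kappa> s))\<bar>"
  let ?P = "t\<^sup>2"
  have ci: "\<bar>c i\<bar> \<le> 1" if "i \<in> I" for i
    by (rule abs_coeff_le_one[OF c I(1) that])
  have subc: "(\<Sum>i\<in>I'. \<bar>c i\<bar>\<^sup>2) \<le> 1" if "I' \<subseteq> I" for I'
  proof -
    have "(\<Sum>i\<in>I'. \<bar>c i\<bar>\<^sup>2) \<le> (\<Sum>i\<in>I. (c i)\<^sup>2)" using that I(1) by (simp add: sum_mono2)
    then show ?thesis using c by linarith
  qed
  have inj: "inj_on j I'" if "I' \<subseteq> I" for I' using I(3) that inj_on_subset by blast
  define A where "A = {i\<in>I. j i \<le> j0}"
  define B where "B s = {i\<in>I. j0 < j i \<and> j i \<le> J (\<kappa> s)}" for s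
  define C where "C s = {i\<in>I. j i \<in> Win (\<kappa> s)}" for s
  define D where "D s = {i\<in>I. J (Suc (\<kappa> s)) < j i}" for s
  have split: "(\<Sum>i\<in>I. ?F i s) = (\<Sum>i\<in>A. ?F i s) + (\<Sum>i\<in>B s. ?F i s) + (\<Sum>i\<in>C s. ?F i s) + (\<Sum>i\<in>D s. ?F i s)" for s
    unfolding A_def B_def C_def D_def
    by (rule sum_split4[OF I(1) J_ge]) (use J_mono in \<open>simp add: strict_mono_less_eq\<close>)
  have "(\<Sum>s<?P. \<Sum>i\<in>A. ?F i s) \<le> ?P / 10"
  proof -
    have "(\<Sum>s<?P. \<Sum>i\<in>A. ?F i s) = (\<Sum>i\<in>A. \<Sum>s<?P. ?F i s)" by (rule sum.swap)
    also have "\<dots> \<le> (\<Sum>i\<in>A. 2 * ?P * (1/32) ^ j i)"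
    proof (rule sum_mono)
      fix i assume i: "i \<in> A"
      then have iI: "i \<in> I" "j i \<le> j0" unfolding A_def by auto
      have j1: "1 \<le> j i" using I(2)[OF iI(1)] unfolding isop_def by blast
      have "(\<Sum>s<?P. ?F i s) \<le> (\<Sum>s<?P. \<bar>act (f i) (u (\<kappa> s))\<bar>)"
        by (rule sum_mono) (use ci[OF iI(1)] in \<open>simp add: abs_mult mult_left_le_one_le\<close>)
      also have "\<dots> \<le> (real (card {..<?P}) + real (nseq (j i))) / real (mseq (j i))"
        by (rule isop_sum_blocks[where u = "\<lambda>s. u (\<kappa> s)"])
          (use I(2)[OF iI(1)] u_c00 u_N u_before \<kappa> in \<open>auto simp: strict_mono_def\<close>)
      also have "\<dots> \<le> (2 * ?P) * (1 / real (mseq (j i)))"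
        using t(2)[OF j1 iI(2)] by (simp add: divide_right_mono of_nat_le_iff[symmetric] del: of_nat_le_iff)
      also have "\<dots> \<le> 2 * ?P * (1/32) ^ j i"
        by (rule mult_left_mono[OF inverse_mseq_le[OF j1]]) simp
      finally show "(\<Sum>s<?P. ?F i s) \<le> 2 * ?P * (1/32) ^ j i" .
    qed
    also have "\<dots> = 2 * ?P * (\<Sum>k\<in>j ` A. (1/32) ^ k)"
      by (simp add: sum_distrib_left sum.reindex[OF inj] A_def)
    also have "\<dots> \<le> 2 * ?P * ((1/32) ^ 0 / 31)"
      by (intro mult_left_mono geometric_tail_le) (use I in \<open>auto simp: A_def isop_def Suc_le_eq\<close>)
    also have "\<dots> \<le> ?P / 10" by simp
    finally show ?thesis .
  qed
  moreover have "(\<Sum>s<?P. \<Sum>i\<in>B s. ?F i s) \<le> ?P * \<eta>"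
  proof -
    have "(\<Sum>i\<in>B s. ?F i s) \<le> \<eta>" for s
    proof -
      have "\<bar>\<Sum>i\<in>B s. \<bar>c i\<bar> * \<bar>act (f i) (u (\<kappa> s))\<bar>\<bar> \<le> \<eta>"
      proof (rule cauchy_schwarz_ball)
        show "(\<Sum>i\<in>B s. \<bar>c i\<bar>\<^sup>2) \<le> 1" by (rule subc) (auto simp: B_def)
        have "(\<Sum>i\<in>B s. (act (f i) (u (\<kappa> s)))\<^sup>2) \<le> \<eta>\<^sup>2"
          by (rule energy_le_indexed[OF u_isop]) (use I inj[of "B s"] in \<open>auto simp: B_def\<close>)
        then show "(\<Sum>i\<in>B s. \<bar>act (f i) (u (\<kappa> s))\<bar>\<^sup>2) \<le> \<eta>\<^sup>2" by simp
      qed (use \<eta> in simp)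
      then show ?thesis by (simp add: abs_mult)
    qed
    then have "(\<Sum>s<?P. \<Sum>i\<in>B s. ?F i s) \<le> (\<Sum>s<?P. \<eta>)" by (intro sum_mono)
    then show ?thesis by simp
  qed
  \<comment> \<open>A weight lies in at most one window, so each \<open>i\<close> is charged to at
    most one \<open>s\<close>.\<close>
  moreover have "(\<Sum>s<?P. \<Sum>i\<in>C s. ?F i s) \<le> t"
    unfolding C_def
  proof (rule disjoint_rows_bound[OF I(1) t(1) c])
    fix s
    have "(\<Sum>i\<in>{i\<in>I. j i \<in> Win (\<kappa> s)}. (act (f i) (u (\<kappa> s)))\<^sup>2) \<le> 1\<^sup>2"
      by (rule energy_le_indexed[OF isop_energy_one]) (use I inj[of "{i\<in>I. j i \<in> Win (\<kappa> s)}"] in auto)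
    then show "(\<Sum>i\<in>{i\<in>I. j i \<in> Win (\<kappa> s)}. (act (f i) (u (\<kappa> s)))\<^sup>2) \<le> 1" by simp
  next
    fix i s s' assume "j i \<in> Win (\<kappa> s)" "j i \<in> Win (\<kappa> s')"
    then have "\<kappa> s = \<kappa> s'" using Win_disjoint by blast
    then show "s = s'" using \<kappa> strict_mono_eq by blast
  qed
  moreover have "(\<Sum>s<?P. \<Sum>i\<in>D s. ?F i s) \<le> ?P * \<eta>"
  proof -
    have "(\<Sum>i\<in>D s. ?F i s) \<le> \<eta>" for s
    proof (rule tail_sum_le)
      fix i assume "i \<in> D s"
      then have i: "i \<in> I" unfolding D_def by blast
      have "\<bar>c i\<bar> * \<bar>act (f i) (u (\<kappa> s))\<bar> \<le> 1 * ((1/32) ^ j i * l1 (u (\<kappa> s)))"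
        by (intro mult_mono ci[OF i] isop_act_le_l1[OF I(2)[OF i] u_c00]) auto
      then show "?F i s \<le> (1/32) ^ j i * l1 (u (\<kappa> s))" by (simp add: abs_mult)
    qed (use I inj[of "D s"] in \<open>auto simp: D_def\<close>)
    then have "(\<Sum>s<?P. \<Sum>i\<in>D s. ?F i s) \<le> (\<Sum>s<?P. \<eta>)" by (intro sum_mono)
    then show ?thesis by simp
  qed
  ultimately show ?thesis unfolding split sum.distrib by (simp add: algebra_simps)
qed

end

section \<open>Averages of thin blocks have small norm\<close>

lemma sum_Un_le:
  fixes F :: "'i \<Rightarrow> real"
  assumes "finite A" "finite B" "\<And>i. 0 \<le> F i"
  shows "sum F (A \<union> B) \<le> sum F A + sum F B"
proof -
  have "0 \<le> sum F (A \<inter> B)" using assms(3) by (simp add: sum_nonneg)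
  then show ?thesis using sum.union_inter[OF assms(1,2), of F] by linarith
qed

text \<open>A functional \<open>i\<close> is born at the first \<open>s\<close> where it is active. Births and hits (large values
  after birth) meet each \<open>i\<close> at most once; the remaining values are smaller than the threshold
  fixed at birth, which beats the number of functionals already born.\<close>

lemma births_bound:
  fixes a :: "'i \<Rightarrow> real" and y :: "'i \<Rightarrow> nat \<Rightarrow> real" and active :: "'i \<Rightarrow> nat \<Rightarrow> bool" and \<delta> :: "nat \<Rightarrow> real"
  assumes fin: "finite I" and t: "t > 0" and a: "(\<Sum>i\<in>I. (a i)\<^sup>2) \<le> 1"
    and bessel: "\<And>s. (\<Sum>i\<in>I. (y i s)\<^sup>2) \<le> 1"
    and act: "\<And>i s. i \<in> I \<Longrightarrow> y i s \<noteq> 0 \<Longrightarrow> active i s"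
    and \<delta>: "\<And>b. 0 \<le> \<delta> b" "(\<Sum>b<t\<^sup>2. real (card {i\<in>I. active i b}) * \<delta> b) \<le> \<eta>"
    and hit: "\<And>i b s s'. i \<in> I \<Longrightarrow> active i b \<Longrightarrow> b < s \<Longrightarrow> b < s' \<Longrightarrow>
      \<delta> b \<le> \<bar>y i s\<bar> \<Longrightarrow> \<delta> b \<le> \<bar>y i s'\<bar> \<Longrightarrow> y i s \<noteq> 0 \<Longrightarrow> y i s' \<noteq> 0 \<Longrightarrow> s = s'"
  shows "(\<Sum>s<t\<^sup>2. \<Sum>i\<in>I. \<bar>a i * y i s\<bar>) \<le> 2 * t + \<eta> * t\<^sup>2"
proof -
  let ?S = "\<lambda>R s. \<Sum>i\<in>{i\<in>I. R i s}. \<bar>a i * y i s\<bar>"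
  define birth where "birth i = (LEAST b. active i b)" for i
  have birth: "active i (birth i)" "birth i \<le> s" if "active i s" for i s
    unfolding birth_def using that by (auto intro: LeastI Least_le)
  define R1 where "R1 i s \<longleftrightarrow> active i s \<and> birth i = s" for i s
  define R2 where "R2 i s \<longleftrightarrow> active i s \<and> birth i < s \<and> y i s \<noteq> 0 \<and> \<delta> (birth i) \<le> \<bar>y i s\<bar>" for i s
  define R3 where "R3 i s \<longleftrightarrow> active i s \<and> birth i < s \<and> \<bar>y i s\<bar> < \<delta> (birth i)" for i s
  have ai: "\<bar>a i\<bar> \<le> 1" if "i \<in> I" for i
    by (rule abs_coeff_le_one[OF a fin that])
  have bessel': "(\<Sum>i\<in>{i\<in>I. R i s}. (y i s)\<^sup>2) \<le> 1" for R s
  proof -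
    have "(\<Sum>i\<in>{i\<in>I. R i s}. (y i s)\<^sup>2) \<le> (\<Sum>i\<in>I. (y i s)\<^sup>2)" by (rule sum_mono2) (use fin in auto)
    then show ?thesis using bessel[of s] by linarith
  qed
  have 1: "(\<Sum>s<t\<^sup>2. ?S R1 s) \<le> t"
    by (rule disjoint_rows_bound[OF fin t a bessel']) (simp add: R1_def)
  have 2: "(\<Sum>s<t\<^sup>2. ?S R2 s) \<le> t"
  proof (rule disjoint_rows_bound[OF fin t a bessel'])
    fix i s s' assume "i \<in> I" "R2 i s" "R2 i s'"
    then show "s = s'" using hit[of i "birth i" s s'] birth unfolding R2_def by blast
  qed
  have 3: "?S R3 s \<le> \<eta>" if s: "s < t\<^sup>2" for s
  proof -
    have "?S R3 s \<le> (\<Sum>i\<in>{i\<in>I. R3 i s}. \<delta> (birth i))"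
    proof (rule sum_mono)
      fix i assume i: "i \<in> {i\<in>I. R3 i s}"
      have "\<bar>a i\<bar> * \<bar>y i s\<bar> \<le> 1 * \<delta> (birth i)"
        using ai i unfolding R3_def by (intro mult_mono) auto
      then show "\<bar>a i * y i s\<bar> \<le> \<delta> (birth i)" by (simp add: abs_mult)
    qed
    \<comment> \<open>Grouped by birth, the value \<open>\<delta> b\<close> occurs at most as often
      as there are functionals active at \<open>b\<close>.\<close>
    also have "\<dots> = (\<Sum>b<t\<^sup>2. \<Sum>i\<in>{i\<in>{i\<in>I. R3 i s}. birth i = b}. \<delta> (birth i))"
      by (rule sum.group[symmetric]) (use fin s in \<open>auto simp: R3_def\<close>)
    also have "\<dots> \<le> (\<Sum>b<t\<^sup>2. real (card {i\<in>I. active i b}) * \<delta> b)"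
    proof (rule sum_mono)
      fix b
      have "(\<Sum>i\<in>{i\<in>{i\<in>I. R3 i s}. birth i = b}. \<delta> (birth i)) = real (card {i\<in>{i\<in>I. R3 i s}. birth i = b}) * \<delta> b"
        by simp
      also have "\<dots> \<le> real (card {i\<in>I. active i b}) * \<delta> b"
        by (intro mult_right_mono \<delta>(1) of_nat_mono card_mono) (use fin birth in \<open>auto simp: R3_def\<close>)
      finally show "(\<Sum>i\<in>{i\<in>{i\<in>I. R3 i s}. birth i = b}. \<delta> (birth i)) \<le> real (card {i\<in>I. active i b}) * \<delta> b" .
    qed
    finally show ?thesis using \<delta>(2) by linarith
  qed
  have "(\<Sum>i\<in>I. \<bar>a i * y i s\<bar>) \<le> ?S R1 s
      + ?S R2 s + ?S R3 s" for s
  proof -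
    have "(\<Sum>i\<in>I. \<bar>a i * y i s\<bar>) = (\<Sum>i\<in>{i\<in>I. y i s \<noteq> 0}. \<bar>a i * y i s\<bar>)"
      by (rule sum.mono_neutral_right) (use fin in auto)
    also have "\<dots> \<le> (\<Sum>i\<in>{i\<in>I. R1 i s} \<union> {i\<in>I. R2 i s} \<union> {i\<in>I. R3 i s}. \<bar>a i * y i s\<bar>)"
    proof (rule sum_mono2)
      show "{i\<in>I. y i s \<noteq> 0} \<subseteq> {i\<in>I. R1 i s} \<union> {i\<in>I. R2 i s} \<union> {i\<in>I. R3 i s}"
      proof
        fix i assume i: "i \<in> {i\<in>I. y i s \<noteq> 0}"
        then have "active i s" using act by blast
        then show "i \<in> {i\<in>I. R1 i s} \<union> {i\<in>I. R2 i s} \<union> {i\<in>I. R3 i s}"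
          using birth(2)[of i s] i unfolding R1_def R2_def R3_def by fastforce
      qed
    qed (use fin in auto)
    also have "\<dots> \<le> (\<Sum>i\<in>{i\<in>I. R1 i s} \<union> {i\<in>I. R2 i s}. \<bar>a i * y i s\<bar>) + ?S R3 s"
      by (rule sum_Un_le) (use fin in auto)
    also have "(\<Sum>i\<in>{i\<in>I. R1 i s} \<union> {i\<in>I. R2 i s}. \<bar>a i * y i s\<bar>)
        \<le> ?S R1 s + ?S R2 s"
      by (rule sum_Un_le) (use fin in auto)
    finally show ?thesis by simp
  qed
  then have "(\<Sum>s<t\<^sup>2. \<Sum>i\<in>I. \<bar>a i * y i s\<bar>) \<le> (\<Sum>s<t\<^sup>2. ?S R1 s
      + ?S R2 s + ?S R3 s)"
    by (intro sum_mono)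
  also have "\<dots> \<le> t + t + (\<Sum>s<t\<^sup>2. \<eta>)"
  proof -
    have "(\<Sum>s<t\<^sup>2. ?S R3 s) \<le> (\<Sum>s<t\<^sup>2. \<eta>)"
      by (rule sum_mono) (use 3 in auto)
    then show ?thesis unfolding sum.distrib using 1 2 by linarith
  qed
  finally show ?thesis by (simp add: algebra_simps)
qed

section \<open>Ground functionals on sparse subsequences\<close>

context thin_blocks
begin

text \<open>At most \<open>J (k + 1) + 1\<close> functionals with disjoint indices are active up to block \<open>k\<close>; the
  threshold beats their number by a summable factor.\<close>

definition thr :: "nat \<Rightarrow> real" where
  "thr k = \<eta> * (1/2) ^ Suc k / real (J (Suc k) + 1)"

lemma thr_pos: "thr k > 0"
  unfolding thr_def using \<eta> by simp

text \<open>This provides the hypothesis \<open>hit\<close> of \<open>births_bound\<close>: the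
  threshold is fixed by the block at which a list is born, and only later blocks are
  compared.\<close>

definition sparse :: "(nat \<Rightarrow> nat) \<Rightarrow> bool" where
  "sparse \<kappa> \<longleftrightarrow> strict_mono \<kappa> \<and> (\<forall>b s s' fs. special L \<xi> M1 \<sigma>1 fs \<longrightarrow> b < s \<longrightarrow> b < s' \<longrightarrow>
     hits (thr (\<kappa> b)) (Win (\<kappa> s)) (u (\<kappa> s)) fs \<longrightarrow> hits (thr (\<kappa> b)) (Win (\<kappa> s')) (u (\<kappa> s')) fs \<longrightarrow> s = s')"

text \<open>Diagonal argument: after each chosen block the remaining infinite set is thinned by
  \<open>one_hit\<close> with the threshold of that block, and all later blocks come from the
  thinned set.\<close>

lemma ex_sparse: "\<exists>\<kappa>. sparse \<kappa> \<and> (\<forall>s. k0 \<le> \<kappa> s)"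
proof -
  define one where "one \<delta> S \<longleftrightarrow> (\<forall>fs k l. special L \<xi> M1 \<sigma>1 fs \<longrightarrow> k \<in> S \<longrightarrow> l \<in> S \<longrightarrow>
    hits \<delta> (Win k) (u k) fs \<longrightarrow> hits \<delta> (Win l) (u l) fs \<longrightarrow> k = l)" for \<delta> S
  have ex: "\<exists>S'\<subseteq>S. infinite S' \<and> one \<delta> S'" if "infinite S" "\<delta> > 0" for S \<delta>
    unfolding one_def by (rule one_hit[OF u_c00 u_N J_mono that(2,1)])
  have "\<exists>F. \<forall>n. (infinite (snd (F n)) \<and> one (thr (fst (F n))) (snd (F n)) \<and> k0 \<le> fst (F n)) \<and>
     (fst (F (Suc n)) \<in> snd (F n) \<and> fst (F n) < fst (F (Suc n)) \<and> snd (F (Suc n)) \<subseteq> snd (F n))"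
  proof (rule dependent_nat_choice)
    obtain S where "infinite S" "one (thr k0) S" using ex[OF infinite_UNIV_nat thr_pos] by blast
    then show "\<exists>x. infinite (snd x) \<and> one (thr (fst x)) (snd x) \<and> k0 \<le> fst x"
      by (intro exI[of _ "(k0, S)"]) simp
    fix x :: "nat \<times> nat set" and n :: nat
    assume x: "infinite (snd x) \<and> one (thr (fst x)) (snd x) \<and> k0 \<le> fst x"
    then obtain k where k: "k \<in> snd x" "fst x < k" by (meson infinite_nat_iff_unbounded)
    have "infinite (snd x)" using x by blast
    then obtain S where "S \<subseteq> snd x" "infinite S" "one (thr k) S" using ex[OF _ thr_pos] by blast
    then show "\<exists>y. (infinite (snd y) \<and> one (thr (fst y)) (snd y) \<and> k0 \<le> fst y) \<and>
       (fst y \<in> snd x \<and> fst x < fst y \<and> snd y \<subseteq> snd x)"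
      using k x by (intro exI[of _ "(k, S)"]) simp
  qed
  then obtain F where F: "\<And>n. one (thr (fst (F n))) (snd (F n))" "\<And>n. k0 \<le> fst (F n)"
    "\<And>n. fst (F (Suc n)) \<in> snd (F n)" "\<And>n. fst (F n) < fst (F (Suc n))" "\<And>n. snd (F (Suc n)) \<subseteq> snd (F n)"
    by blast
  define \<kappa> where "\<kappa> n = fst (F n)" for n
  have \<kappa>: "strict_mono \<kappa>" unfolding strict_mono_Suc_iff \<kappa>_def using F(4) by blast
  have dec: "snd (F n) \<subseteq> snd (F m)" if "m \<le> n" for m n
    using that by (induction n rule: dec_induct) (use F(5) in auto)
  have mem: "\<kappa> s \<in> snd (F b)" if bs: "b < s" for b s
  proof -
    obtain s' where "s = Suc s'" "b \<le> s'" using bs by (cases s) auto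
    then show ?thesis using F(3)[of s'] dec[of b s'] unfolding \<kappa>_def by auto
  qed
  have "sparse \<kappa>"
    unfolding sparse_def
  proof (intro conjI allI impI)
    fix b s s' fs assume *: "special L \<xi> M1 \<sigma>1 fs" "b < s" "b < s'"
      "hits (thr (\<kappa> b)) (Win (\<kappa> s)) (u (\<kappa> s)) fs" "hits (thr (\<kappa> b)) (Win (\<kappa> s')) (u (\<kappa> s')) fs"
    have "\<kappa> s = \<kappa> s'"
      by (rule F(1)[of b, unfolded one_def, rule_format, OF *(1) mem[OF *(2)] mem[OF *(3)]])
        (use * in \<open>simp_all add: \<kappa>_def\<close>)
    then show "s = s'" using \<kappa> strict_mono_eq by blast
  qed (rule \<kappa>)
  then show ?thesis using F(2) unfolding \<kappa>_def by blast
qed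

lemma sum_abs_coord_le:
  fixes \<kappa> :: "nat \<Rightarrow> nat"
  assumes \<kappa>: "strict_mono \<kappa>" and S: "finite S"
  shows "(\<Sum>s\<in>S. \<bar>u (\<kappa> s) n\<bar>) \<le> 1"
proof (rule disjoint_supp_sum_le[OF _ S])
  fix s s' :: nat assume "s \<noteq> s'"
  then show "supp (u (\<kappa> s)) \<inter> supp (u (\<kappa> s')) = {}"
    by (intro before_supp_disjoint[where S = UNIV and x = "\<lambda>s. u (\<kappa> s)"] u_before strict_monoD[OF \<kappa>]) auto
next
  fix s show "\<bar>u (\<kappa> s) n\<bar> \<le> 1" using coord_le_N[OF u_c00, of "\<kappa> s" n] u_N[of "\<kappa> s"] by linarith
qed simp

text \<open>The functional sees at most \<open>nseq (2 * j - 1)\<close> coordinates, and each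
  coordinate belongs to at most one block. The bound is thus independent of the number of
  blocks.\<close>

lemma G1_sum_blocks:
  fixes \<kappa> :: "nat \<Rightarrow> nat"
  assumes h: "h \<in> G1j j" and \<kappa>: "strict_mono \<kappa>" and S: "finite S"
  shows "(\<Sum>s\<in>S. \<bar>act h (u (\<kappa> s))\<bar>) \<le> real (nseq (2 * j - 1))"
proof -
  have hn: "\<bar>h n\<bar> \<le> 1" for n
    using G1j_abs_le[OF h, of n] by (rule order_trans) (simp add: power_le_one)
  have "(\<Sum>s\<in>S. \<bar>act h (u (\<kappa> s))\<bar>) \<le> (\<Sum>s\<in>S. \<Sum>n\<in>supp h. \<bar>u (\<kappa> s) n\<bar>)"
  proof (rule sum_mono)
    fix s
    have "\<bar>act h (u (\<kappa> s))\<bar> \<le> (\<Sum>n\<in>supp h. \<bar>h n * u (\<kappa> s) n\<bar>)" unfolding act_def by (rule sum_abs)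
    also have "\<dots> \<le> (\<Sum>n\<in>supp h. \<bar>u (\<kappa> s) n\<bar>)"
      by (rule sum_mono) (use hn in \<open>simp add: abs_mult mult_left_le_one_le\<close>)
    finally show "\<bar>act h (u (\<kappa> s))\<bar> \<le> (\<Sum>n\<in>supp h. \<bar>u (\<kappa> s) n\<bar>)" .
  qed
  also have "\<dots> = (\<Sum>n\<in>supp h. \<Sum>s\<in>S. \<bar>u (\<kappa> s) n\<bar>)" by (rule sum.swap)
  also have "\<dots> \<le> (\<Sum>n\<in>supp h. 1)" by (rule sum_mono) (rule sum_abs_coord_le[OF \<kappa> S])
  also have "\<dots> \<le> real (nseq (2 * j - 1))" using h by (simp add: G1j_iff)
  finally show ?thesis .
qed

lemma act_pieces:
  assumes r: "ground_rep L \<xi> M1 \<sigma>1 I a fs \<epsilon> E"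
  shows "(\<Sum>i\<in>I. a i * act (gpart W (fs i) (\<epsilon> i) (E i)) x) =
    (\<Sum>d\<in>{d\<in>pieces I fs E. gind (fs (fst d) ! snd d) \<in> W}.
      a (fst d) * (\<epsilon> (fst d) (snd d) * act (restr (E (fst d)) (fs (fst d) ! snd d)) x))"
proof -
  have fI: "finite I" using r unfolding ground_rep_def by blast
  have U: "fs i \<in> Useq" if "i \<in> I" for i
    using r that gtriple_Useq unfolding ground_rep_def by blast
  have "(\<Sum>i\<in>I. a i * act (gpart W (fs i) (\<epsilon> i) (E i)) x) =
    (\<Sum>i\<in>I. \<Sum>p\<in>{p. p < length (fs i) \<and> gind (fs i ! p) \<in> W}.
      a i * (\<epsilon> i p * act (restr (E i) (fs i ! p)) x))"
    by (rule sum.cong) (simp_all add: act_gpart[OF U] sum_distrib_left)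
  also have "\<dots> = (\<Sum>d\<in>Sigma I (\<lambda>i. {p. p < length (fs i) \<and> gind (fs i ! p) \<in> W}).
      a (fst d) * (\<epsilon> (fst d) (snd d) * act (restr (E (fst d)) (fs (fst d) ! snd d)) x))"
    by (subst sum.Sigma) (use fI in \<open>auto simp: case_prod_unfold\<close>)
  also have "\<dots> = (\<Sum>d\<in>{d\<in>pieces I fs E. gind (fs (fst d) ! snd d) \<in> W}.
      a (fst d) * (\<epsilon> (fst d) (snd d) * act (restr (E (fst d)) (fs (fst d) ! snd d)) x))"
    by (rule sum.mono_neutral_right) (use fI in \<open>auto simp: pieces_def\<close>)
  finally show ?thesis .
qed

lemma sum_thr_le:
  fixes \<kappa> :: "nat \<Rightarrow> nat"
  assumes "strict_mono \<kappa>"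
  shows "(\<Sum>b<n. real (J (Suc (\<kappa> b)) + 1) * thr (\<kappa> b)) \<le> \<eta>"
proof -
  have "real (J (Suc (\<kappa> b)) + 1) * thr (\<kappa> b) \<le> \<eta> * (1/2) ^ Suc b" for b
  proof -
    have "real (J (Suc (\<kappa> b)) + 1) * thr (\<kappa> b) = \<eta> * (1/2) ^ Suc (\<kappa> b)"
      unfolding thr_def by (simp del: of_nat_add of_nat_Suc)
    also have "\<dots> \<le> \<eta> * (1/2) ^ Suc b"
      using \<eta> strict_mono_imp_increasing[OF assms, of b] by (intro mult_left_mono power_decreasing) auto
    finally show ?thesis .
  qed
  then have "(\<Sum>b<n. real (J (Suc (\<kappa> b)) + 1) * thr (\<kappa> b)) \<le> (\<Sum>b<n. \<eta> * (1/2) ^ Suc b)"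
    by (rule sum_mono)
  also have "\<dots> = \<eta> * (1 - (1/2) ^ n)"
    by (induction n) (auto simp: algebra_simps)
  also have "\<dots> \<le> \<eta> * 1" using \<eta> by (intro mult_left_mono) auto
  finally show ?thesis by simp
qed

text \<open>\<open>births_bound\<close> applied to the lists, where a list is active at a block if
  one of its surviving indices lies in the window of the block.\<close>

lemma window_estimate:
  assumes r: "ground_rep L \<xi> M1 \<sigma>1 I a fs \<epsilon> E" and sp: "sparse \<kappa>" and t: "t > 0"
  shows "(\<Sum>s<t\<^sup>2. \<Sum>i\<in>I. \<bar>a i * act (gpart (Win (\<kappa> s)) (fs i) (\<epsilon> i) (E i)) (u (\<kappa> s))\<bar>) \<le> 2 * t + \<eta> * t\<^sup>2"
proof -
  have \<kappa>: "strict_mono \<kappa>" using sp unfolding sparse_def by blast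
  have fI: "finite I" and a: "(\<Sum>i\<in>I. (a i)\<^sup>2) \<le> 1"
    and tr: "\<And>i. i \<in> I \<Longrightarrow> gtriple L \<xi> M1 \<sigma>1 (fs i) (\<epsilon> i) (E i)"
    and dis: "\<And>i k. i \<in> I \<Longrightarrow> k \<in> I \<Longrightarrow> i \<noteq> k \<Longrightarrow> ginds (E i) (fs i) \<inter> ginds (E k) (fs k) = {}"
    using r unfolding ground_rep_def by auto
  let ?y = "\<lambda>i s. act (gpart (Win (\<kappa> s)) (fs i) (\<epsilon> i) (E i)) (u (\<kappa> s))"
  let ?act = "\<lambda>i s. ginds (E i) (fs i) \<inter> Win (\<kappa> s) \<noteq> {}"
  show ?thesis
  proof (rule births_bound[where \<delta> = "\<lambda>b. thr (\<kappa> b)" and active = ?act, OF fI t a])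
    fix s
    show "(\<Sum>i\<in>I. (?y i s)\<^sup>2) \<le> 1"
    proof (rule ground_bessel[OF fI tr nat_interval_greaterThanAtMost _ u_c00 u_N])
      fix i k assume "i \<in> I" "k \<in> I" "i \<noteq> k"
      from dis[OF this] show "ginds (E i) (fs i) \<inter> Win (\<kappa> s) \<inter> (ginds (E k) (fs k) \<inter> Win (\<kappa> s)) = {}"
        by blast
    qed
  next
    fix i s assume "?y i s \<noteq> 0"
    then show "?act i s" using gpart_eq_zero[of "E i" "fs i" "Win (\<kappa> s)" "\<epsilon> i"] by auto
  next
    fix b show "0 \<le> thr (\<kappa> b)" using thr_pos less_imp_le by blast
  next
    have "card {i\<in>I. ?act i b} \<le> J (Suc (\<kappa> b)) + 1" for b
    proof -
      \<comment> \<open>Each active list is represented by one of its indices in the window;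
        disjoint index sets make the representatives distinct.\<close>
      define h where "h i = (SOME j. j \<in> ginds (E i) (fs i) \<inter> Win (\<kappa> b))" for i
      have h: "h i \<in> ginds (E i) (fs i) \<inter> Win (\<kappa> b)" if "i \<in> {i\<in>I. ?act i b}" for i
        unfolding h_def by (rule someI_ex) (use that in blast)
      have "inj_on h {i\<in>I. ?act i b}"
      proof (rule inj_onI)
        fix i k assume ik: "i \<in> {i\<in>I. ?act i b}" "k \<in> {i\<in>I. ?act i b}" "h i = h k"
        show "i = k" using h[OF ik(1)] h[OF ik(2)] ik dis[of i k] by auto
      qed
      moreover have "h ` {i\<in>I. ?act i b} \<subseteq> {..J (Suc (\<kappa> b))}" using h by fastforce
      ultimately have "card {i\<in>I. ?act i b} \<le> card {..J (Suc (\<kappa> b))}"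
        by (intro card_inj_on_le) auto
      then show ?thesis by simp
    qed
    then have "(\<Sum>b<t\<^sup>2. real (card {i\<in>I. ?act i b}) * thr (\<kappa> b)) \<le> (\<Sum>b<t\<^sup>2. real (J (Suc (\<kappa> b)) + 1) * thr (\<kappa> b))"
      using thr_pos by (intro sum_mono mult_right_mono of_nat_mono) (auto intro: less_imp_le)
    then show "(\<Sum>b<t\<^sup>2. real (card {i\<in>I. ?act i b}) * thr (\<kappa> b)) \<le> \<eta>"
      using sum_thr_le[OF \<kappa>, of "t\<^sup>2"] by linarith
  next
    fix i b s s' assume i: "i \<in> I" "?act i b" and bs: "b < s" "b < s'"
      and y: "thr (\<kappa> b) \<le> \<bar>?y i s\<bar>" "thr (\<kappa> b) \<le> \<bar>?y i s'\<bar>" and nz: "?y i s \<noteq> 0" "?y i s' \<noteq> 0"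
    have h: "hits (thr (\<kappa> b)) (Win (\<kappa> s)) (u (\<kappa> s)) (fs i)" "hits (thr (\<kappa> b)) (Win (\<kappa> s')) (u (\<kappa> s')) (fs i)"
      using tr[OF i(1)] y unfolding hits_def gtriple_def by blast+
    show "s = s'"
    proof (cases "special L \<xi> M1 \<sigma>1 (fs i)")
      case True
      show ?thesis by (rule sp[unfolded sparse_def, THEN conjunct2, rule_format, OF True bs h])
    next
      \<comment> \<open>A single functional of \<open>G1\<close> has one index, which cannot lie in
        the window at \<open>b\<close> and also in a later one; so this case is
        contradictory.\<close>
      case False
      then obtain f j where f: "fs i = [f]" "f \<in> G1j j" using tr[OF i(1)] unfolding gtriple_def spec_list_def by blast
      then have g: "ginds (E i) (fs i) \<subseteq> {j}" unfolding ginds_def using gind_eq[OF f(2)] by auto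
      have "?act i s" using nz(1) gpart_eq_zero[of "E i" "fs i" "Win (\<kappa> s)" "\<epsilon> i"] by auto
      then have "j \<in> Win (\<kappa> s)" "j \<in> Win (\<kappa> b)" using g i(2) by auto
      moreover have "\<kappa> s \<noteq> \<kappa> b" using bs \<kappa> by (simp add: strict_mono_eq)
      ultimately show ?thesis using Win_disjoint by blast
    qed
  qed
qed

text \<open>Low indices contribute a constant independent of \<open>t\<close>. Known indices and the
  tail cost \<open>\<eta>\<close> per block each, and the windows are covered by
  \<open>window_estimate\<close>.\<close>

lemma ground_estimate:
  assumes r: "ground_rep L \<xi> M1 \<sigma>1 I a fs \<epsilon> E" and sp: "sparse \<kappa>" and t: "t > 0"
  shows "(\<Sum>s<t\<^sup>2. \<bar>act (ground_fun I a fs \<epsilon> E) (u (\<kappa> s))\<bar>)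
    \<le> (\<Sum>j\<in>{1..j0}. real (nseq (2 * j - 1))) + 2 * t + 3 * \<eta> * t\<^sup>2"
proof -
  have \<kappa>: "strict_mono \<kappa>" using sp unfolding sparse_def by blast
  have fI: "finite I" and a: "(\<Sum>i\<in>I. (a i)\<^sup>2) \<le> 1"
    using r unfolding ground_rep_def by auto
  have U: "fs i \<in> Useq" if "i \<in> I" for i
    using r that gtriple_Useq unfolding ground_rep_def by blast
  let ?P = "t\<^sup>2"
  let ?D = "pieces I fs E"
  define g where "g d = gind (fs (fst d) ! snd d)" for d
  define h where "h d = restr (E (fst d)) (fs (fst d) ! snd d)" for d
  define F where "F d s = a (fst d) * (\<epsilon> (fst d) (snd d) * act (h d) (u (\<kappa> s)))" for d s
  have finD: "finite ?D" by (rule finite_pieces[OF fI])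
  have inj: "inj_on g ?D" using pieces_inj[OF r] unfolding g_def by (simp add: case_prod_unfold)
  have inj': "inj_on g D'" if "D' \<subseteq> ?D" for D' using inj that inj_on_subset by blast
  have d: "h d \<in> G1j (g d)" "\<bar>\<epsilon> (fst d) (snd d)\<bar> = 1" "fst d \<in> I" "\<bar>a (fst d)\<bar> \<le> 1" if "d \<in> ?D" for d
    using piece_G1j[OF r, of "fst d" "snd d"] ground_rep_coeff[OF r, of "fst d"] that unfolding h_def g_def by auto
  have gpos: "1 \<le> g d" if "d \<in> ?D" for d using d(1)[OF that] by (simp add: G1j_iff)
  have Fle: "\<bar>F d s\<bar> \<le> \<bar>act (h d) (u (\<kappa> s))\<bar>" if "d \<in> ?D" for d s
    unfolding F_def using d(2,4)[OF that] by (simp add: abs_mult mult_left_le_one_le)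
  have total: "act (ground_fun I a fs \<epsilon> E) (u (\<kappa> s)) = (\<Sum>d\<in>?D. F d s)" for s
  proof -
    have "act (ground_fun I a fs \<epsilon> E) (u (\<kappa> s)) = (\<Sum>i\<in>I. a i * act (gpart UNIV (fs i) (\<epsilon> i) (E i)) (u (\<kappa> s)))"
      unfolding ground_fun_def by (rule act_sum_left) (use fI gpart_c00[OF U] in auto)
    then show ?thesis unfolding act_pieces[OF r] F_def h_def by simp
  qed
  define A where "A = {d\<in>?D. g d \<le> j0}"
  define B where "B s = {d\<in>?D. j0 < g d \<and> g d \<le> J (\<kappa> s)}" for s
  define C where "C s = {d\<in>?D. g d \<in> Win (\<kappa> s)}" for s
  define D where "D s = {d\<in>?D. J (Suc (\<kappa> s)) < g d}" for s
  have split: "(\<Sum>d\<in>?D. F d s) = (\<Sum>d\<in>A. F d s) + (\<Sum>d\<in>B s. F d s) + (\<Sum>d\<in>C s. F d s) + (\<Sum>d\<in>D s. F d s)" for s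
    unfolding A_def B_def C_def D_def
    by (rule sum_split4[OF finD J_ge]) (use J_mono in \<open>simp add: strict_mono_less_eq\<close>)
  have 1: "(\<Sum>s<?P. \<bar>\<Sum>d\<in>A. F d s\<bar>) \<le> (\<Sum>j\<in>{1..j0}. real (nseq (2 * j - 1)))"
  proof -
    have "(\<Sum>s<?P. \<bar>\<Sum>d\<in>A. F d s\<bar>) \<le> (\<Sum>s<?P. \<Sum>d\<in>A. \<bar>act (h d) (u (\<kappa> s))\<bar>)"
    proof (rule sum_mono)
      fix s
      have "\<bar>\<Sum>d\<in>A. F d s\<bar> \<le> (\<Sum>d\<in>A. \<bar>F d s\<bar>)" by (rule sum_abs)
      also have "\<dots> \<le> (\<Sum>d\<in>A. \<bar>act (h d) (u (\<kappa> s))\<bar>)" by (rule sum_mono, rule Fle) (simp add: A_def)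
      finally show "\<bar>\<Sum>d\<in>A. F d s\<bar> \<le> (\<Sum>d\<in>A. \<bar>act (h d) (u (\<kappa> s))\<bar>)" .
    qed
    also have "\<dots> = (\<Sum>d\<in>A. \<Sum>s<?P. \<bar>act (h d) (u (\<kappa> s))\<bar>)" by (rule sum.swap)
    also have "\<dots> \<le> (\<Sum>d\<in>A. real (nseq (2 * g d - 1)))"
      by (rule sum_mono, rule G1_sum_blocks[OF _ \<kappa>]) (use d(1) in \<open>auto simp: A_def\<close>)
    also have "\<dots> = (\<Sum>j\<in>g ` A. real (nseq (2 * j - 1)))"
      by (simp add: sum.reindex[OF inj'] A_def)
    also have "\<dots> \<le> (\<Sum>j\<in>{1..j0}. real (nseq (2 * j - 1)))"
      by (rule sum_mono2) (use gpos in \<open>auto simp: A_def\<close>)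
    finally show ?thesis .
  qed
  \<comment> \<open>Pieces of one list share a coefficient, so Cauchy-Schwarz applies only after all
    but one piece per list are seen to vanish on the block.\<close>
  have 2: "\<bar>\<Sum>d\<in>B s. F d s\<bar> \<le> \<eta>" for s
  proof -
    define B' where "B' = {d\<in>B s. act (h d) (u (\<kappa> s)) \<noteq> 0}"
    have B': "B' \<subseteq> ?D" "B' \<subseteq> B s" unfolding B'_def B_def by auto
    have finB: "finite (B s)" unfolding B_def using finD by simp
    have eq: "(\<Sum>d\<in>B s. F d s) = (\<Sum>d\<in>B'. a (fst d) * (\<epsilon> (fst d) (snd d) * act (h d) (u (\<kappa> s))))"
      unfolding F_def by (rule sum.mono_neutral_right) (use finB in \<open>auto simp: B'_def\<close>)
    have no: False if dd: "(i, p) \<in> B'" "(i, q) \<in> B'" "p < q" for i p q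
    proof -
      have iI: "i \<in> I" and q: "q < length (fs i)" using dd B'(1) unfolding pieces_def by auto
      have "special L \<xi> M1 \<sigma>1 (fs i)"
      proof (rule ccontr)
        assume "\<not> ?thesis"
        then have "length (fs i) = 1"
          using r iI unfolding ground_rep_def gtriple_def spec_list_def by fastforce
        then show False using q dd(3) by simp
      qed
      \<comment> \<open>The index of the later piece encodes its predecessors. Being at most
        \<open>J (\<kappa> s)\<close>, it forces them to end before the block.\<close>
      then have c: "gind (fs i ! q) = \<sigma>1 (take q (fs i))" using special_gind_Suc(1) q dd(3) by simp
      have "gind (fs i ! q) \<le> J (\<kappa> s)" using dd(2) B'(2) unfolding B_def g_def by auto
      then have le: "\<sigma>1 (take q (fs i)) \<le> J (\<kappa> s)" using c by simp
      have T: "take q (fs i) \<in> Useq" using Useq_take[OF U[OF iI]] dd(3) by simp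
      have mem: "fs i ! p \<in> set (take q (fs i))" using dd(3) q by (auto simp: in_set_conv_nth intro!: exI[of _ p])
      have "supp (h (i, p)) \<inter> supp (u (\<kappa> s)) = {}"
      proof (rule ccontr)
        assume "\<not> ?thesis"
        then obtain n where "n \<in> supp (fs i ! p)" "n \<in> supp (u (\<kappa> s))" unfolding h_def by (auto simp: supp_restr)
        then show False using u_codes[OF T le mem] by blast
      qed
      then have "act (h (i, p)) (u (\<kappa> s)) = 0" by (rule act_eq_0)
      then show False using dd(1) unfolding B'_def by simp
    qed
    have injf: "inj_on fst B'"
    proof (rule inj_onI)
      fix d d' assume dd: "d \<in> B'" "d' \<in> B'" "fst d = fst d'"
      obtain i p q where ip: "d = (i, p)" "d' = (i, q)" using dd(3) by (cases d, cases d') auto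
      have "p = q" using no[of i p q] no[of i q p] dd(1,2) unfolding ip by (cases p q rule: linorder_cases) auto
      then show "d = d'" using ip by simp
    qed
    have finB': "finite B'" using B'(2) finB finite_subset by blast
    show ?thesis unfolding eq
    proof (rule cauchy_schwarz_ball)
      have "(\<Sum>d\<in>B'. (a (fst d))\<^sup>2) = (\<Sum>i\<in>fst ` B'. (a i)\<^sup>2)" by (simp add: sum.reindex[OF injf])
      also have "\<dots> \<le> (\<Sum>i\<in>I. (a i)\<^sup>2)"
        by (rule sum_mono2) (use fI d(3) B'(1) in auto)
      finally show "(\<Sum>d\<in>B'. (a (fst d))\<^sup>2) \<le> 1" using a by linarith
      have "(\<Sum>d\<in>B'. (act (h d) (u (\<kappa> s)))\<^sup>2) \<le> \<eta>\<^sup>2"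
      proof (rule energy_le_indexed[OF u_G1 finB' inj'[OF B'(1)]])
        fix d' assume "d' \<in> B'"
        then have "d' \<in> B s" "d' \<in> ?D" using B' by blast+
        then show "j0 < g d' \<and> g d' \<le> J (\<kappa> s) \<and> h d' \<in> G1j (g d')" using d(1)[of d'] unfolding B_def by blast
      qed
      moreover have "(\<Sum>d\<in>B'. (\<epsilon> (fst d) (snd d) * act (h d) (u (\<kappa> s)))\<^sup>2) = (\<Sum>d\<in>B'. (act (h d) (u (\<kappa> s)))\<^sup>2)"
      proof (rule sum.cong)
        fix d' assume "d' \<in> B'"
        then have "\<bar>\<epsilon> (fst d') (snd d')\<bar> = 1" using d(2) B'(1) by blast
        then have "(\<epsilon> (fst d') (snd d'))\<^sup>2 = 1" by (metis power2_abs power_one)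
        then show "(\<epsilon> (fst d') (snd d') * act (h d') (u (\<kappa> s)))\<^sup>2 = (act (h d') (u (\<kappa> s)))\<^sup>2"
          by (simp add: power_mult_distrib)
      qed simp
      ultimately show "(\<Sum>d\<in>B'. (\<epsilon> (fst d) (snd d) * act (h d) (u (\<kappa> s)))\<^sup>2) \<le> \<eta>\<^sup>2" by simp
    qed (use \<eta> in simp)
  qed
  have 3: "(\<Sum>s<?P. \<bar>\<Sum>d\<in>C s. F d s\<bar>) \<le> 2 * t + \<eta> * ?P"
  proof -
    have "(\<Sum>d\<in>C s. F d s) = (\<Sum>i\<in>I. a i * act (gpart (Win (\<kappa> s)) (fs i) (\<epsilon> i) (E i)) (u (\<kappa> s)))" for s
      unfolding act_pieces[OF r] C_def F_def g_def h_def ..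
    then have "(\<Sum>s<?P. \<bar>\<Sum>d\<in>C s. F d s\<bar>)
        \<le> (\<Sum>s<?P. \<Sum>i\<in>I. \<bar>a i * act (gpart (Win (\<kappa> s)) (fs i) (\<epsilon> i) (E i)) (u (\<kappa> s))\<bar>)"
      by (simp add: sum_mono sum_abs)
    also have "\<dots> \<le> 2 * t + \<eta> * ?P" using window_estimate[OF r sp t] by simp
    finally show ?thesis .
  qed
  have 4: "\<bar>\<Sum>d\<in>D s. F d s\<bar> \<le> \<eta>" for s
  proof -
    have "\<bar>\<Sum>d\<in>D s. F d s\<bar> \<le> (\<Sum>d\<in>D s. \<bar>F d s\<bar>)" by (rule sum_abs)
    also have "\<dots> \<le> \<eta>"
    proof (rule tail_sum_le)
      show "finite (D s)" unfolding D_def using finD by simp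
      show "inj_on g (D s)" by (rule inj') (auto simp: D_def)
      fix d' assume "d' \<in> D s"
      then have d': "d' \<in> ?D" "J (Suc (\<kappa> s)) < g d'" unfolding D_def by auto
      show "J (Suc (\<kappa> s)) < g d'" by (rule d'(2))
      have "\<bar>act (h d') (u (\<kappa> s))\<bar> \<le> (1/32) ^ g d' * l1 (u (\<kappa> s))"
        by (rule abs_act_le[OF _ u_c00 G1j_abs_le[OF d(1)[OF d'(1)]]]) (use d(1)[OF d'(1)] G1j_subset_c00 in blast)
      then show "\<bar>F d' s\<bar> \<le> (1/32) ^ g d' * l1 (u (\<kappa> s))" using Fle[OF d'(1), of s] by linarith
    qed
    finally show ?thesis .
  qed
  have "(\<Sum>s<?P. \<bar>act (ground_fun I a fs \<epsilon> E) (u (\<kappa> s))\<bar>)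
      \<le> (\<Sum>s<?P. \<bar>\<Sum>d\<in>A. F d s\<bar> + \<eta> + \<bar>\<Sum>d\<in>C s. F d s\<bar> + \<eta>)"
    unfolding total split using 2 4 by (intro sum_mono) (smt (verit))
  also have "\<dots> \<le> (\<Sum>j\<in>{1..j0}. real (nseq (2 * j - 1))) + 2 * t + 3 * \<eta> * ?P"
    unfolding sum.distrib using 1 3 by (simp add: algebra_simps)
  finally show ?thesis .
qed

end

section \<open>From bounds on generators to the norm of averages\<close>

context attractor_space
begin

lemma op_result_isop:
  assumes "op_result K n (1 / real (mseq j)) f" "n \<le> nseq j" "j \<ge> 1" "f \<in> K"
  shows "isop j f"
proof -
  obtain gs where "gs \<noteq> []" "length gs \<le> n" "set gs \<subseteq> K" "successive gs"
    "f = (\<lambda>k. 1 / real (mseq j) * (\<Sum>i<length gs. (gs ! i) k))"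
    using assms(1) unfolding op_result_def by blast
  then have "op_result K (nseq j) (1 / real (mseq j)) f"
    using assms(2) unfolding op_result_def by (intro exI[of _ gs]) simp
  then show ?thesis using assms unfolding isop_def by blast
qed

text \<open>The functionals of \<open>K\<close> all of whose restrictions to intervals are small at \<open>z\<close> form a set
  with the closure properties defining \<open>K\<close>.\<close>

lemma N_le_by_closure:
  assumes z: "z \<in> c00" and \<beta>: "0 \<le> \<beta>"
    and coord: "\<And>n. \<bar>z n\<bar> \<le> \<beta>"
    and ground: "\<And>I a fs \<epsilon> E. ground_rep L \<xi> M1 \<sigma>1 I a fs \<epsilon> E \<Longrightarrow> \<bar>act (ground_fun I a fs \<epsilon> E) z\<bar> \<le> \<beta>"
    and l2: "\<And>(I::nat set) j f c. finite I \<Longrightarrow> (\<And>i. i \<in> I \<Longrightarrow> isop (j i) (f i)) \<Longrightarrow> inj_on j I \<Longrightarrow>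
      (\<Sum>i\<in>I. (c i)\<^sup>2) \<le> 1 \<Longrightarrow> \<bar>act (\<lambda>n. \<Sum>i\<in>I. c i * f i n) z\<bar> \<le> \<beta>"
  shows "N z \<le> \<beta>"
proof -
  define A where "A = {f\<in>K. \<forall>E. nat_interval E \<longrightarrow> \<bar>act (restr E f) z\<bar> \<le> \<beta>}"
  have AK: "A \<subseteq> K" unfolding A_def by blast
  \<comment> \<open>A weighted functional is an l2-sum with the single coefficient 1, and its
    restrictions to intervals are weighted again.\<close>
  have isopA: "f \<in> A" if "isop j f" for j f
  proof -
    have "\<bar>act (restr E f) z\<bar> \<le> \<beta>" if "nat_interval E" for E
      using l2[of "{0}" "\<lambda>_. j" "\<lambda>_. restr E f" "\<lambda>_. 1"] isop_restr[OF \<open>isop j f\<close> that] by simp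
    then show ?thesis using that unfolding A_def isop_def by blast
  qed
  have "K \<subseteq> A"
  proof (rule K_induct_closed)
    show "A \<subseteq> c00" using AK K_c00 by blast
    show "Defs.K_closed (Gset L \<xi> M1 \<sigma>1) \<Lambda> N1 \<sigma> A"
      unfolding K_closed_def
    proof (intro conjI ballI allI impI)
      fix f assume f: "f \<in> A"
      have "\<bar>act (restr E (\<lambda>n. - f n)) z\<bar> \<le> \<beta>" if "nat_interval E" for E
      proof -
        have "restr E (\<lambda>n. - f n) = (\<lambda>n. - restr E f n)" unfolding restr_def by auto
        then have "act (restr E (\<lambda>n. - f n)) z = - act (restr E f) z"
          using act_minus_left[OF c00_restr[OF K_c00], of f E z] f unfolding A_def by simp
        then show ?thesis using f that unfolding A_def by simp
      qed
      then show "(\<lambda>n. - f n) \<in> A" using f K_uminus unfolding A_def by simp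
      fix E assume "nat_interval E"
      then show "restr E f \<in> A"
        using f K_restr nat_interval_Int unfolding A_def by (simp add: restr_restr)
    next
      show "Gset L \<xi> M1 \<sigma>1 \<subseteq> A"
      proof
        fix g assume g: "g \<in> Gset L \<xi> M1 \<sigma>1"
        have "\<bar>act (restr E g) z\<bar> \<le> \<beta>" if E: "nat_interval E" for E
        proof (cases "g \<in> G0")
          case True
          then obtain s n where sn: "s \<in> {-1, 1::real}" "n \<ge> 1" "g = (\<lambda>k. s * unit_vec n k)" unfolding G0_def by blast
          have "act (restr E g) z = s * (restr E z) n"
            using act_restr[OF K_c00[OF K_G[OF g]], of E z] act_scale_left[OF c00_unit_vec[OF sn(2)], of s "restr E z"]
              act_unit_vec[OF sn(2), of "restr E z"] unfolding sn(3) by simp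
          then show ?thesis using sn(1) coord[of n] \<beta> unfolding restr_def by auto
        next
          case False
          obtain I a fs \<epsilon> F where r: "ground_rep L \<xi> M1 \<sigma>1 I a fs \<epsilon> F" "g = ground_fun I a fs \<epsilon> F"
            using Gset_ground_rep[OF g False] by blast
          show ?thesis unfolding r(2) ground_rep_restr(2)[OF r(1) E] by (rule ground[OF ground_rep_restr(1)[OF r(1) E]])
        qed
        then show "g \<in> A" using K_G[OF g] unfolding A_def by blast
      qed
    next
      \<comment> \<open>The bound does not come from the constituents: the result is a weighted
        functional of \<open>K\<close>, so \<open>isopA\<close> applies.\<close>
      fix j f assume "1 \<le> j" "op_result A (nseq (2 * j)) (1 / real (mseq (2 * j))) f"
      then have "op_result K (nseq (2 * j)) (1 / real (mseq (2 * j))) f" "1 \<le> 2 * j" "f \<in> K"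
        using op_result_mono[OF AK] K_even_op by auto
      then show "f \<in> A" by (intro isopA[of "2 * j"] op_result_isop) auto
    next
      fix j fs assume j: "1 \<le> j" and fs: "attractor_seq \<Lambda> N1 \<sigma> A j fs"
      let ?f = "\<lambda>n. 1 / real (mseq (2 * j - 1)) * (\<Sum>i<length fs. (fs ! i) n)"
      have K: "attractor_seq \<Lambda> N1 \<sigma> K j fs" by (rule attractor_seq_mono[OF AK fs])
      have "?f \<in> K"
        by (rule K_closed[THEN conjunct2, THEN conjunct2, THEN conjunct2, THEN conjunct2, THEN conjunct1,
          rule_format, OF j K])
      moreover have "op_result K (nseq (2 * j - 1)) (1 / real (mseq (2 * j - 1))) ?f"
        using K unfolding attractor_seq_def Qs_def op_result_def by (intro exI[of _ fs]) auto
      ultimately show "?f \<in> A" using j by (intro isopA[of "2 * j - 1"] op_result_isop) auto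
    next
      fix I :: "nat set" and c :: "nat \<Rightarrow> real" and f j
      assume h: "finite I \<and> (\<forall>i\<in>I. f i \<in> A \<and> j i \<ge> 1 \<and> op_result A (nseq (j i)) (1 / real (mseq (j i))) (f i)) \<and>
        inj_on (\<lambda>i. nseq (j i)) I \<and> (\<forall>i\<in>I. c i \<in> \<rat>) \<and> (\<Sum>i\<in>I. (c i)\<^sup>2) \<le> 1"
      have op: "isop (j i) (f i)" if "i \<in> I" for i
        using h that op_result_mono[OF AK] AK unfolding isop_def by blast
      have inj: "inj_on j I" using h unfolding inj_on_def by metis
      have K: "(\<lambda>n. \<Sum>i\<in>I. c i * f i n) \<in> K"
        by (rule K_l2_sum[where j = j]) (use h op inj in auto)
      have "\<bar>act (restr E (\<lambda>n. \<Sum>i\<in>I. c i * f i n)) z\<bar> \<le> \<beta>" if "nat_interval E" for E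
        unfolding restr_sum by (rule l2[where j = j]) (use h op inj isop_restr that in auto)
      then show "(\<lambda>n. \<Sum>i\<in>I. c i * f i n) \<in> A" using K unfolding A_def by blast
    next
      fix I :: "nat set" and c :: "nat \<Rightarrow> real" and f
      assume h: "finite I \<and> (\<forall>i\<in>I. f i \<in> A \<and> c i \<in> \<rat> \<and> c i \<ge> 0) \<and> (\<Sum>i\<in>I. c i) = 1"
      have fK: "f i \<in> K" if "i \<in> I" for i using h that unfolding A_def by blast
      have h': "finite I \<and> (\<forall>i\<in>I. f i \<in> K \<and> c i \<in> \<rat> \<and> c i \<ge> 0) \<and> (\<Sum>i\<in>I. c i) = 1"
        using h fK by blast
      have K: "(\<lambda>n. \<Sum>i\<in>I. c i * f i n) \<in> K"
        by (rule K_closed[THEN conjunct2, THEN conjunct2, THEN conjunct2, THEN conjunct2, THEN conjunct2, THEN conjunct2,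
          rule_format, OF h'])
      have "\<bar>act (restr E (\<lambda>n. \<Sum>i\<in>I. c i * f i n)) z\<bar> \<le> \<beta>" if E: "nat_interval E" for E
      proof -
        have "act (restr E (\<lambda>n. \<Sum>i\<in>I. c i * f i n)) z = (\<Sum>i\<in>I. c i * act (restr E (f i)) z)"
          unfolding restr_sum by (rule act_sum_left) (use h c00_restr[OF K_c00[OF fK]] in auto)
        also have "\<bar>\<dots>\<bar> \<le> (\<Sum>i\<in>I. \<bar>c i * act (restr E (f i)) z\<bar>)" by (rule sum_abs)
        also have "\<dots> \<le> (\<Sum>i\<in>I. c i * \<beta>)"
        proof (rule sum_mono)
          fix i assume i: "i \<in> I"
          then have "\<bar>act (restr E (f i)) z\<bar> \<le> \<beta>" "0 \<le> c i" using h E unfolding A_def by blast+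
          then show "\<bar>c i * act (restr E (f i)) z\<bar> \<le> c i * \<beta>" by (simp add: abs_mult mult_left_mono)
        qed
        also have "\<dots> = \<beta>" using h by (simp flip: sum_distrib_right)
        finally show ?thesis .
      qed
      then show "(\<lambda>n. \<Sum>i\<in>I. c i * f i n) \<in> A" using K unfolding A_def by blast
    qed
  qed
  then have "\<bar>act f z\<bar> \<le> \<beta>" if "f \<in> K" for f
    using that nat_interval_UNIV unfolding A_def by fastforce
  then show ?thesis by (intro N_le) (simp add: abs_le_iff)
qed

text \<open>The length \<open>P\<close> is fixed before \<open>k0\<close>. That one length works
  arbitrarily far out is what the infimum argument in \<open>no_l1_blocks\<close> needs.\<close>

lemma small_averages:
  assumes u: "\<And>k. u k \<in> c00" "\<And>k. N (u k) \<le> 1" "\<And>k l. k < l \<Longrightarrow> before (u k) (u l)"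
    and ge: "\<And>k n. n \<in> supp (u k) \<Longrightarrow> k \<le> n"
  shows "\<exists>P\<ge>1. \<forall>k0. \<exists>H\<subseteq>{k0..}. finite H \<and> card H = P \<and> N (\<lambda>n. \<Sum>k\<in>H. u k n) \<le> real P / 2"
proof -
  obtain r j0 J where r: "strict_mono r" and thin: "thin_blocks L \<xi> M1 M2 N1 \<sigma>1 \<sigma> \<Lambda> (u \<circ> r) J j0 (1/20)"
    using thinning[where u = u and \<eta> = "1/20", OF u ge] by auto
  interpret T: thin_blocks L \<xi> M1 M2 N1 \<sigma>1 \<sigma> \<Lambda> "u \<circ> r" J j0 "1/20" by (rule thin)
  \<comment> \<open>\<open>C\<close> collects the constants depending on \<open>j0\<close>. With
    \<open>20 \<le> t\<close>, \<open>20 * C \<le> t\<close> and \<open>\<eta> = 1/20\<close>, the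
    ground bound is at most \<open>3 * t + 3/20 * t^2\<close>, hence \<open>3/10 * t^2\<close>, and
    the l2 bound is at most \<open>t^2/10 + t^2/10 + t\<close>, hence \<open>t^2/4\<close>.\<close>
  define C where "C = (\<Sum>j\<in>{1..j0}. nseq (2 * j - 1)) + (\<Sum>j\<in>{1..j0}. nseq j)"
  define t where "t = 20 * C + 20"
  have t: "t > 0" "20 \<le> t" "C * 20 \<le> t" unfolding t_def by auto
  have tt: "t * 20 \<le> t\<^sup>2" unfolding power2_eq_square using t by (intro mult_left_mono) auto
  have nt: "nseq j \<le> t\<^sup>2" if "1 \<le> j" "j \<le> j0" for j
  proof -
    have "nseq j \<le> (\<Sum>j\<in>{1..j0}. nseq j)" by (rule member_le_sum) (use that in auto)
    moreover have "(\<Sum>j\<in>{1..j0}. nseq j) \<le> C" unfolding C_def by simp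
    ultimately show ?thesis using t tt by linarith
  qed
  have Ct: "(\<Sum>j\<in>{1..j0}. real (nseq (2 * j - 1))) \<le> t"
  proof -
    have "(\<Sum>j\<in>{1..j0}. nseq (2 * j - 1)) \<le> C" unfolding C_def by simp
    then have "(\<Sum>j\<in>{1..j0}. nseq (2 * j - 1)) \<le> t" using t by linarith
    then have "real (\<Sum>j\<in>{1..j0}. nseq (2 * j - 1)) \<le> real t" by (simp only: of_nat_le_iff)
    then show ?thesis by simp
  qed
  have tr: "20 \<le> real t" using t(2) by simp
  have ttr: "real t * 20 \<le> (real t)\<^sup>2" using tt by (metis of_nat_le_iff of_nat_mult of_nat_numeral of_nat_power)
  show ?thesis
  proof (intro exI[of _ "t\<^sup>2"] conjI allI)
    show "1 \<le> t\<^sup>2" using t by simp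
    fix k0
    obtain \<kappa> where \<kappa>: "T.sparse \<kappa>" "\<And>s. k0 \<le> \<kappa> s" using T.ex_sparse by blast
    have m: "strict_mono \<kappa>" using \<kappa> unfolding T.sparse_def by blast
    have mm: "strict_mono (r \<circ> \<kappa>)" by (rule strict_mono_o[OF r m])
    define H where "H = (r \<circ> \<kappa>) ` {..<t\<^sup>2}"
    have inj: "inj_on (r \<circ> \<kappa>) {..<t\<^sup>2}" using mm strict_mono_imp_inj_on inj_on_subset by blast
    define v where "v s = (u \<circ> r) (\<kappa> s)" for s
    let ?z = "\<lambda>n. \<Sum>s<t\<^sup>2. v s n"
    have v: "v s \<in> c00" "N (v s) \<le> 1" for s unfolding v_def using u by auto
    have z: "(\<lambda>n. \<Sum>k\<in>H. u k n) = ?z"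
      unfolding H_def v_def sum.reindex[OF inj] by (simp only: comp_def)
    have le: "\<bar>act f ?z\<bar> \<le> (\<Sum>s<t\<^sup>2. \<bar>act f (v s)\<bar>)" if "f \<in> c00" for f
      unfolding act_sum_right'[OF that] by (rule sum_abs)
    have "N ?z \<le> real (t\<^sup>2) / 2"
    proof (rule N_le_by_closure)
      show "?z \<in> c00" using c00_sum[of "{..<t\<^sup>2}" v "\<lambda>_. 1"] v by simp
      fix n
      have "\<bar>\<Sum>s<t\<^sup>2. v s n\<bar> \<le> (\<Sum>s<t\<^sup>2. \<bar>v s n\<bar>)" by (rule sum_abs)
      also have "\<dots> \<le> 1" unfolding v_def by (rule T.sum_abs_coord_le[OF m]) simp
      also have "\<dots> \<le> real (t\<^sup>2) / 2" using ttr tr by simp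
      finally show "\<bar>\<Sum>s<t\<^sup>2. v s n\<bar> \<le> real (t\<^sup>2) / 2" .
    next
      fix I a fs \<epsilon> E assume g: "ground_rep L \<xi> M1 \<sigma>1 I a fs \<epsilon> E"
      have "ground_fun I a fs \<epsilon> E \<in> c00"
        unfolding ground_fun_def
        by (rule c00_sum) (use g gpart_c00 gtriple_Useq in \<open>auto simp: ground_rep_def\<close>)
      from le[OF this] have "\<bar>act (ground_fun I a fs \<epsilon> E) ?z\<bar>
          \<le> (\<Sum>j\<in>{1..j0}. real (nseq (2 * j - 1))) + 2 * t + 3 * (1/20) * t\<^sup>2"
        using T.ground_estimate[OF g \<kappa>(1) t(1)] unfolding v_def by linarith
      then show "\<bar>act (ground_fun I a fs \<epsilon> E) ?z\<bar> \<le> real (t\<^sup>2) / 2"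
        using Ct ttr by simp
    next
      fix I :: "nat set" and j f and c :: "nat \<Rightarrow> real"
      assume h: "finite I" "\<And>i. i \<in> I \<Longrightarrow> isop (j i) (f i)" "inj_on j I" "(\<Sum>i\<in>I. (c i)\<^sup>2) \<le> 1"
      have fc: "f i \<in> c00" if "i \<in> I" for i using h(2)[OF that] K_c00 unfolding isop_def by blast
      have "(\<lambda>n. \<Sum>i\<in>I. c i * f i n) \<in> c00" by (rule c00_sum[OF h(1) fc])
      from le[OF this] have "\<bar>act (\<lambda>n. \<Sum>i\<in>I. c i * f i n) ?z\<bar>
          \<le> (\<Sum>s<t\<^sup>2. \<bar>act (\<lambda>n. \<Sum>i\<in>I. c i * f i n) (v s)\<bar>)" .
      also have "\<dots> \<le> (\<Sum>s<t\<^sup>2. \<Sum>i\<in>I. \<bar>c i * act (f i) (v s)\<bar>)"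
        by (rule sum_mono) (simp add: act_sum_left[OF h(1) fc] sum_abs)
      also have "\<dots> \<le> (real t)\<^sup>2 / 10 + 2 * (1/20) * (real t)\<^sup>2 + real t"
        using T.l2_sum_estimate[OF h m t(1) nt] unfolding v_def by simp
      finally show "\<bar>act (\<lambda>n. \<Sum>i\<in>I. c i * f i n) ?z\<bar> \<le> real (t\<^sup>2) / 2"
        using ttr by simp
    qed simp
    moreover have "H \<subseteq> {k0..}"
    proof
      fix k assume "k \<in> H"
      then obtain s where "k = r (\<kappa> s)" unfolding H_def by auto
      then show "k \<in> {k0..}" using \<kappa>(2)[of s] strict_mono_imp_increasing[OF r, of "\<kappa> s"] by simp
    qed
    moreover have "finite H" unfolding H_def by simp
    moreover have "card H = t\<^sup>2" unfolding H_def card_image[OF inj] by simp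
    ultimately show "\<exists>H\<subseteq>{k0..}. finite H \<and> card H = t\<^sup>2 \<and> N (\<lambda>n. \<Sum>k\<in>H. u k n) \<le> real (t\<^sup>2) / 2"
      unfolding z[symmetric] by blast
  qed
qed

end

section \<open>From spreading models to blocks\<close>

text \<open>\<open>nseq (2 * j)\<close> is a power with exponent \<open>sexp (2 * j - 1)\<close>,
  its base is at least \<open>2 ^ Q\<close> for large \<open>j\<close>, and
  \<open>2 ^ sexp (2 * j - 1) = mseq (2 * j) ^ 3\<close>. So it is at least
  \<open>mseq (2 * j) ^ (3 * Q)\<close>, and \<open>1 / q \<le> Q\<close> makes its
  \<open>q\<close>-th power at least \<open>mseq (2 * j) ^ 2\<close>.\<close>

lemma nseq_power_dominates:
  assumes q: "0 < (q::real)"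
  shows "\<exists>j\<ge>1. B * real (mseq (2 * j)) < real (nseq (2 * j)) powr q"
proof -
  obtain Q :: nat where Q: "1 / q \<le> real Q" using real_arch_simple by blast
  obtain b :: nat where b: "B < real b" using reals_Archimedean2 by blast
  \<comment> \<open>\<open>2 ^ Q\<close> makes the base of the power large enough, and
    \<open>b\<close> makes \<open>mseq (2 * j)\<close> exceed \<open>B\<close>.\<close>
  define j where "j = 2 ^ Q + b"
  have j1: "1 \<le> j" unfolding j_def by (simp add: trans_le_add1)
  obtain i where i: "2 * j = Suc (Suc i)" using j1 by (cases j) auto
  have nseq_ge: "k \<le> nseq k" if "1 \<le> k" for k
    using that
  proof (induction k rule: dec_induct)
    case (step k)
    then show ?case using nseq_less_Suc[of k] by simp
  qed simp
  have "z \<le> Suc i" if "2 * (z + b) = Suc (Suc i)" "1 \<le> z" for z :: nat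
    using that by presburger
  then have "2 ^ Q \<le> Suc i" by this (use i in \<open>simp_all only: j_def one_le_power one_le_numeral\<close>)
  also have "\<dots> \<le> 2 * nseq (Suc i)" using nseq_ge[of "Suc i"] by simp
  finally have "(2 ^ Q) ^ sexp (Suc i) \<le> nseq (2 * j)"
    unfolding i nseq.simps by (rule power_mono) simp
  also have "((2::nat) ^ Q) ^ sexp (Suc i) = (2 ^ sexp (Suc i)) ^ Q"
    by (simp only: power_mult[symmetric] mult.commute)
  also have "\<dots> = mseq (2 * j) ^ (3 * Q)" unfolding two_power_sexp i by (simp only: power_mult)
  finally have n: "mseq (2 * j) ^ (3 * Q) \<le> nseq (2 * j)" .
  have m1: "32 ^ (2 * j) \<le> mseq (2 * j)" using mseq_ge[of "2*j"] j1 by simp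
  have "b < 32 ^ (2 * j)"
  proof -
    have "b \<le> 2 * j" unfolding j_def by simp
    also have "\<dots> < 2 ^ (2 * j)" by simp
    also have "(2::nat) ^ (2 * j) \<le> 32 ^ (2 * j)" by (rule power_mono) auto
    finally show ?thesis .
  qed
  then have mb: "real b < real (mseq (2 * j))" using m1 by simp
  define m where "m = real (mseq (2 * j))"
  have mpos: "1 \<le> m" using mseq_pos[of "2*j"] j1 unfolding m_def by simp
  have "m powr 2 \<le> m powr (real (3 * Q) * q)"
  proof (rule powr_mono)
    have "1 \<le> real Q * q" using Q q by (simp add: field_simps)
    then show "2 \<le> real (3 * Q) * q" by simp
  qed (rule mpos)
  also have "\<dots> = (m ^ (3 * Q)) powr q"
    using mpos by (subst powr_realpow[symmetric]) (simp_all add: powr_powr)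
  also have "\<dots> \<le> real (nseq (2 * j)) powr q"
  proof (rule powr_mono2)
    have "real (mseq (2 * j) ^ (3 * Q)) \<le> real (nseq (2 * j))" using n by (simp only: of_nat_le_iff)
    then show "m ^ (3 * Q) \<le> real (nseq (2 * j))" unfolding m_def by simp
  qed (use q mpos in auto)
  finally have "m\<^sup>2 \<le> real (nseq (2 * j)) powr q" using mpos by simp
  moreover have "B * m < m\<^sup>2" unfolding power2_eq_square using b mb mpos m_def by (intro mult_strict_right_mono) auto
  ultimately show ?thesis using j1 unfolding m_def by (intro exI[of _ j]) linarith
qed

lemma before_hull:
  assumes "before x y" "a \<in> hull_interval (supp x)" "b \<in> hull_interval (supp y)"
  shows "a < b"
proof -
  obtain a' where "a' \<in> supp x" "a \<le> a'" using assms(2) unfolding hull_interval_def by blast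
  moreover obtain b' where "b' \<in> supp y" "b' \<le> b" using assms(3) unfolding hull_interval_def by blast
  ultimately show ?thesis using assms(1) unfolding before_def by fastforce
qed

section \<open>Lower estimates for blocks and James' argument\<close>

context attractor_space
begin

lemma N_scale_le: "x \<in> c00 \<Longrightarrow> N (\<lambda>n. c * x n) \<le> \<bar>c\<bar> * N x"
proof (rule N_le)
  fix f assume x: "x \<in> c00" and f: "f \<in> K"
  have "act f (\<lambda>n. c * x n) = c * act f x" by (rule act_scale_right[OF K_c00[OF f]])
  also have "\<dots> \<le> \<bar>c * act f x\<bar>" by simp
  also have "\<dots> = \<bar>c\<bar> * \<bar>act f x\<bar>" by (rule abs_mult)
  also have "\<dots> \<le> \<bar>c\<bar> * N x" by (rule mult_left_mono[OF abs_act_le_N[OF f x]]) simp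
  finally show "act f (\<lambda>n. c * x n) \<le> \<bar>c\<bar> * N x" .
qed

text \<open>Almost norming functionals are cut to the hulls of their blocks. They become successive
  and vanish on the other blocks, so an even operation can combine them.\<close>

lemma even_op_lower:
  fixes w :: "nat \<Rightarrow> nat \<Rightarrow> real"
  assumes F: "finite F" "F \<noteq> {}" "card F \<le> nseq (2 * j)" and j: "j \<ge> 1"
    and w: "\<And>k. k \<in> F \<Longrightarrow> w k \<in> c00" "\<And>k. k \<in> F \<Longrightarrow> c \<le> N (w k)"
    and bf: "\<And>k l. k \<in> F \<Longrightarrow> l \<in> F \<Longrightarrow> k < l \<Longrightarrow> before (w k) (w l)"
  shows "c * real (card F) / real (mseq (2 * j)) \<le> N (\<lambda>n. \<Sum>k\<in>F. w k n)"
proof -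
  define m where "m = real (mseq (2 * j))"
  have m: "m > 0" using mseq_pos[of "2*j"] j unfolding m_def by simp
  have z: "(\<lambda>n. \<Sum>k\<in>F. w k n) \<in> c00" using c00_sum[of F w "\<lambda>_. 1"] F w by simp
  \<comment> \<open>The supremum defining \<open>N\<close> need not be attained, so the estimate is
    shown for all \<open>c' < c\<close> and passed to \<open>c\<close> by
    \<open>dense_le\<close>.\<close>
  have "c' * real (card F) / m \<le> N (\<lambda>n. \<Sum>k\<in>F. w k n)" if c': "c' < c" for c'
  proof -
    have "\<forall>k\<in>F. \<exists>f\<in>K. c' < act f (w k)"
      using N_less_ex[OF w(1), of _ c'] w(2) c' by fastforce
    then obtain f where f: "\<And>k. k \<in> F \<Longrightarrow> f k \<in> K" "\<And>k. k \<in> F \<Longrightarrow> c' < act (f k) (w k)" by metis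
    define h where "h k = restr (hull_interval (supp (w k))) (f k)" for k
    have hK: "h k \<in> K" if "k \<in> F" for k unfolding h_def by (rule K_restr[OF f(1)[OF that] nat_interval_hull])
    have sh: "supp (h k) \<subseteq> hull_interval (supp (w k))" for k unfolding h_def supp_restr by blast
    have bh: "before (h k) (h l)" if "k \<in> F" "l \<in> F" "k < l" for k l
      unfolding before_def
    proof (intro ballI)
      fix a b assume "a \<in> supp (h k)" "b \<in> supp (h l)"
      then show "a < b" using before_hull[OF bf[OF that], of a b] sh by blast
    qed
    have diag: "act (h k) (w k) = act (f k) (w k)" if "k \<in> F" for k
      unfolding h_def act_restr[OF K_c00[OF f(1)[OF that]]] restr_hull_supp ..
    have off: "act (h k) (w l) = 0" if kl: "k \<in> F" "l \<in> F" "k \<noteq> l" for k l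
    proof (rule act_eq_0)
      have "n \<notin> supp (w l)" if n: "n \<in> supp (h k)" for n
      proof
        assume nl: "n \<in> supp (w l)"
        have "n \<in> hull_interval (supp (w k))" "n \<in> hull_interval (supp (w l))"
          using n nl sh hull_interval_superset by blast+
        then show False
          using kl before_hull[OF bf, of k l n n] before_hull[OF bf, of l k n n]
          by (cases k l rule: linorder_cases) auto
      qed
      then show "supp (h k) \<inter> supp (w l) = {}" by blast
    qed
    define xs where "xs = sorted_list_of_set F"
    have xs: "set xs = F" "distinct xs" "sorted_wrt (<) xs" "length xs = card F"
      unfolding xs_def using F(1) by auto
    define g where "g = (\<lambda>n. 1 / m * (\<Sum>i<length (map h xs). (map h xs ! i) n))"
    have "successive (map h xs)"
      unfolding successive_def sorted_wrt_map
      by (rule sorted_wrt_mono_rel[OF _ xs(3)]) (use bh xs(1) in auto)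
    then have "op_result K (nseq (2 * j)) (1 / m) g"
      unfolding op_result_def g_def using xs F hK by (intro exI[of _ "map h xs"]) auto
    then have gK: "g \<in> K" using K_even_op[OF j] unfolding m_def by blast
    have "(\<Sum>i<length (map h xs). (map h xs ! i) n) = (\<Sum>k\<in>F. h k n)" for n
      using sum.reindex_bij_betw[OF bij_betw_nth[OF xs(2) refl refl], of "\<lambda>k. h k n"] xs(1)
      by (simp add: atLeast0LessThan)
    then have ge: "g = (\<lambda>n. \<Sum>k\<in>F. (1 / m) * h k n)" unfolding g_def by (simp add: sum_distrib_left)
    have "act g (\<lambda>n. \<Sum>k\<in>F. w k n) = (\<Sum>k\<in>F. (1 / m) * act (h k) (\<lambda>n. \<Sum>l\<in>F. w l n))"
      unfolding ge by (rule act_sum_left) (use F hK K_c00 in auto)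
    also have "\<dots> = (\<Sum>k\<in>F. (1 / m) * act (f k) (w k))"
    proof (rule sum.cong)
      fix k assume k: "k \<in> F"
      have "act (h k) (\<lambda>n. \<Sum>l\<in>F. w l n) = (\<Sum>l\<in>F. act (h k) (w l))"
        by (rule act_sum_right'[OF K_c00[OF hK[OF k]]])
      also have "\<dots> = (\<Sum>l\<in>{k}. act (h k) (w l))"
        by (rule sum.mono_neutral_right) (use F k off in auto)
      finally show "(1 / m) * act (h k) (\<lambda>n. \<Sum>l\<in>F. w l n) = (1 / m) * act (f k) (w k)" using diag[OF k] by simp
    qed simp
    also have "\<dots> \<ge> (\<Sum>k\<in>F. (1 / m) * c')"
      by (intro sum_mono mult_left_mono) (use f(2) m in \<open>auto intro: less_imp_le\<close>)
    finally have "c' * real (card F) / m \<le> act g (\<lambda>n. \<Sum>k\<in>F. w k n)" by (simp add: mult.commute)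
    then show ?thesis using act_le_N[OF gK z] by linarith
  qed
  then have "c' \<le> N (\<lambda>n. \<Sum>k\<in>F. w k n) * m / real (card F)" if "c' < c" for c'
    using that m F by (simp add: field_simps card_gt_0_iff)
  then have "c \<le> N (\<lambda>n. \<Sum>k\<in>F. w k n) * m / real (card F)" by (rule dense_le)
  then show ?thesis using m F unfolding m_def[symmetric] by (simp add: field_simps card_gt_0_iff)
qed

text \<open>James' argument: averages of almost minimal norm, normalized, keep averages of norm
  close to \<open>1\<close>, which contradicts the existence of small averages.\<close>

lemma no_l1_blocks:
  fixes w :: "nat \<Rightarrow> nat \<Rightarrow> real"
  assumes w: "\<And>k. w k \<in> c00" "\<And>k. N (w k) \<le> B" "\<And>k l. k < l \<Longrightarrow> before (w k) (w l)"
    and ge: "\<And>k n. n \<in> supp (w k) \<Longrightarrow> k \<le> n" and c: "c > 0"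
    and low: "\<And>F. finite F \<Longrightarrow> F \<noteq> {} \<Longrightarrow> (\<And>k. k \<in> F \<Longrightarrow> 2 * card F \<le> k) \<Longrightarrow>
      c * real (card F) \<le> N (\<lambda>n. \<Sum>k\<in>F. w k n)"
  shows False
proof -
  define small where "small \<theta> M k0 F \<longleftrightarrow> F \<subseteq> {k0..} \<and> finite F \<and> card F = M
    \<and> N (\<lambda>n. \<Sum>k\<in>F. w k n) \<le> \<theta> * real M" for \<theta> M k0 F
  \<comment> \<open>Constants that averages of one fixed length achieve arbitrarily far out. The
    hypothesis \<open>low\<close> keeps their infimum \<open>\<alpha>\<close> positive.\<close>
  define \<Theta> where "\<Theta> = {\<theta>. \<exists>M\<ge>1. \<forall>k0. \<exists>F. small \<theta> M k0 F}"
  have "B \<in> \<Theta>" unfolding \<Theta>_def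
  proof (intro CollectI exI[of _ "1::nat"] conjI allI)
    fix k0
    show "\<exists>F. small B 1 k0 F"
      unfolding small_def by (rule exI[of _ "{k0}"]) (use w(2) in auto)
  qed simp
  have lb: "c \<le> \<theta>" if mem: "\<theta> \<in> \<Theta>" for \<theta>
  proof -
    obtain M where M: "M \<ge> 1" and *: "\<And>k0. \<exists>F. small \<theta> M k0 F" using mem unfolding \<Theta>_def by blast
    obtain F where F: "F \<subseteq> {2 * M..}" "finite F" "card F = M" "N (\<lambda>n. \<Sum>k\<in>F. w k n) \<le> \<theta> * real M"
      using *[of "2 * M"] unfolding small_def by blast
    have "c * real (card F) \<le> N (\<lambda>n. \<Sum>k\<in>F. w k n)" by (rule low) (use F M in auto)
    then have "c * real M \<le> \<theta> * real M" using F by simp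
    then show ?thesis using M by simp
  qed
  define \<alpha> where "\<alpha> = Inf \<Theta>"
  have bdd: "bdd_below \<Theta>" using lb by (rule bdd_belowI)
  have \<alpha>: "c \<le> \<alpha>" unfolding \<alpha>_def using \<open>B \<in> \<Theta>\<close> lb by (intro cInf_greatest) auto
  \<comment> \<open>Small averages gain a factor \<open>1/2\<close>. Starting within a factor
    \<open>5/4\<close> of the infimum leads to \<open>5/8 * \<alpha>\<close>, below the value
    \<open>3/4 * \<alpha>\<close>, which cannot belong to \<open>\<Theta>\<close>.\<close>
  then have "\<alpha> < 5/4 * \<alpha>" using c by simp
  then obtain \<theta> where \<theta>: "\<theta> \<in> \<Theta>" "\<theta> < 5/4 * \<alpha>" using cInf_lessD[of \<Theta> "5/4 * \<alpha>"] \<open>B \<in> \<Theta>\<close> unfolding \<alpha>_def by blast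
  have \<theta>0: "\<theta> > 0" using lb[OF \<theta>(1)] c by linarith
  obtain M where M: "M \<ge> 1" and exF: "\<And>k0. \<exists>F. small \<theta> M k0 F" using \<theta>(1) unfolding \<Theta>_def by blast
  obtain S where "\<And>k0. small \<theta> M k0 (S k0)" using exF by metis
  then have S: "S k0 \<subseteq> {k0..}" "finite (S k0)" "card (S k0) = M"
    "N (\<lambda>n. \<Sum>k\<in>S k0. w k n) \<le> \<theta> * real M" for k0
    unfolding small_def by blast+
  \<comment> \<open>Each averaging set starts beyond the last element of the previous one, so that
    the averages are successive.\<close>
  define ks where "ks = rec_nat (0::nat) (\<lambda>_ k. Suc (Max (insert k (S k))))"
  have ks: "ks (Suc n) = Suc (Max (insert (ks n) (S (ks n))))" for n unfolding ks_def by simp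
  define G where "G n = S (ks n)" for n
  have kk: "ks n < ks (Suc n)" for n unfolding ks using S(2)[of "ks n"] by (simp add: less_Suc_eq_le)
  have mono: "strict_mono ks" using kk by (simp add: strict_mono_Suc_iff)
  have G1: "ks n \<le> k" "k < ks (Suc n)" if "k \<in> G n" for n k
    using S(1)[of "ks n"] S(2)[of "ks n"] that unfolding G_def ks by (auto simp: less_Suc_eq_le)
  have Gn: "n \<le> k" if "k \<in> G n" for n k
    using G1(1)[OF that] strict_mono_imp_increasing[OF mono, of n] by linarith
  have Gless: "k < l" if "n < n'" "k \<in> G n" "l \<in> G n'" for n n' k l
  proof -
    have "ks (Suc n) \<le> ks n'" using mono that(1) by (simp add: Suc_leI strict_mono_less_eq)
    then show ?thesis using G1(2)[OF that(2)] G1(1)[OF that(3)] by linarith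
  qed
  \<comment> \<open>Division by the common bound \<open>\<theta> * real M\<close>, and not by the
    individual norms, keeps every sum of the \<open>u n\<close> a multiple of a plain sum of the
    \<open>w k\<close>.\<close>
  define u where "u n = (\<lambda>m. 1 / (\<theta> * real M) * (\<Sum>k\<in>G n. w k m))" for n
  have zc: "(\<lambda>m. \<Sum>k\<in>F. w k m) \<in> c00" if "finite F" for F using c00_sum[OF that, of w "\<lambda>_. 1"] w(1) by simp
  have finG: "finite (G n)" for n unfolding G_def by (rule S(2))
  have tM: "\<theta> * real M > 0" using \<theta>0 M by simp
  have uc: "u n \<in> c00" for n unfolding u_def by (rule c00_scale[OF zc[OF finG]])
  have uN: "N (u n) \<le> 1" for n
  proof -
    have "N (u n) \<le> \<bar>1 / (\<theta> * real M)\<bar> * N (\<lambda>m. \<Sum>k\<in>G n. w k m)"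
      unfolding u_def by (rule N_scale_le[OF zc[OF finG]])
    also have "\<dots> \<le> \<bar>1 / (\<theta> * real M)\<bar> * (\<theta> * real M)"
      unfolding G_def by (rule mult_left_mono[OF S(4)]) simp
    also have "\<dots> = 1" using \<theta>0 M by simp
    finally show ?thesis .
  qed
  have us: "\<exists>k\<in>G n. m \<in> supp (w k)" if "m \<in> supp (u n)" for n m
  proof (rule ccontr)
    assume "\<not> ?thesis"
    then have "u n m = 0" unfolding u_def supp_def by (simp add: sum.neutral)
    then show False using that by (simp add: supp_def)
  qed
  have ub: "before (u n) (u n')" if "n < n'" for n n'
    unfolding before_def
  proof (intro ballI)
    fix a b assume "a \<in> supp (u n)" "b \<in> supp (u n')"
    then obtain k l where "k \<in> G n" "a \<in> supp (w k)" "l \<in> G n'" "b \<in> supp (w l)" using us by blast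
    then show "a < b" using w(3)[OF Gless[OF that, of k l]] unfolding before_def by blast
  qed
  have uge: "n \<le> m" if mn: "m \<in> supp (u n)" for n m
  proof -
    obtain k where "k \<in> G n" "m \<in> supp (w k)" using us[OF mn] by blast
    then show ?thesis using Gn ge order_trans by blast
  qed
  define smallu where "smallu P k0 H \<longleftrightarrow> H \<subseteq> {k0..} \<and> finite H \<and> card H = P
    \<and> N (\<lambda>n. \<Sum>k\<in>H. u k n) \<le> real P / 2" for P k0 H
  have "\<exists>P\<ge>1. \<forall>k0. \<exists>H. smallu P k0 H"
    unfolding smallu_def by (rule small_averages) (fact uc, fact uN, erule ub, erule uge)
  then obtain P where P: "P \<ge> 1" and exH: "\<And>k0. \<exists>H. smallu P k0 H" by blast
  have "3/4 * \<alpha> \<notin> \<Theta>"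
  proof
    assume "3/4 * \<alpha> \<in> \<Theta>"
    then have "\<alpha> \<le> 3/4 * \<alpha>" unfolding \<alpha>_def using bdd by (rule cInf_lower)
    then show False using \<alpha> c by simp
  qed
  moreover have "M * P \<ge> 1" using M P by simp
  ultimately obtain k0 where k0: "\<And>F. \<not> small (3/4 * \<alpha>) (M * P) k0 F" unfolding \<Theta>_def by blast
  obtain H where H: "H \<subseteq> {k0..}" "finite H" "card H = P" "N (\<lambda>n. \<Sum>k\<in>H. u k n) \<le> real P / 2"
    using exH[of k0] unfolding smallu_def by blast
  define F where "F = (\<Union>n\<in>H. G n)"
  have disj: "G n \<inter> G n' = {}" if "n \<noteq> n'" for n n'
    using that Gless[of n n'] Gless[of n' n] by (cases n n' rule: linorder_cases) auto
  have cF: "card F = M * P"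
    unfolding F_def using H(2,3) finG disj by (subst card_UN_disjoint) (auto simp: G_def S(3) mult.commute)
  have sF: "(\<lambda>m. \<Sum>k\<in>F. w k m) = (\<lambda>m. (\<theta> * real M) * (\<Sum>n\<in>H. u n m))"
  proof
    fix m
    have "(\<Sum>k\<in>F. w k m) = (\<Sum>n\<in>H. \<Sum>k\<in>G n. w k m)"
      unfolding F_def by (rule sum.UNION_disjoint) (use H finG disj in auto)
    also have "\<dots> = (\<Sum>n\<in>H. (\<theta> * real M) * u n m)" unfolding u_def using \<theta>0 M by simp
    finally show "(\<Sum>k\<in>F. w k m) = (\<theta> * real M) * (\<Sum>n\<in>H. u n m)" by (simp add: sum_distrib_left)
  qed
  have "(\<lambda>m. \<Sum>n\<in>H. u n m) \<in> c00" using c00_sum[OF H(2), of u "\<lambda>_. 1"] uc by simp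
  then have "N (\<lambda>m. \<Sum>k\<in>F. w k m) \<le> \<bar>\<theta> * real M\<bar> * N (\<lambda>m. \<Sum>n\<in>H. u n m)"
    unfolding sF by (rule N_scale_le)
  also have "\<dots> \<le> (\<theta> * real M) * (real P / 2)"
    unfolding abs_of_pos[OF tM] by (rule mult_left_mono[OF H(4) less_imp_le[OF tM]])
  also have "\<dots> \<le> (5/4 * \<alpha> * real M) * (real P / 2)"
    using \<theta>(2) by (intro mult_right_mono) auto
  also have "\<dots> = 5/8 * (\<alpha> * real (M * P))" by simp
  also have "\<dots> \<le> 3/4 * (\<alpha> * real (M * P))"
    by (rule mult_right_mono) (use \<alpha> c in auto)
  finally have "N (\<lambda>m. \<Sum>k\<in>F. w k m) \<le> 3/4 * \<alpha> * real (M * P)" by (simp only: mult.assoc)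
  moreover have "F \<subseteq> {k0..}"
  proof
    fix k assume "k \<in> F"
    then obtain n where "n \<in> H" "k \<in> G n" unfolding F_def by blast
    then show "k \<in> {k0..}" using H(1) Gn[of k n] by auto
  qed
  moreover have "finite F" unfolding F_def using H finG by blast
  ultimately show False using k0[of F] cF unfolding small_def by blast
qed

end

text \<open>Rounding the coordinates up to \<open>m\<close> to multiples of \<open>\<delta>\<close>
  leaves finitely many patterns, so two late members share one.\<close>

lemma pigeonhole_close:
  fixes v :: "nat \<Rightarrow> nat \<Rightarrow> real"
  assumes v: "\<And>i n. \<bar>v i n\<bar> \<le> R" and \<delta>: "\<delta> > 0"
  shows "\<exists>p q. k < p \<and> p < q \<and> (\<forall>n\<le>m. \<bar>v p n - v q n\<bar> \<le> \<delta>)"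
proof -
  define g where "g i = (\<lambda>n. if n \<le> m then \<lfloor>v i n / \<delta>\<rfloor> else 0)" for i
  have "g i \<in> {f. \<forall>n. (n \<in> {..m} \<longrightarrow> f n \<in> {\<lfloor>- R / \<delta>\<rfloor>..\<lfloor>R / \<delta>\<rfloor>}) \<and> (n \<notin> {..m} \<longrightarrow> f n = 0)}" for i
  proof -
    have "- R / \<delta> \<le> v i n / \<delta>" "v i n / \<delta> \<le> R / \<delta>" for n
      using v[of i n] \<delta> divide_right_mono[of "- R" "v i n" \<delta>] divide_right_mono[of "v i n" R \<delta>]
      by (auto simp: abs_le_iff)
    then show ?thesis unfolding g_def by (auto intro: floor_mono)
  qed
  then have "finite (g ` {k<..})"
    by (intro finite_subset[OF _ finite_set_of_finite_funs[of "{..m}" "{\<lfloor>- R / \<delta>\<rfloor>..\<lfloor>R / \<delta>\<rfloor>}" 0]]) blast+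
  moreover have "infinite {k<..}" by (rule infinite_Ioi)
  ultimately obtain i0 where "infinite {i\<in>{k<..}. g i = g i0}" using pigeonhole_infinite by blast
  then obtain p where p: "k < p" "g p = g i0" and inf: "infinite {i\<in>{k<..}. g i = g i0}"
    using infinite_imp_nonempty by blast
  obtain q where q: "p < q" "g q = g i0" using inf unfolding infinite_nat_iff_unbounded by blast
  have "\<bar>v p n - v q n\<bar> \<le> \<delta>" if "n \<le> m" for n
  proof -
    have "\<lfloor>v p n / \<delta>\<rfloor> = \<lfloor>v q n / \<delta>\<rfloor>" using p q that unfolding g_def by (metis (mono_tags, lifting))
    then have "\<bar>v p n / \<delta> - v q n / \<delta>\<bar> \<le> 1" by linarith
    then have "\<bar>(v p n - v q n) / \<delta>\<bar> \<le> 1" by (simp add: diff_divide_distrib)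
    then show ?thesis using \<delta> by (simp add: abs_divide field_simps)
  qed
  then show ?thesis using p q by blast
qed

lemma c00_diff: "x \<in> c00 \<Longrightarrow> y \<in> c00 \<Longrightarrow> (\<lambda>n. x n - y n) \<in> c00"
  using c00_sum[of "{0::nat, 1}" "\<lambda>i. if i = 0 then x else y" "\<lambda>i. if i = 0 then 1 else -1"] by simp

section \<open>Differences close to blocks in the completion\<close>

locale attractor_completion = attractor_space L \<xi> M1 M2 N1 \<sigma>1 \<sigma> \<Lambda>
  for L :: "omega1 \<Rightarrow> nat \<Rightarrow> omega1" and \<xi> :: omega1 and M1 M2 N1 :: "nat set"
    and \<sigma>1 \<sigma> :: "(nat \<Rightarrow> real) list \<Rightarrow> nat" and \<Lambda> :: "nat \<Rightarrow> nat set" +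
  fixes T :: "(nat \<Rightarrow> real) \<Rightarrow> 'a::banach" and X :: "'a set"
  assumes completion: "is_completion N T X"
begin

lemma T_add: "x \<in> c00 \<Longrightarrow> y \<in> c00 \<Longrightarrow> T (\<lambda>n. x n + y n) = T x + T y"
  and T_scale: "x \<in> c00 \<Longrightarrow> T (\<lambda>n. c * x n) = c *\<^sub>R T x"
  and T_norm: "x \<in> c00 \<Longrightarrow> norm (T x) = N x"
  and X_closure: "X = closure (T ` c00)"
  using completion unfolding is_completion_def by blast+

lemma T_diff: "x \<in> c00 \<Longrightarrow> y \<in> c00 \<Longrightarrow> T (\<lambda>n. x n - y n) = T x - T y"
  using T_add[of x "\<lambda>n. -1 * y n"] T_scale[of y "-1"] c00_scale[of y "-1"] by simp

lemma T_sum: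
  assumes "finite F" "\<And>k. k \<in> F \<Longrightarrow> w k \<in> c00"
  shows "T (\<lambda>n. \<Sum>k\<in>F. w k n) = (\<Sum>k\<in>F. T (w k))"
  using assms
proof (induction F rule: finite_induct)
  case empty
  have "(\<lambda>_. 0) \<in> c00" by (simp add: c00_def supp_def)
  then show ?case using T_scale[of "\<lambda>_. 0" 0] by simp
next
  case (insert k F)
  have "(\<lambda>n. \<Sum>k\<in>F. w k n) \<in> c00" using c00_sum[of F w "\<lambda>_. 1"] insert by simp
  then show ?case using insert T_add[of "w k" "\<lambda>n. \<Sum>k\<in>F. w k n"] by simp
qed

text \<open>Finitely supported approximants that nearly agree up to \<open>m\<close> have a
  difference whose part up to \<open>m\<close> is small in l1 and can be cut off.\<close>

lemma block_step:
  fixes x :: "nat \<Rightarrow> 'a"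
  assumes X: "\<forall>i\<ge>1. x i \<in> X \<and> norm (x i) = 1" and e: "e > 0"
  shows "\<exists>p q w m'. k < p \<and> p < q \<and> m < m' \<and> w \<in> c00 \<and> supp w \<subseteq> {m<..m'} \<and> norm (T w - (x p - x q)) \<le> e"
proof -
  note x = X[rule_format]
  \<comment> \<open>Three errors of size \<open>e'\<close> add up: two approximations and the part
    cut off. The cap 1 keeps the coordinates of the approximants below 2.\<close>
  define e' where "e' = min (e / 3) 1"
  have e': "e' > 0" "e' \<le> 1" "3 * e' \<le> e" unfolding e'_def using e by auto
  have "\<exists>v\<in>c00. norm (T v - x (Suc i)) < e'" for i
  proof -
    have "x (Suc i) \<in> closure (T ` c00)" using x[of "Suc i"] X_closure by simp
    then obtain y where "y \<in> T ` c00" "dist y (x (Suc i)) < e'" using e'(1) unfolding closure_approachable by blast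
    then show ?thesis by (auto simp: dist_norm)
  qed
  then obtain v where v: "\<And>i. v i \<in> c00" "\<And>i. norm (T (v i) - x (Suc i)) < e'" by metis
  have "\<bar>v i n\<bar> \<le> 2" for i n
  proof -
    have "\<bar>v i n\<bar> \<le> norm (T (v i))" using coord_le_N[OF v(1)] T_norm[OF v(1)] by simp
    also have "\<dots> \<le> norm (T (v i) - x (Suc i)) + norm (x (Suc i))"
      using norm_triangle_sub[of "T (v i)" "x (Suc i)"] by simp
    also have "\<dots> \<le> 2" using v(2)[of i] e' x[of "Suc i"] by simp
    finally show ?thesis .
  qed
  \<comment> \<open>There are \<open>Suc m\<close> coordinates up to \<open>m\<close>, so this
    closeness bounds the l1 norm of the discarded part by \<open>e'\<close>.\<close>
  moreover have "e' / real (Suc m) > 0" using e' by simp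
  ultimately obtain p q where pq: "k < p" "p < q" and cl: "\<forall>n\<le>m. \<bar>v p n - v q n\<bar> \<le> e' / real (Suc m)"
    using pigeonhole_close[of v 2 "e' / real (Suc m)" k m] by blast
  define d where "d = (\<lambda>n. v p n - v q n)"
  have d: "d \<in> c00" unfolding d_def by (rule c00_diff[OF v(1) v(1)])
  obtain m0 where m0: "supp d \<subseteq> {..<m0}" using supp_c00[OF d] finite_nat_iff_bounded by blast
  define m' where "m' = max m0 (Suc m)"
  define w where "w = restr {m<..m'} d"
  define y where "y = restr {..m} d"
  have w: "w \<in> c00" and y: "y \<in> c00" unfolding w_def y_def by (rule c00_restr[OF d])+
  have "d n = w n + y n" for n
    using m0 unfolding w_def y_def restr_def m'_def supp_def by (auto simp: not_le)
  then have wd: "w = (\<lambda>n. d n - y n)" by (simp add: fun_eq_iff)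
  have "l1 y \<le> (\<Sum>n\<in>{..m}. \<bar>y n\<bar>)"
    unfolding l1_def by (rule sum_mono2) (auto simp: y_def supp_restr)
  also have "\<dots> \<le> (\<Sum>n\<in>{..m}. e' / real (Suc m))"
    by (rule sum_mono) (use cl in \<open>auto simp: y_def restr_def d_def\<close>)
  also have "\<dots> = e'" by simp
  finally have Ny: "norm (T y) \<le> e'" using N_le_l1[OF y] T_norm[OF y] by simp
  have "T w - (x (Suc p) - x (Suc q)) = (T (v p) - x (Suc p)) - (T (v q) - x (Suc q)) - T y"
    unfolding wd T_diff[OF d y] unfolding d_def T_diff[OF v(1) v(1)] by simp
  also have "norm \<dots> \<le> norm (T (v p) - x (Suc p)) + norm (T (v q) - x (Suc q)) + norm (T y)"
    by (intro norm_triangle_le_diff[THEN order_trans] add_right_mono norm_triangle_ineq4 order_refl)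
      (auto intro: norm_triangle_ineq4)
  also have "\<dots> \<le> e" using v(2)[of p] v(2)[of q] Ny e'(3) by linarith
  finally have "norm (T w - (x (Suc p) - x (Suc q))) \<le> e" .
  moreover have "m < m'" unfolding m'_def by simp
  moreover have "supp w \<subseteq> {m<..m'}" unfolding w_def supp_restr by blast
  ultimately show ?thesis using pq w
    by (intro exI[of _ "Suc p"] exI[of _ "Suc q"] exI[of _ w] exI[of _ m']) auto
qed

text \<open>The errors are summable, so one bound covers sums over all finite sets of blocks. The
  positions increase strictly, so distinct differences involve distinct members of the
  sequence.\<close>

lemma block_differences:
  fixes x :: "nat \<Rightarrow> 'a"
  assumes x: "\<forall>i\<ge>1. x i \<in> X \<and> norm (x i) = 1" and \<eta>: "\<eta> > 0"
  obtains p q :: "nat \<Rightarrow> nat" and w :: "nat \<Rightarrow> nat \<Rightarrow> real"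
  where "\<And>i. i < p i" "\<And>i. p i < q i" "\<And>i. q i < p (Suc i)" "\<And>i. w i \<in> c00"
    "\<And>i j. i < j \<Longrightarrow> before (w i) (w j)" "\<And>i n. n \<in> supp (w i) \<Longrightarrow> i \<le> n"
    "\<And>i. norm (T (w i) - (x (p i) - x (q i))) \<le> \<eta> * (1/2) ^ i"
proof -
  define Pr where "Pr i s \<longleftrightarrow> (case s of (p, q, w, m) \<Rightarrow> i < p \<and> p < q \<and> i \<le> m \<and> w \<in> c00 \<and> supp w \<subseteq> {i..m}
    \<and> norm (T w - (x p - x q)) \<le> \<eta> * (1/2) ^ i)" for i and s :: "nat \<times> nat \<times> (nat \<Rightarrow> real) \<times> nat"
  define Qr where "Qr s s' \<longleftrightarrow> (case s of (p, q, w, m) \<Rightarrow> case s' of (p', q', w', m') \<Rightarrow>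
    q < p' \<and> m \<le> m' \<and> supp w' \<subseteq> {m<..m'})" for s s' :: "nat \<times> nat \<times> (nat \<Rightarrow> real) \<times> nat"
  have "\<exists>F. \<forall>i. Pr i (F i) \<and> Qr (F i) (F (Suc i))"
  proof (rule dependent_nat_choice)
    obtain p q w m' where "0 < p" "p < q" "0 < m'" "w \<in> c00" "supp w \<subseteq> {0<..m'}" "norm (T w - (x p - x q)) \<le> \<eta>"
      using block_step[OF x \<eta>, of 0 0] by blast
    then show "\<exists>s. Pr 0 s" unfolding Pr_def by (intro exI[of _ "(p, q, w, m')"]) auto
    fix s i assume "Pr i s"
    then obtain p q w m where s: "s = (p, q, w, m)" "i < p" "p < q" "i \<le> m" unfolding Pr_def by (cases s) auto
    have pos: "\<eta> * (1/2) ^ Suc i > 0" using \<eta> by simp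
    obtain p' q' w' m' where n: "q < p'" "p' < q'" "m < m'" "w' \<in> c00" "supp w' \<subseteq> {m<..m'}"
      "norm (T w' - (x p' - x q')) \<le> \<eta> * (1/2) ^ Suc i"
      using block_step[OF x pos, of q m] by blast
    have "Pr (Suc i) (p', q', w', m')" unfolding Pr_def using n s by fastforce
    moreover have "Qr s (p', q', w', m')" unfolding Qr_def s(1) using n by auto
    ultimately show "\<exists>s'. Pr (Suc i) s' \<and> Qr s s'" by blast
  qed
  then obtain F where F: "\<And>i. Pr i (F i)" "\<And>i. Qr (F i) (F (Suc i))" by blast
  define p where "p i = fst (F i)" for i
  define q where "q i = fst (snd (F i))" for i
  define w where "w i = fst (snd (snd (F i)))" for i
  define m where "m i = snd (snd (snd (F i)))" for i
  have Fi: "F i = (p i, q i, w i, m i)" for i unfolding p_def q_def w_def m_def by simp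
  have P: "i < p i" "p i < q i" "i \<le> m i" "w i \<in> c00" "supp (w i) \<subseteq> {i..m i}"
    "norm (T (w i) - (x (p i) - x (q i))) \<le> \<eta> * (1/2) ^ i" for i
    using F(1)[of i] unfolding Pr_def Fi by auto
  have Q: "q i < p (Suc i)" "m i \<le> m (Suc i)" "supp (w (Suc i)) \<subseteq> {m i<..m (Suc i)}" for i
    using F(2)[of i] unfolding Qr_def Fi by auto
  have mm: "m i \<le> m j" if "i \<le> j" for i j using Q(2) that by (rule lift_Suc_mono_le)
  have "before (w i) (w j)" if ij: "i < j" for i j
    unfolding before_def
  proof (intro ballI)
    fix a b assume ab: "a \<in> supp (w i)" "b \<in> supp (w j)"
    obtain j' where j': "j = Suc j'" "i \<le> j'" using ij by (cases j) auto
    have "a \<le> m i" using P(5)[of i] ab(1) by auto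
    also have "\<dots> \<le> m j'" by (rule mm[OF j'(2)])
    also have "\<dots> < b" using Q(3)[of j'] ab(2) j'(1) by auto
    finally show "a < b" .
  qed
  moreover have "i \<le> n" if "n \<in> supp (w i)" for i n using P(5)[of i] that by auto
  ultimately show thesis using that[of p q w] P Q by blast
qed

lemma no_spreading_model:
  assumes NF: "\<And>F a. finite F \<Longrightarrow> F \<noteq> {} \<Longrightarrow> (\<And>i. i \<in> F \<Longrightarrow> \<bar>a i\<bar> = 1) \<Longrightarrow> NF F a = real (card F) powr \<rho>"
    and \<rho>: "0 \<le> \<rho>" "\<rho> \<le> 1"
  shows "\<not> admits_spreading_model X NF"
proof
  assume "admits_spreading_model X NF"
  then obtain x C where xX: "\<forall>i\<ge>1. x i \<in> X \<and> norm (x i) = 1" and C: "C \<ge> 1"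
    and eq: "\<And>F. F \<in> schreier1 \<Longrightarrow> equiv_on C NF x F" unfolding admits_spreading_model_def by metis
  note x = xX[rule_format]
  \<comment> \<open>The total error is at most \<open>2 * \<eta> = 1 / (2 * C)\<close>, half of the
    lower bound \<open>1 / C\<close>. Hence the blocks keep the lower estimate with
    \<open>2 * C\<close> in place of \<open>C\<close>.\<close>
  define \<eta> where "\<eta> = 1 / (4 * C)"
  have \<eta>: "\<eta> > 0" "\<eta> \<le> 1" unfolding \<eta>_def using C by (auto simp: divide_le_eq)
  obtain p q w where pq: "\<And>i::nat. i < p i" "\<And>i. p i < q i" "\<And>i. q i < p (Suc i)" and w: "\<And>i. w i \<in> c00"
    and bf: "\<And>i j. i < j \<Longrightarrow> before (w i) (w j)" and ge: "\<And>i n. n \<in> supp (w i) \<Longrightarrow> i \<le> n"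
    and err: "\<And>i. norm (T (w i) - (x (p i) - x (q i))) \<le> \<eta> * (1/2) ^ i"
    by (rule block_differences[OF xX \<eta>(1)]) (rule that)
  have qp: "q i < p j" if ij: "i < j" for i j
  proof -
    obtain j' where j': "j = Suc j'" "i \<le> j'" using ij by (cases j) auto
    have "q k \<le> q (Suc k)" for k using pq(2)[of "Suc k"] pq(3)[of k] by linarith
    then have "q i \<le> q j'" using j'(2) by (rule lift_Suc_mono_le)
    then show ?thesis using pq(3)[of j'] j'(1) by simp
  qed
  have p_inj: "inj_on p F" for F
    by (rule inj_onI) (metis linorder_neqE_nat less_trans order_less_irrefl pq(2) qp)
  have q_inj: "inj_on q F" for F
    by (rule inj_onI) (metis linorder_neqE_nat less_trans order_less_irrefl pq(2) qp)
  have pq_dis: "p i \<noteq> q j" for i j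
    by (metis linorder_neqE_nat less_trans order_less_irrefl pq(2) qp)
  have close: "\<bar>N (\<lambda>n. \<Sum>k\<in>F. w k n) - norm (\<Sum>k\<in>F. x (p k) - x (q k))\<bar> \<le> 1 / (2 * C)"
    if F: "finite F" for F
  proof -
    have zc: "(\<lambda>n. \<Sum>k\<in>F. w k n) \<in> c00" using c00_sum[OF F, of w "\<lambda>_. 1"] w by simp
    have "\<bar>norm (\<Sum>k\<in>F. T (w k)) - norm (\<Sum>k\<in>F. x (p k) - x (q k))\<bar>
        \<le> norm ((\<Sum>k\<in>F. T (w k)) - (\<Sum>k\<in>F. x (p k) - x (q k)))" by (rule norm_triangle_ineq3)
    also have "\<dots> = norm (\<Sum>k\<in>F. T (w k) - (x (p k) - x (q k)))" by (simp only: sum_subtractf)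
    also have "\<dots> \<le> (\<Sum>k\<in>F. \<eta> * (1/2) ^ k)" by (rule sum_norm_le) (rule err)
    also have "\<dots> \<le> 2 * \<eta>"
    proof -
      have "(\<Sum>k\<in>F. (1/2::real) ^ k) \<le> (\<Sum>k. (1/2) ^ k)"
        by (rule sum_le_suminf) (use F in \<open>auto intro: summable_geometric\<close>)
      also have "\<dots> = 2" by (subst suminf_geometric) auto
      finally show ?thesis using \<eta>(1) by (simp flip: sum_distrib_left)
    qed
    also have "\<dots> = 1 / (2 * C)" unfolding \<eta>_def by simp
    finally show ?thesis using T_norm[OF zc] T_sum[OF F w] by simp
  qed
  \<comment> \<open>Each block uses two members of the sequence, so \<open>card F\<close> blocks
    involve \<open>2 * card F\<close> indices. These exceed the block numbers, and the condition on
    \<open>F\<close> gives the Schreier condition.\<close>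
  have est: "(2 * real (card F)) powr \<rho> / (2 * C) \<le> N (\<lambda>n. \<Sum>k\<in>F. w k n) \<and>
      N (\<lambda>n. \<Sum>k\<in>F. w k n) \<le> 2 * C * (2 * real (card F)) powr \<rho>"
    if F: "finite F" "F \<noteq> {}" "\<And>k. k \<in> F \<Longrightarrow> 2 * card F \<le> k" for F
  proof -
    define F' where "F' = p ` F \<union> q ` F"
    define a :: "nat \<Rightarrow> real" where "a i = (if i \<in> p ` F then 1 else - 1)" for i
    have dis: "p ` F \<inter> q ` F = {}" using pq_dis by auto
    have F': "finite F'" "F' \<noteq> {}" unfolding F'_def using F by auto
    have card: "card F' = 2 * card F"
      unfolding F'_def using F(1) dis by (simp add: card_Un_disjoint card_image[OF p_inj] card_image[OF q_inj])
    have "card F' \<le> i" if i: "i \<in> F'" for i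
    proof -
      obtain k where "k \<in> F" "i = p k \<or> i = q k" using i unfolding F'_def by blast
      then show ?thesis using F(3)[of k] pq(1)[of k] pq(2)[of k] card by auto
    qed
    then have "F' \<in> schreier1" unfolding schreier1_def using F' by simp
    then have e: "NF F' a / C \<le> norm (\<Sum>i\<in>F'. a i *\<^sub>R x i)" "norm (\<Sum>i\<in>F'. a i *\<^sub>R x i) \<le> C * NF F' a"
      using eq unfolding equiv_on_def by blast+
    have NFa: "NF F' a = (2 * real (card F)) powr \<rho>"
      using NF[OF F', of a] card unfolding a_def by simp
    have "(\<Sum>i\<in>F'. a i *\<^sub>R x i) = (\<Sum>i\<in>p ` F. a i *\<^sub>R x i) + (\<Sum>i\<in>q ` F. a i *\<^sub>R x i)"
      unfolding F'_def by (rule sum.union_disjoint) (use F dis in auto)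
    also have "(\<Sum>i\<in>p ` F. a i *\<^sub>R x i) = (\<Sum>k\<in>F. x (p k))"
      by (simp add: sum.reindex[OF p_inj] a_def)
    also have "(\<Sum>i\<in>q ` F. a i *\<^sub>R x i) = (\<Sum>k\<in>F. - x (q k))"
      unfolding sum.reindex[OF q_inj] by (rule sum.cong) (use dis in \<open>auto simp: a_def\<close>)
    also have "(\<Sum>k\<in>F. x (p k)) + (\<Sum>k\<in>F. - x (q k)) = (\<Sum>k\<in>F. x (p k) - x (q k))"
      by (simp add: sum_subtractf sum_negf)
    finally have s: "(\<Sum>i\<in>F'. a i *\<^sub>R x i) = (\<Sum>k\<in>F. x (p k) - x (q k))" .
    define r where "r = (2 * real (card F)) powr \<rho>"
    have "1 \<le> real (card F)" using F by (simp add: Suc_leI card_gt_0_iff)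
    then have r1: "1 \<le> r" unfolding r_def using \<rho>(1) by (intro ge_one_powr_ge_zero) auto
    have c: "\<bar>N (\<lambda>n. \<Sum>k\<in>F. w k n) - norm (\<Sum>k\<in>F. x (p k) - x (q k))\<bar> \<le> 1 / (2 * C)" by (rule close[OF F(1)])
    have e': "r / C \<le> norm (\<Sum>k\<in>F. x (p k) - x (q k))" "norm (\<Sum>k\<in>F. x (p k) - x (q k)) \<le> C * r"
      using e unfolding s NFa r_def by auto
    have "1 / (2 * C) \<le> r / (2 * C)" using r1 C by (intro divide_right_mono) auto
    moreover have "r / C = r / (2 * C) + r / (2 * C)" by simp
    moreover have "1 / (2 * C) \<le> C * r"
    proof -
      have "1 / (2 * C) \<le> 1" using C by simp
      also have "1 \<le> C * r" using C r1 by (metis mult_mono mult_1 zero_le_one order_trans)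
      finally show ?thesis .
    qed
    ultimately show ?thesis using c e' unfolding r_def[symmetric] by (auto simp: abs_le_iff)
  qed
  show False
  proof (cases "\<rho> = 1")
    case True
    \<comment> \<open>For \<open>\<rho> = 1\<close> the lower bound in \<open>est\<close> is
      \<open>2 * card F / (2 * C)\<close>, which gives \<open>c = 1 / C\<close>. The norm bound 3
      comes from two unit vectors and an error of at most 1.\<close>
    show False
    proof (rule no_l1_blocks[OF w _ bf ge])
      fix k
      have "N (w k) = norm (T (w k))" using T_norm[OF w] by simp
      also have "\<dots> \<le> norm (T (w k) - (x (p k) - x (q k))) + norm (x (p k) - x (q k))"
        using norm_triangle_sub[of "T (w k)" "x (p k) - x (q k)"] by simp
      also have "\<dots> \<le> \<eta> * (1/2) ^ k + (norm (x (p k)) + norm (x (q k)))"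
        by (intro add_mono err norm_triangle_ineq4)
      also have "\<dots> \<le> 1 * 1 + (1 + 1)"
        using x[of "p k"] x[of "q k"] pq(1)[of k] pq(2)[of k] \<eta> by (intro add_mono mult_mono power_le_one) auto
      finally show "N (w k) \<le> 3" by simp
    next
      show "1 / C > 0" using C by simp
      fix F :: "nat set" assume F: "finite F" "F \<noteq> {}" "\<And>k. k \<in> F \<Longrightarrow> 2 * card F \<le> k"
      then show "1 / C * real (card F) \<le> N (\<lambda>n. \<Sum>k\<in>F. w k n)"
        using est[OF F] True by simp
    qed
  next
    case False
    then have \<rho>1: "0 < 1 - \<rho>" using \<rho> by simp
    \<comment> \<open>With \<open>M = nseq (2 * j)\<close> and \<open>m = mseq (2 * j)\<close>, the
      lower and upper estimates give \<open>M / (2 * C * m) \<le> 4 * C * M powr \<rho>\<close>,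
      that is \<open>M powr (1 - \<rho>) \<le> 8 * C^2 * m\<close>.\<close>
    obtain j where j: "j \<ge> 1" "8 * C\<^sup>2 * real (mseq (2 * j)) < real (nseq (2 * j)) powr (1 - \<rho>)"
      using nseq_power_dominates[OF \<rho>1] by blast
    define M where "M = nseq (2 * j)"
    define m where "m = real (mseq (2 * j))"
    have M: "M \<ge> 1" using nseq_pos[of "2*j"] j(1) unfolding M_def by simp
    have m: "m > 0" using mseq_pos[of "2*j"] j(1) unfolding m_def by simp
    \<comment> \<open>\<open>M\<close> blocks, numbered from \<open>2 * M\<close> on as
      \<open>est\<close> requires.\<close>
    define F where "F = {2 * M..<3 * M}"
    have F: "finite F" "F \<noteq> {}" "card F = M" unfolding F_def using M by auto
    have low: "1 / (2 * C) \<le> N (w k)" if "k \<in> F" for k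
    proof -
      have "2 * card {k} \<le> k" using that M unfolding F_def by simp
      then have "2 powr \<rho> / (2 * C) \<le> N (w k)" using est[of "{k}"] by simp
      moreover have "1 / (2 * C) \<le> 2 powr \<rho> / (2 * C)"
        using \<rho>(1) C by (intro divide_right_mono ge_one_powr_ge_zero) auto
      ultimately show ?thesis by linarith
    qed
    have "1 / (2 * C) * real M / m \<le> N (\<lambda>n. \<Sum>k\<in>F. w k n)"
      using even_op_lower[OF F(1,2) _ j(1) w low bf] F(3) unfolding M_def m_def by simp
    also have "\<dots> \<le> 2 * C * (2 * real M) powr \<rho>"
      using est[OF F(1,2)] F(3) unfolding F_def by auto
    also have "\<dots> \<le> 2 * C * (2 * real M powr \<rho>)"
    proof (rule mult_left_mono)
      have "(2::real) powr \<rho> \<le> 2 powr 1" using \<rho> by (intro powr_mono) auto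
      then show "(2 * real M) powr \<rho> \<le> 2 * real M powr \<rho>" by (simp add: powr_mult mult_right_mono)
    qed (use C in simp)
    finally have "real M \<le> 8 * C\<^sup>2 * m * real M powr \<rho>"
      using C m by (simp add: field_simps power2_eq_square)
    moreover have "real M = real M powr (1 - \<rho>) * real M powr \<rho>"
      using M by (simp flip: powr_add)
    moreover have "real M powr \<rho> > 0" using M by simp
    ultimately have "real M powr (1 - \<rho>) \<le> 8 * C\<^sup>2 * m"
      by (metis mult_le_cancel_right_pos)
    then show False using j(2) unfolding M_def m_def by linarith
  qed
qed

end

theorem corollary11p7:
  fixes \<xi> :: omega1 and L :: "omega1 \<Rightarrow> nat \<Rightarrow> omega1"
    and M1 M2 N1 N2 :: "nat set" and \<Lambda> :: "nat \<Rightarrow> nat set"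
    and \<sigma>1 \<sigma> :: "(nat \<Rightarrow> real) list \<Rightarrow> nat"
    and T :: "(nat \<Rightarrow> real) \<Rightarrow> 'a::banach" and X :: "'a set"
  assumes "ladder_system L"
    and "partition_pair M1 M2" and "coding1 M2 \<sigma>1"
    and "partition_family \<Lambda>"
    and "partition_pair N1 N2" and "coding N2 \<sigma>"
    and "is_completion (norm_of (Kset L \<xi> M1 \<sigma>1 \<Lambda> N1 \<sigma>)) T X"
  shows "(\<forall>p\<ge>1. \<not> admits_lp_spreading_model X p) \<and> \<not> admits_c0_spreading_model X"
proof -
  interpret attractor_completion L \<xi> M1 M2 N1 \<sigma>1 \<sigma> \<Lambda> T X
    by unfold_locales (rule assms)+
  have "\<not> admits_lp_spreading_model X p" if "p \<ge> 1" for p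
    unfolding admits_lp_spreading_model_def
  proof (rule no_spreading_model[where \<rho> = "1 / p"])
    fix F :: "nat set" and a :: "nat \<Rightarrow> real"
    assume "finite F" "F \<noteq> {}" and a: "\<And>i. i \<in> F \<Longrightarrow> \<bar>a i\<bar> = 1"
    then show "lp_norm p F a = real (card F) powr (1 / p)" unfolding lp_norm_def by simp
  qed (use that in auto)
  moreover have "\<not> admits_c0_spreading_model X"
    unfolding admits_c0_spreading_model_def
  proof (rule no_spreading_model[where \<rho> = 0])
    fix F :: "nat set" and a :: "nat \<Rightarrow> real"
    assume F: "finite F" "F \<noteq> {}" and a: "\<And>i. i \<in> F \<Longrightarrow> \<bar>a i\<bar> = 1"
    have "(\<lambda>i. \<bar>a i\<bar>) ` F = {1}" using a F by (auto simp: image_iff)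
    then have "linf_norm F a = 1" unfolding linf_norm_def by simp
    then show "linf_norm F a = real (card F) powr 0" using F by (simp add: card_gt_0_iff)
  qed auto
  ultimately show ?thesis by blast
qed

end
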